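(* Let $R$ be a relation over the universe of $\mathcal{P}^W(\Delta_1)$. If $R$ is definable in some $\Delta_2$-presentation $f$ of $\mathcal{P}^W(\Delta_1)$, then $R$ is definable in every $\Delta_2$-presentation of $\mathcal{P}^W(\Delta_1)$.
   Context: $\Delta_1$ is the unlabeled tree with domain $0^*$, identified with $(\mathbb{N},\mathit{succ})$; $\Delta_2$ is the unlabeled tree with domain $\{0,1\}^*$ (the infinite binary tree) with binary relations $S_i(u,v)\iff v=ui$ ($i=0,1$). WMSO is MSO with set variables ranging over finite sets. The weak powerset $\mathcal{P}^W(\mathcal{T})$ of a structure $\mathcal{T}$ of signature $\Sigma$ is the structure of signature $\Sigma\cup\{\preceq\}$ whose universe is the set of finite subsets of the universe of $\mathcal{T}$, in which each $R\in\Sigma$ holds of a tuple of singletons $(\{u_1\},\dots,\{u_r\})$ iff $R(u_1,\dots,u_r)$ holds in $\mathcal{T}$ (and of no other tuples), and $\preceq$ is inclusion. Given a structure $\mathcal{T}$, a $\mathcal{T}$-presentation of a structure $\mathcal{S}$ with universe $\mathcal{U}$ is an injection $f$ from $\mathcal{U}$ into the finite subsets of the universe of $\mathcal{T}$ such that $f(\mathcal{U})$ is WMSO-definable in $\mathcal{T}$ and for each relation $R$ of $\mathcal{S}$ of arity $r$ there is a WMSO formula $\phi_R(X_1,\dots,X_r)$ over $\mathcal{T}$ with $(u_1,\dots,u_r)\in R$ iff $\mathcal{T}\models\phi_R(f(u_1),\dots,f(u_r))$. A relation $R'$ on $\mathcal{U}$ is definable in $f$ if $f$ is also a $\mathcal{T}$-presentation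 of $\mathcal{S}$ expanded by $R'$. *)

theory Defs
  imports Main
begin

section \<open>Relational structures\<close>

record ('r, 'a) struct =
  univ :: "'a set"
  arity :: "'r \<Rightarrow> nat"
  interp :: "'r \<Rightarrow> 'a list set"

definition tuples :: "nat \<Rightarrow> 'a set \<Rightarrow> 'a list set" where
  "tuples n A = {us. length us = n \<and> set us \<subseteq> A}"

definition is_structure :: "('r, 'a) struct \<Rightarrow> bool" where
  "is_structure T \<longleftrightarrow> univ T \<noteq> {} \<and> (\<forall>r. interp T r \<subseteq> tuples (arity T r) (univ T))"

datatype 'r expand_sym = Old 'r | New

text \<open>The expansion of a structure by one further relation \<open>R\<close> of arity \<open>k\<close>.\<close>

definition expand :: "('r, 'a) struct \<Rightarrow> nat \<Rightarrow> 'a list set \<Rightarrow> ('r expand_sym, 'a) struct" where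
  "expand S k R = \<lparr>
     univ = univ S,
     arity = (\<lambda>s. case s of Old r \<Rightarrow> arity S r | New \<Rightarrow> k),
     interp = (\<lambda>s. case s of Old r \<Rightarrow> interp S r | New \<Rightarrow> R)\<rparr>"


section \<open>Weak monadic second-order logic\<close>

text \<open>
  Individual variables and set variables are two separate sorts, both named by
  natural numbers.  An atom \<open>Atom r xs\<close> whose argument list does not have the
  length prescribed by the arity of \<open>r\<close> is false in every structure
  satisfying \<^const>\<open>is_structure\<close>, so no separate arity check is imposed on formulas.
\<close>

datatype 'r wmso =
    Atom 'r "nat list"
  | Eq nat nat
  | Mem nat nat
  | Neg "'r wmso"
  | Conj "'r wmso" "'r wmso"
  | ExElem nat "'r wmso"
  | ExSet nat "'r wmso"

primrec free_elem :: "'r wmso \<Rightarrow> nat set" where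
  "free_elem (Atom r xs) = set xs"
| "free_elem (Eq x y) = {x, y}"
| "free_elem (Mem x X) = {x}"
| "free_elem (Neg \<phi>) = free_elem \<phi>"
| "free_elem (Conj \<phi> \<psi>) = free_elem \<phi> \<union> free_elem \<psi>"
| "free_elem (ExElem x \<phi>) = free_elem \<phi> - {x}"
| "free_elem (ExSet X \<phi>) = free_elem \<phi>"

primrec free_set :: "'r wmso \<Rightarrow> nat set" where
  "free_set (Atom r xs) = {}"
| "free_set (Eq x y) = {}"
| "free_set (Mem x X) = {X}"
| "free_set (Neg \<phi>) = free_set \<phi>"
| "free_set (Conj \<phi> \<psi>) = free_set \<phi> \<union> free_set \<psi>"
| "free_set (ExElem x \<phi>) = free_set \<phi>"
| "free_set (ExSet X \<phi>) = free_set \<phi> - {X}"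

primrec sat :: "('r, 'a) struct \<Rightarrow> (nat \<Rightarrow> 'a) \<Rightarrow> (nat \<Rightarrow> 'a set) \<Rightarrow> 'r wmso \<Rightarrow> bool" where
  "sat T e E (Atom r xs) \<longleftrightarrow> map e xs \<in> interp T r"
| "sat T e E (Eq x y) \<longleftrightarrow> e x = e y"
| "sat T e E (Mem x X) \<longleftrightarrow> e x \<in> E X"
| "sat T e E (Neg \<phi>) \<longleftrightarrow> \<not> sat T e E \<phi>"
| "sat T e E (Conj \<phi> \<psi>) \<longleftrightarrow> sat T e E \<phi> \<and> sat T e E \<psi>"
| "sat T e E (ExElem x \<phi>) \<longleftrightarrow> (\<exists>a\<in>univ T. sat T (e(x := a)) E \<phi>)"
| "sat T e E (ExSet X \<phi>) \<longleftrightarrow> (\<exists>A\<in>Fpow (univ T). sat T e (E(X := A)) \<phi>)"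

text \<open>
  \<open>set_formula n \<phi>\<close>: \<open>\<phi>\<close> is a formula \<open>\<phi>(X\<^sub>0, \<dots>, X\<^bsub>n-1\<^esub>)\<close>, i.e. its free variables are
  among these set variables.  For such \<open>\<phi>\<close> the values that \<open>holds\<close> gives to all other
  variables are irrelevant.
\<close>

definition set_formula :: "nat \<Rightarrow> 'r wmso \<Rightarrow> bool" where
  "set_formula n \<phi> \<longleftrightarrow> free_elem \<phi> = {} \<and> free_set \<phi> \<subseteq> {..<n}"

definition holds :: "('r, 'a) struct \<Rightarrow> 'r wmso \<Rightarrow> 'a set list \<Rightarrow> bool" where
  "holds T \<phi> As \<longleftrightarrow> sat T (\<lambda>_. undefined) (\<lambda>i. if i < length As then As ! i else {}) \<phi>"

lemma sat_cong:
  assumes "\<And>x. x \<in> free_elem \<phi> \<Longrightarrow> e x = e' x"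
    and "\<And>X. X \<in> free_set \<phi> \<Longrightarrow> E X = E' X"
  shows "sat T e E \<phi> \<longleftrightarrow> sat T e' E' \<phi>"
  using assms
proof (induction \<phi> arbitrary: e e' E E')
  case (Atom r xs)
  then have "map e xs = map e' xs" by simp
  then show ?case by (simp only: sat.simps)
next
  case (Conj \<phi> \<psi>)
  have "sat T e E \<phi> = sat T e' E' \<phi>" by (rule Conj.IH) (simp_all add: Conj.prems)
  moreover have "sat T e E \<psi> = sat T e' E' \<psi>" by (rule Conj.IH) (simp_all add: Conj.prems)
  ultimately show ?case by simp
next
  case (Neg \<phi>)
  have "sat T e E \<phi> = sat T e' E' \<phi>" by (rule Neg.IH) (simp_all add: Neg.prems)
  then show ?case by simp
next
  case (ExElem x \<phi>)
  have "sat T (e(x := a)) E \<phi> = sat T (e'(x := a)) E' \<phi>" for a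
    by (rule ExElem.IH) (simp_all add: ExElem.prems)
  then show ?case by simp
next
  case (ExSet X \<phi>)
  have "sat T e (E(X := A)) \<phi> = sat T e' (E'(X := A)) \<phi>" for A
    by (rule ExSet.IH) (simp_all add: ExSet.prems)
  then show ?case by simp
qed simp_all

definition wmso_definable :: "('r, 'a) struct \<Rightarrow> 'a set set \<Rightarrow> bool" where
  "wmso_definable T F \<longleftrightarrow>
     (\<exists>\<phi>. set_formula 1 \<phi> \<and> (\<forall>A\<in>Fpow (univ T). A \<in> F \<longleftrightarrow> holds T \<phi> [A]))"


section \<open>Presentations and definability in a presentation\<close>

definition presentation :: "('r, 'a) struct \<Rightarrow> ('s, 'u) struct \<Rightarrow> ('u \<Rightarrow> 'a set) \<Rightarrow> bool" where
  "presentation T S f \<longleftrightarrow>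
     inj_on f (univ S) \<and> f ` univ S \<subseteq> Fpow (univ T) \<and>
     wmso_definable T (f ` univ S) \<and>
     (\<forall>s. \<exists>\<phi>. set_formula (arity S s) \<phi> \<and>
        (\<forall>us\<in>tuples (arity S s) (univ S). us \<in> interp S s \<longleftrightarrow> holds T \<phi> (map f us)))"

definition definable_in ::
  "('r, 'a) struct \<Rightarrow> ('s, 'u) struct \<Rightarrow> ('u \<Rightarrow> 'a set) \<Rightarrow> nat \<Rightarrow> 'u list set \<Rightarrow> bool" where
  "definable_in T S f k R \<longleftrightarrow> presentation T (expand S k R) f"


section \<open>The weak powerset and the trees \<open>\<Delta>\<^sub>1\<close> and \<open>\<Delta>\<^sub>2\<close>\<close>

datatype 'r powerset_sym = Base 'r | Incl

definition weak_powerset :: "('r, 'a) struct \<Rightarrow> ('r powerset_sym, 'a set) struct" where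
  "weak_powerset T = \<lparr>
     univ = Fpow (univ T),
     arity = (\<lambda>s. case s of Base r \<Rightarrow> arity T r | Incl \<Rightarrow> 2),
     interp = (\<lambda>s. case s of
         Base r \<Rightarrow> {map (\<lambda>u. {u}) us | us. us \<in> interp T r}
       | Incl \<Rightarrow> {[A, B] | A B. A \<in> Fpow (univ T) \<and> B \<in> Fpow (univ T) \<and> A \<subseteq> B})\<rparr>"

datatype succ_sym = Succ

definition Delta1 :: "(succ_sym, nat) struct" where
  "Delta1 = \<lparr>
     univ = UNIV,
     arity = (\<lambda>_. 2),
     interp = (\<lambda>_. {[n, Suc n] | n. True})\<rparr>"

text \<open>
  Words over \<open>{0,1}\<close> are Boolean lists, \<^const>\<open>False\<close> standing for the letter 0 and
  \<^const>\<open>True\<close> for 1.  As in the defining condition \<open>S\<^sub>i(u,v) \<longleftrightarrow> v = ui\<close>, the letter is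
  appended at the end of the word.
\<close>

datatype child_sym = S0 | S1

definition Delta2 :: "(child_sym, bool list) struct" where
  "Delta2 = \<lparr>
     univ = UNIV,
     arity = (\<lambda>_. 2),
     interp = (\<lambda>s. case s of
         S0 \<Rightarrow> {[u, v] | u v. v = u @ [False]}
       | S1 \<Rightarrow> {[u, v] | u v. v = u @ [True]})\<rparr>"

lemma is_structure_expand:
  "is_structure S \<Longrightarrow> R \<subseteq> tuples k (univ S) \<Longrightarrow> is_structure (expand S k R)"
  by (auto simp: is_structure_def expand_def split: expand_sym.split)

lemma is_structure_weak_powerset:
  assumes "is_structure T"
  shows "is_structure (weak_powerset T)"
proof -
  have "map (\<lambda>u. {u}) us \<in> tuples (arity T r) (Fpow (univ T))" if "us \<in> interp T r" for r us
    using assms that by (fastforce simp: is_structure_def tuples_def Fpow_def)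
  moreover have "{} \<in> Fpow (univ T)" by (simp add: Fpow_def)
  ultimately show ?thesis
    by (auto simp: is_structure_def weak_powerset_def tuples_def split: powerset_sym.split) blast
qed

lemma is_structure_Delta1: "is_structure Delta1"
  by (auto simp: is_structure_def Delta1_def tuples_def)

lemma is_structure_Delta2: "is_structure Delta2"
  by (auto simp: is_structure_def Delta2_def tuples_def split: child_sym.split)

end

theory Submission
  imports Defs "HOL-Library.Sublist" "HOL-Library.Infinite_Set"
begin

text \<open>
  Every presentation turns formulas over \<open>\<Delta>\<^sub>1\<close> into formulas over
  \<open>\<Delta>\<^sub>2\<close>, so it suffices that a relation \<open>R\<close> definable in
  \<open>f\<close> is regular, i.e. has finitely many residuals when tuples of finite sets of
  numbers are read as words. The difficulty is that \<open>f {n}\<close> may contain a lot of junk.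
  Say that a region of the tree sees a position \<open>d\<close> if, for a fixed reference code,
  some code that differs from it only in that region represents a set whose first difference from
  the reference set is \<open>d\<close>. Counting the \<open>2\<^sup>m\<close> codes of subsets of a
  set of \<open>m\<close> positions shows that the regions of a partition into a subtree (or two
  sibling subtrees) and the rest together see all but boundedly many positions, while two disjoint
  regions cannot see long alternating sequences of positions, since they exchange only finitely many
  types. Hence the leftmost deepest node whose subtree sees sufficiently many positions of a block
  starting at \<open>n\<close> is a definable function \<open>h\<close> of \<open>n\<close> with
  bounded fibres. For each depth, \<open>h n\<close> eventually stays below one node of that depth,
  and two such nodes with the same context type make \<open>h\<close> periodic. This bounds the
  number of residuals of \<open>R\<close>.
\<close>

section \<open>Recognizable predicates on finite sets of nodes\<close>

text \<open>Residuals mention neither the tree nor a presentation; this is why they can carry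
  \<open>R\<close> across: their number is bounded by means of \<open>f\<close>, and the automaton
  they form is then expressed by means of \<open>g\<close>. First differences suit the counting
  because every large family of codes yields many of them and because comparing two of them uses
  only the order of the numbers, which every presentation defines. For a node of
  \<open>f {n}\<close> merely picked by a formula, nothing bounds the number of \<open>n\<close>
  that share it. A node whose subtree sees much of a block while neither child does is better: both
  its subtree and the complement must then see a position of that block, so sharing such a node
  among many separate blocks would produce a long alternation. Bounded fibres matter because
  \<open>h n\<close> together with the rank of \<open>n\<close> in its fibre determines
  \<open>n\<close>. A set of numbers can thus be recoded by finitely many sets of nodes that contain
  no junk, and order and successor become definable relations between recoded numbers.\<close>

definition sub :: "'a list \<Rightarrow> 'a list set \<Rightarrow> 'a list set" where
  "sub v A = {w. v @ w \<in> A}"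

definition eqout :: "'a list \<Rightarrow> 'a list set \<Rightarrow> 'a list set \<Rightarrow> bool" where
  "eqout v A B \<longleftrightarrow> (\<forall>u. \<not> prefix v u \<longrightarrow> (u \<in> A \<longleftrightarrow> u \<in> B))"

abbreviation finenv :: "('i \<Rightarrow> 'a set) \<Rightarrow> bool" where
  "finenv E \<equiv> \<forall>i. finite (E i)"

text \<open>Instead of automata: finitely many types of subtree contents suffice to decide \<open>P\<close> in every
  context, in the style of Myhill and Nerode.\<close>

definition decides :: "(('i \<Rightarrow> bool list set) \<Rightarrow> 'q) \<Rightarrow> (('i \<Rightarrow> bool list set) \<Rightarrow> bool) \<Rightarrow> bool" where
  "decides t P \<longleftrightarrow> finite (range t) \<and>
     (\<forall>v E E'. finenv E \<longrightarrow> finenv E' \<longrightarrow> (\<forall>i. eqout v (E i) (E' i)) \<longrightarrow>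
        t (\<lambda>i. sub v (E i)) = t (\<lambda>i. sub v (E' i)) \<longrightarrow> P E \<longrightarrow> P E')"

definition recognizable :: "(('i \<Rightarrow> bool list set) \<Rightarrow> bool) \<Rightarrow> bool" where
  "recognizable P \<longleftrightarrow> (\<exists>t :: ('i \<Rightarrow> bool list set) \<Rightarrow> nat. decides t P)"

lemma eqout_sym: "eqout v A B \<Longrightarrow> eqout v B A"
  by (auto simp: eqout_def)

lemma eqout_refl [simp]: "eqout v A A"
  by (auto simp: eqout_def)

lemma sub_iff [simp]: "w \<in> sub v A \<longleftrightarrow> v @ w \<in> A"
  by (simp add: sub_def)

lemma finite_sub [simp]: "finite A \<Longrightarrow> finite (sub v A)"
  unfolding sub_def by (rule finite_subset[of _ "drop (length v) ` A"]) (auto intro: rev_image_eqI)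

lemma eqout_subI:
  assumes "eqout v A B" "sub v A = sub v B"
  shows "A = B"
proof -
  have "u \<in> A \<longleftrightarrow> u \<in> B" for u
    using assms by (cases "prefix v u") (auto simp: eqout_def sub_def prefix_def)
  then show ?thesis by blast
qed

lemma eqout_singletonD:
  assumes "eqout v {v @ y} B" "sub v B = {z}"
  shows "B = {v @ z}"
proof -
  have "u \<in> B \<longleftrightarrow> u = v @ z" for u
  proof (cases "prefix v u")
    case True
    then obtain w where "u = v @ w" by (auto simp: prefix_def)
    moreover have "w \<in> sub v B \<longleftrightarrow> w = z" using assms(2) by simp
    ultimately show ?thesis by simp
  next
    case False
    then have "u \<noteq> v @ y" "u \<noteq> v @ z" by auto
    then show ?thesis using assms(1) False by (simp add: eqout_def)
  qed
  then show ?thesis by blast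
qed

lemma sub_singleton_other: "\<not> prefix v x \<Longrightarrow> sub v {x} = {}"
  by (auto simp: sub_def)

lemma decidesI:
  assumes "finite (range t)"
    and "\<And>v E E'. finenv E \<Longrightarrow> finenv E' \<Longrightarrow> (\<And>i. eqout v (E i) (E' i)) \<Longrightarrow>
        t (\<lambda>i. sub v (E i)) = t (\<lambda>i. sub v (E' i)) \<Longrightarrow> P E \<Longrightarrow> P E'"
  shows "decides t P"
  unfolding decides_def using assms by presburger

lemma decidesD:
  assumes "decides t P" "finenv E" "finenv E'" "\<And>i. eqout v (E i) (E' i)"
    "t (\<lambda>i. sub v (E i)) = t (\<lambda>i. sub v (E' i))"
  shows "P E \<longleftrightarrow> P E'"
proof
  show "P E \<Longrightarrow> P E'" using assms unfolding decides_def by presburger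
  have "\<And>i. eqout v (E' i) (E i)" using assms(4) by (rule eqout_sym)
  then show "P E' \<Longrightarrow> P E" using assms unfolding decides_def by metis
qed

lemma decides_finite: "decides t P \<Longrightarrow> finite (range t)"
  by (simp add: decides_def)

text \<open>Only equality of types is ever used, so a finite space of types can be renamed into the
  natural numbers. \<open>recognizable\<close> fixes \<open>nat\<close> because a definition cannot
  quantify over a type.\<close>

lemma decides_recognizable:
  fixes t :: "('i \<Rightarrow> bool list set) \<Rightarrow> 'q"
  assumes "decides t P"
  shows "recognizable P"
proof -
  have fin: "finite (range t)" using assms by (rule decides_finite)
  obtain enc :: "'q \<Rightarrow> nat" where enc: "inj_on enc (range t)"
    using finite_imp_inj_to_nat_seg[OF fin] by blast
  have "finite (range (enc \<circ> t))"
    using fin by (metis finite_imageI image_comp)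
  then have "decides (enc \<circ> t) P"
  proof (rule decidesI)
    fix v E E' assume "finenv E" "finenv E'" "\<And>i. eqout v (E i) (E' i)" and
      "(enc \<circ> t) (\<lambda>i. sub v (E i)) = (enc \<circ> t) (\<lambda>i. sub v (E' i))" and "P E"
    then show "P E'"
      using enc decidesD[OF assms, of E E' v] by (auto dest: inj_onD)
  qed
  then show ?thesis unfolding recognizable_def by blast
qed

lemma recognizableE:
  assumes "recognizable P"
  obtains t :: "('i \<Rightarrow> bool list set) \<Rightarrow> nat" where "decides t P"
  using assms unfolding recognizable_def by blast

lemma finite_range_Pair:
  assumes "finite (range s)" "finite (range t)"
  shows "finite (range (\<lambda>x. (s x, t x)))"
  by (rule finite_subset[of _ "range s \<times> range t"]) (use assms in auto)

section \<open>Closure properties and basic recognizable predicates\<close>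

lemma recognizable_not: "recognizable P \<Longrightarrow> recognizable (\<lambda>E. \<not> P E)"
proof (erule recognizableE)
  fix t :: "('a \<Rightarrow> bool list set) \<Rightarrow> nat" assume t: "decides t P"
  have "decides t (\<lambda>E. \<not> P E)"
    using decides_finite[OF t] by (rule decidesI) (use decidesD[OF t] in blast)
  then show ?thesis by (rule decides_recognizable)
qed

lemma recognizable_conj:
  assumes "recognizable P" "recognizable Q"
  shows "recognizable (\<lambda>E. P E \<and> Q E)"
proof -
  obtain s :: "('a \<Rightarrow> bool list set) \<Rightarrow> nat" where s: "decides s P"
    using assms(1) by (rule recognizableE)
  obtain t :: "('a \<Rightarrow> bool list set) \<Rightarrow> nat" where t: "decides t Q"
    using assms(2) by (rule recognizableE)
  have "decides (\<lambda>E. (s E, t E)) (\<lambda>E. P E \<and> Q E)"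
  proof (rule decidesI[OF finite_range_Pair[OF decides_finite[OF s] decides_finite[OF t]]])
    fix v E E' assume *: "finenv E" "finenv E'" "\<And>i. eqout v (E i) (E' i)"
      "(s (\<lambda>i. sub v (E i)), t (\<lambda>i. sub v (E i))) = (s (\<lambda>i. sub v (E' i)), t (\<lambda>i. sub v (E' i)))"
      "P E \<and> Q E"
    then show "P E' \<and> Q E'"
      using decidesD[OF s *(1,2,3)] decidesD[OF t *(1,2,3)] by simp
  qed
  then show ?thesis by (rule decides_recognizable)
qed

lemma recognizable_const: "recognizable (\<lambda>E. b)"
  by (rule decides_recognizable[of "\<lambda>_. ()"]) (rule decidesI, auto)

lemma recognizable_ball:
  assumes "finite S" "\<And>x. x \<in> S \<Longrightarrow> recognizable (P x)"
  shows "recognizable (\<lambda>E. \<forall>x\<in>S. P x E)"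
  using assms by (induction rule: finite_induct) (auto intro: recognizable_conj recognizable_const)

lemma recognizable_subst:
  assumes "recognizable P"
  shows "recognizable (\<lambda>E. P (\<lambda>i. E (\<tau> i)))"
proof -
  obtain t :: "('a \<Rightarrow> bool list set) \<Rightarrow> nat" where t: "decides t P"
    using assms by (rule recognizableE)
  have "decides (\<lambda>E. t (\<lambda>i. E (\<tau> i))) (\<lambda>E. P (\<lambda>i. E (\<tau> i)))"
  proof (rule decidesI)
    show "finite (range (\<lambda>E. t (\<lambda>i. E (\<tau> i))))"
      by (rule finite_subset[OF _ decides_finite[OF t]]) auto
  next
    fix v E E' assume "finenv E" "finenv E'" "\<And>i. eqout v (E i) (E' i)"
      "t (\<lambda>i. sub v (E (\<tau> i))) = t (\<lambda>i. sub v (E' (\<tau> i)))" "P (\<lambda>i. E (\<tau> i))"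
    then show "P (\<lambda>i. E' (\<tau> i))"
      using decidesD[OF t, of "\<lambda>i. E (\<tau> i)" "\<lambda>i. E' (\<tau> i)" v] by simp
  qed
  then show ?thesis by (rule decides_recognizable)
qed

lemma sub_combine:
  "sub v {u. if prefix v u then drop (length v) u \<in> A else u \<in> B} = A"
  by (auto simp: sub_def)

lemma finite_combine:
  assumes "finite A" "finite B"
  shows "finite {u. if prefix v u then drop (length v) u \<in> A else u \<in> B}"
  by (rule finite_subset[of _ "(@) v ` A \<union> B"]) (use assms in \<open>auto simp: prefix_def split: if_splits\<close>)

text \<open>The powerset construction: the new type of \<open>E\<close> is the set of all old types
  that arise when \<open>E\<close> is completed by finite sets \<open>F\<close>.\<close>

lemma recognizable_ex:
  fixes P :: "('i + 'j \<Rightarrow> bool list set) \<Rightarrow> bool"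
  assumes "recognizable P"
  shows "recognizable (\<lambda>E. \<exists>F. finenv F \<and> P (case_sum E F))"
proof -
  obtain t :: "('i + 'j \<Rightarrow> bool list set) \<Rightarrow> nat" where t: "decides t P"
    using assms by (rule recognizableE)
  define s where "s E = {t (case_sum E F) | F. finenv F}" for E
  have *: "(\<lambda>i. sub v (case_sum E F i)) = case_sum (\<lambda>i. sub v (E i)) (\<lambda>i. sub v (F i))"
    for v E F by (rule ext) (simp split: sum.split)
  have "decides s (\<lambda>E. \<exists>F. finenv F \<and> P (case_sum E F))"
  proof (rule decidesI)
    have "range s \<subseteq> Pow (range t)" by (auto simp: s_def)
    then show "finite (range s)" using decides_finite[OF t] by (simp add: finite_subset)
    fix v E E' assume fin: "finenv E" "finenv E'" and eo: "\<And>i. eqout v (E i) (E' i)"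
      and eq: "s (\<lambda>i. sub v (E i)) = s (\<lambda>i. sub v (E' i))"
      and "\<exists>F. finenv F \<and> P (case_sum E F)"
    then obtain F where F: "finenv F" "P (case_sum E F)" by blast
    have "t (case_sum (\<lambda>i. sub v (E i)) (\<lambda>i. sub v (F i))) \<in> s (\<lambda>i. sub v (E i))"
      unfolding s_def using F by auto
    then obtain G where G: "finenv G"
      "t (case_sum (\<lambda>i. sub v (E i)) (\<lambda>i. sub v (F i))) = t (case_sum (\<lambda>i. sub v (E' i)) G)"
      unfolding eq unfolding s_def by blast
    \<comment> \<open>The old witness is kept outside the subtree at \<open>v\<close>, and the
      witness \<open>G\<close> realizing the same type is grafted inside it.\<close>
    define F' where "F' i = {u. if prefix v u then drop (length v) u \<in> G i else u \<in> F i}" for i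
    have F': "finenv F'" unfolding F'_def using finite_combine F G by blast
    have sF': "(\<lambda>i. sub v (F' i)) = G" unfolding F'_def sub_combine ..
    have "P (case_sum E F) \<longleftrightarrow> P (case_sum E' F')"
    proof (rule decidesD[OF t, of _ _ v])
      show "eqout v (case_sum E F i) (case_sum E' F' i)" for i
        using eo by (cases i) (simp_all add: eqout_def F'_def)
      show "finenv (case_sum E F)" "finenv (case_sum E' F')"
        using fin F(1) F' by (simp_all split: sum.split)
      show "t (\<lambda>i. sub v (case_sum E F i)) = t (\<lambda>i. sub v (case_sum E' F' i))"
        unfolding * sF' by (rule G(2))
    qed
    then show "\<exists>F. finenv F \<and> P (case_sum E' F)" using F F' by blast
  qed
  then show ?thesis by (rule decides_recognizable)
qed

text \<open>Overwriting coordinate \<open>i\<close> amounts to the renaming \<open>?\<tau>\<close>,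
  which reads that coordinate from an extra summand; projecting the summand away gives the
  quantifier.\<close>

lemma recognizable_ex_update:
  assumes "recognizable P"
  shows "recognizable (\<lambda>E. \<exists>A. finite A \<and> P (E(i := A)))"
proof -
  let ?\<tau> = "\<lambda>j. if j = i then Inr () else Inl j"
  have "recognizable (\<lambda>E. \<exists>F :: unit \<Rightarrow> bool list set. finenv F \<and> P (\<lambda>j. case_sum E F (?\<tau> j)))"
    by (rule recognizable_ex) (rule recognizable_subst[OF assms])
  moreover have "(\<lambda>j. case_sum E F (?\<tau> j)) = E(i := F ())" for E and F :: "unit \<Rightarrow> bool list set"
    by (rule ext) simp
  moreover have "(\<exists>F :: unit \<Rightarrow> bool list set. finenv F \<and> P (E(i := F ()))) \<longleftrightarrow>
      (\<exists>A. finite A \<and> P (E(i := A)))" for E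
  proof
    assume "\<exists>A. finite A \<and> P (E(i := A))"
    then obtain A where "finite A" "P (E(i := A))" by blast
    then show "\<exists>F :: unit \<Rightarrow> bool list set. finenv F \<and> P (E(i := F ()))"
      by (intro exI[of _ "\<lambda>_. A"]) simp
  qed blast
  ultimately show ?thesis by simp
qed

lemma recognizable_subset: "recognizable (\<lambda>E. E i \<subseteq> E j)"
proof (rule decides_recognizable[of "\<lambda>E. E i \<subseteq> E j"], rule decidesI)
  fix v and E E' :: "'a \<Rightarrow> bool list set"
  assume *: "\<And>i. eqout v (E i) (E' i)"
    "(sub v (E i) \<subseteq> sub v (E j)) = (sub v (E' i) \<subseteq> sub v (E' j))" "E i \<subseteq> E j"
  then have s: "sub v (E' i) \<subseteq> sub v (E' j)" by auto
  show "E' i \<subseteq> E' j"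
  proof
    fix u assume "u \<in> E' i"
    then show "u \<in> E' j"
      using s *(1)[of i] *(1)[of j] *(3)
      by (cases "prefix v u") (auto simp: eqout_def prefix_def)
  qed
qed simp

text \<open>The component \<open>E j = {[]}\<close> of the type deals with an edge that crosses the
  boundary: if the child is \<open>v\<close> itself, its parent lies outside the subtree, and the
  subtree must remember that exactly its root is marked.\<close>

lemma recognizable_child: "recognizable (\<lambda>E. \<exists>x. E i = {x} \<and> E j = {x @ [b]})"
proof -
  let ?c = "\<lambda>E. \<exists>x. E i = {x} \<and> E j = {x @ [b]}"
  let ?t = "\<lambda>E :: 'a \<Rightarrow> bool list set. (E i = {}, E j = {}, E j = {[]}, ?c E)"
  show ?thesis
  proof (rule decides_recognizable[of ?t], rule decidesI)
    show "finite (range ?t)" by simp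
    fix v and E E' :: "'a \<Rightarrow> bool list set"
    assume eo: "\<And>i. eqout v (E i) (E' i)"
      and t: "?t (\<lambda>i. sub v (E i)) = ?t (\<lambda>i. sub v (E' i))" and c: "?c E"
    from c obtain x where x: "E i = {x}" "E j = {x @ [b]}" by blast
    have t': "sub v (E i) = {} \<longleftrightarrow> sub v (E' i) = {}" "sub v (E j) = {} \<longleftrightarrow> sub v (E' j) = {}"
      "sub v (E j) = {[]} \<longleftrightarrow> sub v (E' j) = {[]}"
      "?c (\<lambda>i. sub v (E i)) \<longleftrightarrow> ?c (\<lambda>i. sub v (E' i))"
      using t unfolding prod.inject by simp_all
    show "?c E'"
    proof (cases "prefix v x")
      case True
      then obtain y where y: "x = v @ y" by (auto simp: prefix_def)
      then have "sub v (E i) = {y}" "sub v (E j) = {y @ [b]}" using x by (auto simp: sub_def)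
      then have "?c (\<lambda>i. sub v (E i))" by blast
      then have "?c (\<lambda>i. sub v (E' i))" by (rule iffD1[OF t'(4)])
      then obtain z where z: "sub v (E' i) = {z}" "sub v (E' j) = {z @ [b]}" by blast
      have "E' i = {v @ z}"
        using eo[of i] z(1) unfolding x y by (rule eqout_singletonD)
      moreover have "E' j = {v @ z @ [b]}"
        using eo[of j] z(2) unfolding x y append_assoc by (rule eqout_singletonD)
      ultimately show ?thesis by auto
    next
      case False
      then have "sub v (E i) = {}" using x sub_singleton_other by simp
      then have i: "E' i = E i"
        using t'(1) by (intro eqout_subI[OF eqout_sym[OF eo]]) simp
      have "E' j = E j"
      proof (cases "v = x @ [b]")
        case True
        then have "sub v (E j) = {[]}" using x by (auto simp: sub_def)
        then show ?thesis using t'(3) by (intro eqout_subI[OF eqout_sym[OF eo]]) simp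
      next
        case ne: False
        then have "sub v (E j) = {}" using False x by (simp add: sub_singleton_other)
        then show ?thesis using t'(2) by (intro eqout_subI[OF eqout_sym[OF eo]]) simp
      qed
      then show ?thesis using i x by auto
    qed
  qed
qed

lemma recognizable_singleton: "recognizable (\<lambda>E. \<exists>x. E i = {x})"
proof -
  let ?t = "\<lambda>E :: 'a \<Rightarrow> bool list set. (E i = {}, \<exists>x. E i = {x})"
  show ?thesis
  proof (rule decides_recognizable[of ?t], rule decidesI)
    show "finite (range ?t)" by simp
    fix v and E E' :: "'a \<Rightarrow> bool list set"
    assume eo: "\<And>i. eqout v (E i) (E' i)"
      and t: "?t (\<lambda>i. sub v (E i)) = ?t (\<lambda>i. sub v (E' i))" and c: "\<exists>x. E i = {x}"
    from c obtain x where x: "E i = {x}" by blast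
    have t': "sub v (E i) = {} \<longleftrightarrow> sub v (E' i) = {}"
      "(\<exists>x. sub v (E i) = {x}) \<longleftrightarrow> (\<exists>x. sub v (E' i) = {x})"
      using t unfolding prod.inject by simp_all
    show "\<exists>x. E' i = {x}"
    proof (cases "prefix v x")
      case True
      then obtain y where y: "x = v @ y" by (auto simp: prefix_def)
      then have "sub v (E i) = {y}" using x by (auto simp: sub_def)
      then obtain z where z: "sub v (E' i) = {z}" using t'(2) by metis
      have "E' i = {v @ z}"
        using eo[of i] z unfolding x y by (rule eqout_singletonD)
      then show ?thesis by auto
    next
      case False
      then have "sub v (E i) = {}" using x sub_singleton_other by simp
      then have "E' i = E i" using t'(1) by (intro eqout_subI[OF eqout_sym[OF eo]]) simp
      then show ?thesis using x by auto
    qed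
  qed
qed

lemma recognizable_cong:
  assumes "recognizable P" "\<And>E. finenv E \<Longrightarrow> P E \<longleftrightarrow> Q E"
  shows "recognizable Q"
proof -
  obtain t :: "('a \<Rightarrow> bool list set) \<Rightarrow> nat" where t: "decides t P"
    using assms(1) by (rule recognizableE)
  have "decides t Q"
  proof (rule decidesI[OF decides_finite[OF t]])
    fix v E E' assume *: "finenv E" "finenv E'" "\<And>i. eqout v (E i) (E' i)"
      "t (\<lambda>i. sub v (E i)) = t (\<lambda>i. sub v (E' i))" "Q E"
    then show "Q E'"
      using decidesD[OF t *(1-4)] assms(2) by simp
  qed
  then show ?thesis by (rule decides_recognizable)
qed

text \<open>This disposes of the element variables of a formula in which none is free: they may all
  be placed at the root. Such a mark is visible in the subtree at \<open>v\<close> only for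
  \<open>v = []\<close>, so the type has one component for that case and one with empty coordinates
  for all other \<open>v\<close>.\<close>

lemma recognizable_fix:
  fixes P :: "('i + 'j \<Rightarrow> bool list set) \<Rightarrow> bool"
  assumes "recognizable P"
  shows "recognizable (\<lambda>E. P (case_sum (\<lambda>_. {[]}) E))"
proof -
  obtain t :: "('i + 'j \<Rightarrow> bool list set) \<Rightarrow> nat" where t: "decides t P"
    using assms by (rule recognizableE)
  let ?s = "\<lambda>E. (t (case_sum (\<lambda>_. {[]}) E), t (case_sum (\<lambda>_. {}) E))"
  have *: "(\<lambda>i. sub v (case_sum (\<lambda>_. {[]}) E i)) =
      (if v = [] then case_sum (\<lambda>_. {[]}) (\<lambda>i. sub v (E i)) else case_sum (\<lambda>_. {}) (\<lambda>i. sub v (E i)))"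
    for v and E :: "'j \<Rightarrow> bool list set" by (rule ext) (auto simp: sub_def split: sum.split)
  have "decides ?s (\<lambda>E. P (case_sum (\<lambda>_. {[]}) E))"
  proof (rule decidesI)
    show "finite (range ?s)"
      by (rule finite_subset[of _ "range t \<times> range t"]) (use decides_finite[OF t] in auto)
    fix v E E' assume e: "finenv E" "finenv E'" "\<And>i. eqout v (E i) (E' i)"
      "?s (\<lambda>i. sub v (E i)) = ?s (\<lambda>i. sub v (E' i))" "P (case_sum (\<lambda>_. {[]}) E)"
    have "P (case_sum (\<lambda>_. {[]}) E) \<longleftrightarrow> P (case_sum (\<lambda>_. {[]}) E')"
    proof (rule decidesD[OF t, of _ _ v])
      show "eqout v (case_sum (\<lambda>_. {[]}) E i) (case_sum (\<lambda>_. {[]}) E' i)" for i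
        using e(3) by (cases i) simp_all
      show "t (\<lambda>i. sub v (case_sum (\<lambda>_. {[]}) E i)) = t (\<lambda>i. sub v (case_sum (\<lambda>_. {[]}) E' i))"
        unfolding * by (cases "v = []") (use e(4) in \<open>simp_all only: prod.inject if_True if_False simp_thms\<close>)
    qed (use e(1,2) in \<open>simp_all split: sum.split\<close>)
    then show "P (case_sum (\<lambda>_. {[]}) E')" using e(5) by blast
  qed
  then show ?thesis by (rule decides_recognizable)
qed

section \<open>Satisfaction in the binary tree is recognizable\<close>

lemma univ_Delta2 [simp]: "univ Delta2 = UNIV"
  by (simp add: Delta2_def)

lemma Fpow_UNIV [simp]: "A \<in> Fpow UNIV \<longleftrightarrow> finite A"
  by (simp add: Fpow_def)

lemma interp_Delta2 [simp]:
  "us \<in> interp Delta2 S0 \<longleftrightarrow> (\<exists>u. us = [u, u @ [False]])"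
  "us \<in> interp Delta2 S1 \<longleftrightarrow> (\<exists>u. us = [u, u @ [True]])"
  by (auto simp: Delta2_def)

text \<open>Both sorts are merged into one environment of sets in which element variables are
  singletons. Equality and membership then become inclusion, and an element quantifier becomes a set
  quantifier restricted to singletons.\<close>

lemma sat_recognizable_aux:
  "\<exists>P. recognizable P \<and> (\<forall>e E. finenv E \<longrightarrow> (sat Delta2 e E \<phi> \<longleftrightarrow> P (case_sum (\<lambda>x. {e x}) E)))"
proof (induction \<phi>)
  case (Atom r xs)
  show ?case
  proof (cases "\<exists>x y. xs = [x, y]")
    case True
    then obtain x y where xs: "xs = [x, y]" by blast
    obtain b where "\<And>us. us \<in> interp Delta2 r \<longleftrightarrow> (\<exists>u. us = [u, u @ [b]])"
      by (cases r) (use interp_Delta2 in blast)+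
    then show ?thesis unfolding xs
      by (intro exI[of _ "\<lambda>F. \<exists>z. F (Inl x) = {z} \<and> F (Inl y) = {z @ [b]}"] conjI recognizable_child)
        auto
  next
    case False
    then have "\<not> sat Delta2 e E (Atom r xs)" for e E
      by (cases r) (auto simp: map_eq_Cons_conv)
    then show ?thesis using recognizable_const by blast
  qed
next
  case (Eq x y)
  show ?case
    by (rule exI[of _ "\<lambda>F. F (Inl x) \<subseteq> F (Inl y)"]) (auto intro: recognizable_subset)
next
  case (Mem x X)
  show ?case
    by (rule exI[of _ "\<lambda>F. F (Inl x) \<subseteq> F (Inr X)"]) (auto intro: recognizable_subset)
next
  case (Neg \<phi>)
  then obtain P where "recognizable P"
    and "\<forall>e E. finenv E \<longrightarrow> (sat Delta2 e E \<phi> \<longleftrightarrow> P (case_sum (\<lambda>x. {e x}) E))" by blast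
  then show ?case by (intro exI[of _ "\<lambda>F. \<not> P F"]) (auto intro: recognizable_not)
next
  case (Conj \<phi> \<psi>)
  then obtain P Q where "recognizable P" "recognizable Q"
    and "\<forall>e E. finenv E \<longrightarrow> (sat Delta2 e E \<phi> \<longleftrightarrow> P (case_sum (\<lambda>x. {e x}) E))"
    and "\<forall>e E. finenv E \<longrightarrow> (sat Delta2 e E \<psi> \<longleftrightarrow> Q (case_sum (\<lambda>x. {e x}) E))" by blast
  then show ?case by (intro exI[of _ "\<lambda>F. P F \<and> Q F"]) (auto intro: recognizable_conj)
next
  case (ExElem x \<phi>)
  then obtain P where P: "recognizable P"
    and sat: "\<And>e E. finenv E \<Longrightarrow> sat Delta2 e E \<phi> \<longleftrightarrow> P (case_sum (\<lambda>x. {e x}) E)" by blast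
  let ?P = "\<lambda>F. \<exists>A. finite A \<and> ((\<exists>a. (F(Inl x := A)) (Inl x) = {a}) \<and> P (F(Inl x := A)))"
  have "recognizable ?P"
    by (intro recognizable_ex_update recognizable_conj recognizable_singleton P)
  moreover have "sat Delta2 e E (ExElem x \<phi>) \<longleftrightarrow> ?P (case_sum (\<lambda>x. {e x}) E)" if "finenv E" for e E
  proof -
    have "(case_sum (\<lambda>x. {e x}) E)(Inl x := {a}) = case_sum (\<lambda>y. {(e(x := a)) y}) E" for a
      by (rule ext) (simp split: sum.split)
    then have "sat Delta2 (e(x := a)) E \<phi> \<longleftrightarrow> P ((case_sum (\<lambda>x. {e x}) E)(Inl x := {a}))" for a
      using sat[OF that] by simp
    then show ?thesis by auto
  qed
  ultimately show ?case by blast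
next
  case (ExSet X \<phi>)
  then obtain P where P: "recognizable P"
    and sat: "\<And>e E. finenv E \<Longrightarrow> sat Delta2 e E \<phi> \<longleftrightarrow> P (case_sum (\<lambda>x. {e x}) E)" by blast
  let ?P = "\<lambda>F. \<exists>A. finite A \<and> P (F(Inr X := A))"
  have "recognizable ?P"
    by (intro recognizable_ex_update P)
  moreover have "sat Delta2 e E (ExSet X \<phi>) \<longleftrightarrow> ?P (case_sum (\<lambda>x. {e x}) E)" if "finenv E" for e E
  proof -
    have "(case_sum (\<lambda>x. {e x}) E)(Inr X := A) = case_sum (\<lambda>y. {e y}) (E(X := A))" for A
      by (rule ext) (simp split: sum.split)
    then have "sat Delta2 e (E(X := A)) \<phi> \<longleftrightarrow> P ((case_sum (\<lambda>x. {e x}) E)(Inr X := A))" if "finite A" for A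
      using sat that \<open>finenv E\<close> by simp
    then show ?thesis by auto
  qed
  ultimately show ?case by blast
qed

section \<open>Definable predicates\<close>

text \<open>Definability as a property of predicates: closure rules can then be applied to their
  logical form, and formulas need not be written out. Free set variables are unrestricted here;
  \<open>wdef_set_formula\<close> later removes surplus ones.\<close>

definition wdef :: "((nat \<Rightarrow> bool list set) \<Rightarrow> bool) \<Rightarrow> bool" where
  "wdef P \<longleftrightarrow> (\<exists>\<phi>. free_elem \<phi> = {} \<and> (\<forall>e E. finenv E \<longrightarrow> (P E \<longleftrightarrow> sat Delta2 e E \<phi>)))"

lemma wdefI:
  assumes "free_elem \<phi> = {}" "\<And>e E. finenv E \<Longrightarrow> P E \<longleftrightarrow> sat Delta2 e E \<phi>"
  shows "wdef P"
  unfolding wdef_def using assms by blast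

lemma wdef_recognizable:
  assumes "wdef P"
  shows "recognizable P"
proof -
  obtain \<phi> where \<phi>: "\<And>e E. finenv E \<Longrightarrow> P E \<longleftrightarrow> sat Delta2 e E \<phi>"
    using assms unfolding wdef_def by blast
  obtain Q where "recognizable Q"
    and Q: "\<And>e E. finenv E \<Longrightarrow> sat Delta2 e E \<phi> \<longleftrightarrow> Q (case_sum (\<lambda>x. {e x}) E)"
    using sat_recognizable_aux[of \<phi>] by blast
  then have "recognizable (\<lambda>E. Q (case_sum (\<lambda>_. {[]}) E))" by (intro recognizable_fix)
  then show ?thesis
    by (rule recognizable_cong) (use \<phi> Q[of _ "\<lambda>_. []"] in simp)
qed

lemma wdef_cong:
  assumes "\<And>E. finenv E \<Longrightarrow> P E \<longleftrightarrow> Q E" "wdef Q"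
  shows "wdef P"
  using assms unfolding wdef_def by auto

lemma wdef_not:
  assumes "wdef P"
  shows "wdef (\<lambda>E. \<not> P E)"
proof -
  obtain \<phi> where "free_elem \<phi> = {}" "\<And>e E. finenv E \<Longrightarrow> P E \<longleftrightarrow> sat Delta2 e E \<phi>"
    using assms unfolding wdef_def by blast
  then show ?thesis by (intro wdefI[of "Neg \<phi>"]) simp_all
qed

lemma wdef_conj:
  assumes "wdef P" "wdef Q"
  shows "wdef (\<lambda>E. P E \<and> Q E)"
proof -
  obtain \<phi> where "free_elem \<phi> = {}" "\<And>e E. finenv E \<Longrightarrow> P E \<longleftrightarrow> sat Delta2 e E \<phi>"
    using assms(1) unfolding wdef_def by blast
  moreover obtain \<psi> where "free_elem \<psi> = {}" "\<And>e E. finenv E \<Longrightarrow> Q E \<longleftrightarrow> sat Delta2 e E \<psi>"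
    using assms(2) unfolding wdef_def by blast
  ultimately show ?thesis by (intro wdefI[of "Conj \<phi> \<psi>"]) simp_all
qed

lemma wdef_disj: "wdef P \<Longrightarrow> wdef Q \<Longrightarrow> wdef (\<lambda>E. P E \<or> Q E)"
  by (rule wdef_cong[of _ "\<lambda>E. \<not> (\<not> P E \<and> \<not> Q E)"]) (blast, intro wdef_not wdef_conj)

lemma wdef_imp: "wdef P \<Longrightarrow> wdef Q \<Longrightarrow> wdef (\<lambda>E. P E \<longrightarrow> Q E)"
  by (rule wdef_cong[of _ "\<lambda>E. \<not> (P E \<and> \<not> Q E)"]) (blast, intro wdef_not wdef_conj)

lemma wdef_iff: "wdef P \<Longrightarrow> wdef Q \<Longrightarrow> wdef (\<lambda>E. P E \<longleftrightarrow> Q E)"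
  by (rule wdef_cong[of _ "\<lambda>E. (P E \<longrightarrow> Q E) \<and> (Q E \<longrightarrow> P E)"]) (blast, intro wdef_conj wdef_imp)

lemma wdef_const: "wdef (\<lambda>E. b)"
proof -
  have "wdef (\<lambda>E. True)" by (rule wdefI[of "ExElem 0 (Eq 0 0)"]) auto
  then show ?thesis using wdef_not[of "\<lambda>E. True"] by (cases b) simp_all
qed

lemma wdef_finite_ball:
  assumes "finite S" "\<And>x. x \<in> S \<Longrightarrow> wdef (P x)"
  shows "wdef (\<lambda>E. \<forall>x\<in>S. P x E)"
  using assms by (induction rule: finite_induct) (simp_all add: wdef_const wdef_conj)

lemma wdef_finite_bex:
  assumes "finite S" "\<And>x. x \<in> S \<Longrightarrow> wdef (P x)"
  shows "wdef (\<lambda>E. \<exists>x\<in>S. P x E)"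
  using assms by (induction rule: finite_induct) (simp_all add: wdef_const wdef_disj)

lemma finite_free_set: "finite (free_set \<phi>)"
  by (induction \<phi>) auto

text \<open>At a set quantifier the bound variable is moved to an index outside the image of the
  free variables of the body. This avoids capture even if \<tau> is not injective.\<close>

lemma rename_sets:
  "\<exists>\<psi>. free_elem \<psi> = free_elem \<phi> \<and> (\<forall>e E. sat T e E \<psi> \<longleftrightarrow> sat T e (\<lambda>i. E (\<tau> i)) \<phi>)"
proof (induction \<phi> arbitrary: \<tau>)
  case (Atom r xs)
  show ?case by (rule exI[of _ "Atom r xs"]) simp
next
  case (Eq x y)
  show ?case by (rule exI[of _ "Eq x y"]) simp
next
  case (Mem x X)
  show ?case by (rule exI[of _ "Mem x (\<tau> X)"]) simp
next
  case (Neg \<phi>)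
  obtain \<psi> where "free_elem \<psi> = free_elem \<phi>" "\<forall>e E. sat T e E \<psi> \<longleftrightarrow> sat T e (\<lambda>i. E (\<tau> i)) \<phi>"
    using Neg[of \<tau>] by blast
  then show ?case by (intro exI[of _ "Neg \<psi>"]) simp
next
  case (Conj \<phi>1 \<phi>2)
  obtain \<psi>1 where "free_elem \<psi>1 = free_elem \<phi>1" "\<forall>e E. sat T e E \<psi>1 \<longleftrightarrow> sat T e (\<lambda>i. E (\<tau> i)) \<phi>1"
    using Conj.IH(1)[of \<tau>] by blast
  moreover obtain \<psi>2 where "free_elem \<psi>2 = free_elem \<phi>2"
    "\<forall>e E. sat T e E \<psi>2 \<longleftrightarrow> sat T e (\<lambda>i. E (\<tau> i)) \<phi>2"
    using Conj.IH(2)[of \<tau>] by blast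
  ultimately show ?case by (intro exI[of _ "Conj \<psi>1 \<psi>2"]) simp
next
  case (ExElem x \<phi>)
  obtain \<psi> where "free_elem \<psi> = free_elem \<phi>" "\<forall>e E. sat T e E \<psi> \<longleftrightarrow> sat T e (\<lambda>i. E (\<tau> i)) \<phi>"
    using ExElem[of \<tau>] by blast
  then show ?case by (intro exI[of _ "ExElem x \<psi>"]) simp
next
  case (ExSet X \<phi>)
  obtain m where m: "m \<notin> \<tau> ` free_set \<phi>"
    using ex_new_if_finite[OF infinite_UNIV_nat finite_imageI[OF finite_free_set]] by blast
  obtain \<psi> where fe: "free_elem \<psi> = free_elem \<phi>"
    and \<psi>: "\<And>e E. sat T e E \<psi> \<longleftrightarrow> sat T e (\<lambda>i. E ((\<tau>(X := m)) i)) \<phi>"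
    using ExSet[of "\<tau>(X := m)"] by blast
  have "sat T e (\<lambda>i. (E(m := A)) ((\<tau>(X := m)) i)) \<phi> \<longleftrightarrow> sat T e ((\<lambda>i. E (\<tau> i))(X := A)) \<phi>" for e E A
    by (rule sat_cong) (use m in auto)
  then show ?case by (intro exI[of _ "ExSet m \<psi>"]) (simp add: fe \<psi>)
qed

text \<open>Quantifiers are handled with de Bruijn indices: the bound set is variable \<open>0\<close>, and the
  variables of the context are shifted by one.\<close>

lemma wdef_ex_set:
  assumes "wdef (\<lambda>E. Q (E 0) (\<lambda>i. E (Suc i)))"
  shows "wdef (\<lambda>E. \<exists>A. finite A \<and> Q A E)"
proof -
  obtain \<phi> where fe: "free_elem \<phi> = {}"
    and \<phi>: "\<And>e E. finenv E \<Longrightarrow> Q (E 0) (\<lambda>i. E (Suc i)) \<longleftrightarrow> sat Delta2 e E \<phi>"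
    using assms unfolding wdef_def by blast
  obtain m where m: "\<forall>X\<in>free_set \<phi>. X \<le> m"
    using finite_free_set[of \<phi>] finite_nat_set_iff_bounded_le by blast
  \<comment> \<open>The quantified variable \<open>0\<close> goes to \<open>m\<close> and each
    \<open>Suc i\<close> to \<open>i\<close>. A free \<open>Suc i\<close> is at most
    \<open>m\<close>, hence \<open>i < m\<close>, and no variable of the context collides with the
    bound one.\<close>
  define \<tau> where "\<tau> = case_nat m id"
  obtain \<psi> where \<psi>: "free_elem \<psi> = free_elem \<phi>"
    "\<And>e E. sat Delta2 e E \<psi> \<longleftrightarrow> sat Delta2 e (\<lambda>i. E (\<tau> i)) \<phi>"
    using rename_sets[of \<phi> Delta2 \<tau>] by blast
  show ?thesis
  proof (rule wdefI)
    show "free_elem (ExSet m \<psi>) = {}" using fe \<psi> by simp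
    fix e and E :: "nat \<Rightarrow> bool list set" assume E: "finenv E"
    have "Q A E \<longleftrightarrow> sat Delta2 e (E(m := A)) \<psi>" if "finite A" for A
    proof -
      have "Q A E \<longleftrightarrow> sat Delta2 e (case_nat A E) \<phi>"
        using \<phi>[of "case_nat A E" e] E that by (simp split: nat.split)
      also have "\<dots> \<longleftrightarrow> sat Delta2 e (\<lambda>i. (E(m := A)) (\<tau> i)) \<phi>"
        by (rule sat_cong) (use m in \<open>force simp: \<tau>_def split: nat.split\<close>)+
      finally show ?thesis by (simp add: \<psi>)
    qed
    then show "(\<exists>A. finite A \<and> Q A E) \<longleftrightarrow> sat Delta2 e E (ExSet m \<psi>)" by auto
  qed
qed

lemma wdef_all_set:
  assumes "wdef (\<lambda>E. Q (E 0) (\<lambda>i. E (Suc i)))"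
  shows "wdef (\<lambda>E. \<forall>A. finite A \<longrightarrow> Q A E)"
proof (rule wdef_cong)
  show "wdef (\<lambda>E. \<not> (\<exists>A. finite A \<and> \<not> Q A E))"
    using assms by (intro wdef_not wdef_ex_set)
qed blast

text \<open>The decoders \<open>nd\<close>, \<open>nset\<close> and \<open>num\<close> are total and onto, with junk values outside their
  intended domain, so that quantifiers over nodes, finite sets of numbers and numbers need no
  relativization.\<close>

definition nd :: "bool list set \<Rightarrow> bool list" where
  "nd A = (if \<exists>w. A = {w} then the_elem A else [])"

lemma nd_singleton [simp]: "nd {w} = w"
  by (simp add: nd_def)

abbreviation all_elem :: "nat \<Rightarrow> 'r wmso \<Rightarrow> 'r wmso" where
  "all_elem x \<phi> \<equiv> Neg (ExElem x (Neg \<phi>))"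

definition single_form :: "nat \<Rightarrow> nat \<Rightarrow> nat \<Rightarrow> 'r wmso" where
  "single_form i y z = ExElem y (all_elem z
     (Conj (Neg (Conj (Mem z i) (Neg (Eq z y)))) (Neg (Conj (Eq z y) (Neg (Mem z i))))))"

text \<open>For a set that is no singleton \<open>nd\<close> returns the root, described here as the
  node without a parent. The variables \<open>y\<close> and \<open>z\<close> are scratch
  variables.\<close>

definition nd_form :: "nat \<Rightarrow> nat \<Rightarrow> nat \<Rightarrow> nat \<Rightarrow> child_sym wmso" where
  "nd_form i x y z = Neg (Conj
     (Neg (Conj (single_form i y z) (Mem x i)))
     (Neg (Conj (Neg (single_form i y z))
        (all_elem y (Conj (Neg (Atom S0 [y, x])) (Neg (Atom S1 [y, x])))))))"

lemma sat_single_form: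
  "y \<noteq> z \<Longrightarrow> sat Delta2 e E (single_form i y z) \<longleftrightarrow> (\<exists>w. E i = {w})"
  by (auto simp: single_form_def)

lemma Nil_iff_no_parent: "w = [] \<longleftrightarrow> (\<forall>u. w \<noteq> u @ [False] \<and> w \<noteq> u @ [True])"
proof (cases w rule: rev_cases)
  case (snoc u b)
  then show ?thesis by (cases b) simp_all
qed simp

lemma sat_nd_form:
  assumes "distinct [x, y, z]"
  shows "sat Delta2 e E (nd_form i x y z) \<longleftrightarrow> e x = nd (E i)"
proof (cases "\<exists>w. E i = {w}")
  case True
  then obtain w where "E i = {w}" by blast
  then show ?thesis using assms by (simp add: nd_form_def sat_single_form)
next
  case False
  then have "nd (E i) = []" by (simp add: nd_def)
  moreover have "sat Delta2 e E (nd_form i x y z) \<longleftrightarrow> (\<forall>u. e x \<noteq> u @ [False] \<and> e x \<noteq> u @ [True])"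
    using assms False by (simp add: nd_form_def sat_single_form)
  ultimately show ?thesis using Nil_iff_no_parent[of "e x"] by metis
qed

lemma free_elem_nd_form: "distinct [x, y, z] \<Longrightarrow> free_elem (nd_form i x y z) = {x}"
  by (auto simp: nd_form_def single_form_def)

lemma wdef_nd_mem: "wdef (\<lambda>E. nd (E i) \<in> E j)"
  by (rule wdefI[of "ExElem 0 (Conj (nd_form i 0 1 2) (Mem 0 j))"])
    (simp_all add: free_elem_nd_form sat_nd_form)

lemma wdef_nd_child: "wdef (\<lambda>E. nd (E j) = nd (E i) @ [b])"
  by (rule wdefI[of "ExElem 0 (ExElem 3 (Conj (Conj (nd_form i 0 1 2) (nd_form j 3 1 2))
        (Atom (if b then S1 else S0) [0, 3])))"])
    (auto simp: free_elem_nd_form sat_nd_form)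

lemma wdef_nd_eq: "wdef (\<lambda>E. nd (E i) = nd (E j))"
  by (rule wdefI[of "ExElem 0 (Conj (nd_form i 0 1 2) (nd_form j 0 1 2))"])
    (simp_all add: free_elem_nd_form sat_nd_form)

lemma wdef_ex_node:
  assumes "wdef (\<lambda>E. Q (nd (E 0)) (\<lambda>i. E (Suc i)))"
  shows "wdef (\<lambda>E. \<exists>w. Q w E)"
proof (rule wdef_cong)
  show "wdef (\<lambda>E. \<exists>A. finite A \<and> Q (nd A) E)"
    using assms by (rule wdef_ex_set)
qed (metis nd_singleton finite.emptyI finite.insertI)

lemma wdef_all_node:
  assumes "wdef (\<lambda>E. Q (nd (E 0)) (\<lambda>i. E (Suc i)))"
  shows "wdef (\<lambda>E. \<forall>w. Q w E)"
proof (rule wdef_cong)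
  show "wdef (\<lambda>E. \<not> (\<exists>w. \<not> Q w E))"
    using assms by (intro wdef_not wdef_ex_node)
qed blast

text \<open>Transitive closure by quantifying over closed sets. Finite sets suffice since the
  ancestors of \<open>w\<close> form a finite set closed under parents.\<close>

lemma prefix_iff_closed:
  "prefix u (w :: bool list) \<longleftrightarrow> (\<forall>A. finite A \<longrightarrow> w \<in> A \<longrightarrow>
     (\<forall>x y. y = x @ [False] \<or> y = x @ [True] \<longrightarrow> y \<in> A \<longrightarrow> x \<in> A) \<longrightarrow> u \<in> A)"
proof
  assume "prefix u w"
  then obtain v where w: "w = u @ v" by (auto simp: prefix_def)
  show "\<forall>A. finite A \<longrightarrow> w \<in> A \<longrightarrow>
     (\<forall>x y. y = x @ [False] \<or> y = x @ [True] \<longrightarrow> y \<in> A \<longrightarrow> x \<in> A) \<longrightarrow> u \<in> A"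
  proof (intro allI impI)
    fix A assume wA: "w \<in> A"
      and A: "\<forall>x y. y = x @ [False] \<or> y = x @ [True] \<longrightarrow> y \<in> A \<longrightarrow> x \<in> A"
    have step: "x @ [b] \<in> A \<Longrightarrow> x \<in> A" for x b
      using A by (cases b) blast+
    have "u @ v \<in> A \<Longrightarrow> u \<in> A" for v
    proof (induction v rule: rev_induct)
      case (snoc b v)
      then show ?case using step[of "u @ v" b] by (metis append_assoc)
    qed simp
    then show "u \<in> A" using wA w by blast
  qed
next
  assume *: "\<forall>A. finite A \<longrightarrow> w \<in> A \<longrightarrow>
     (\<forall>x y. y = x @ [False] \<or> y = x @ [True] \<longrightarrow> y \<in> A \<longrightarrow> x \<in> A) \<longrightarrow> u \<in> A"
  have "finite (set (prefixes w))" "w \<in> set (prefixes w)"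
    "\<forall>x y. y = x @ [False] \<or> y = x @ [True] \<longrightarrow> y \<in> set (prefixes w) \<longrightarrow> x \<in> set (prefixes w)"
    by (auto dest: append_prefixD)
  then have "u \<in> set (prefixes w)" using *[rule_format, of "set (prefixes w)"] by blast
  then show "prefix u w" by simp
qed

lemma wdef_prefix: "wdef (\<lambda>E. prefix (nd (E i)) (nd (E j)))"
  unfolding prefix_iff_closed
  by (intro wdef_all_set wdef_imp wdef_all_node wdef_disj wdef_nd_mem wdef_nd_child)

lemmas wdef_intros = wdef_not wdef_conj wdef_disj wdef_imp wdef_iff wdef_const
  wdef_ex_set wdef_all_set wdef_ex_node wdef_all_node
  wdef_nd_mem wdef_nd_child wdef_nd_eq wdef_prefix

lemma wdef_holds:
  assumes "set_formula n \<phi>" "length is = n"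
  shows "wdef (\<lambda>E. holds Delta2 \<phi> (map E is))"
proof -
  have \<phi>: "free_elem \<phi> = {}" "free_set \<phi> \<subseteq> {..<n}"
    using assms(1) by (simp_all add: set_formula_def)
  obtain \<psi> where \<psi>: "free_elem \<psi> = free_elem \<phi>"
    "\<And>e E. sat Delta2 e E \<psi> \<longleftrightarrow> sat Delta2 e (\<lambda>i. E (is ! i)) \<phi>"
    using rename_sets[of \<phi> Delta2 "\<lambda>i. is ! i"] by blast
  show ?thesis
  proof (rule wdefI)
    show "free_elem \<psi> = {}" using \<psi> \<phi> by simp
    show "holds Delta2 \<phi> (map E is) \<longleftrightarrow> sat Delta2 e E \<psi>" for e E
      unfolding holds_def \<psi> by (rule sat_cong) (use \<phi> assms(2) in auto)
  qed
qed

section \<open>Decoding numbers and finite sets of numbers in a presentation\<close>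

definition is_succ :: "nat set \<Rightarrow> nat set \<Rightarrow> bool" where
  "is_succ X Y \<longleftrightarrow> (\<exists>n. X = {n} \<and> Y = {Suc n})"

definition is_single :: "nat set \<Rightarrow> bool" where
  "is_single X \<longleftrightarrow> (\<exists>n. X = {n})"

locale powerset_presentation =
  fixes f :: "nat set \<Rightarrow> bool list set"
  assumes pres: "presentation Delta2 (weak_powerset Delta1) f"
begin

definition codes :: "bool list set set" where
  "codes = f ` {X. finite X}"

lemma univ_weak_powerset: "univ (weak_powerset Delta1) = {X. finite X}"
  by (auto simp: weak_powerset_def Delta1_def Fpow_def)

lemma f_inj: "finite X \<Longrightarrow> finite Y \<Longrightarrow> f X = f Y \<longleftrightarrow> X = Y"
  using pres unfolding presentation_def univ_weak_powerset by (auto dest: inj_onD)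

lemma f_finite [simp]: "finite X \<Longrightarrow> finite (f X)"
  using pres unfolding presentation_def univ_weak_powerset by auto

lemma f_codes [simp]: "finite X \<Longrightarrow> f X \<in> codes"
  by (simp add: codes_def)

definition nset :: "bool list set \<Rightarrow> nat set" where
  "nset A = (if A \<in> codes then inv_into {X. finite X} f A else {})"

lemma nset_f [simp]: "finite X \<Longrightarrow> nset (f X) = X"
  using pres unfolding presentation_def univ_weak_powerset by (simp add: nset_def)

lemma finite_nset [simp]: "finite (nset A)"
  by (cases "A \<in> codes") (auto simp: codes_def, simp add: nset_def codes_def)

lemma f_nset: "A \<in> codes \<Longrightarrow> f (nset A) = A"
  by (auto simp: codes_def)

lemma nset_not_code: "A \<notin> codes \<Longrightarrow> nset A = {}"
  by (simp add: nset_def)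

definition num :: "bool list set \<Rightarrow> nat" where
  "num A = (if is_single (nset A) then the_elem (nset A) else 0)"

lemma num_f [simp]: "num (f {n}) = n"
  by (simp add: num_def is_single_def)

lemma wdef_code: "wdef (\<lambda>E. E i \<in> codes)"
proof -
  obtain \<phi> where \<phi>: "set_formula 1 \<phi>" and "\<forall>A\<in>Fpow (univ Delta2). A \<in> codes \<longleftrightarrow> holds Delta2 \<phi> [A]"
    using pres unfolding presentation_def wmso_definable_def univ_weak_powerset codes_def by blast
  then have "A \<in> codes \<longleftrightarrow> holds Delta2 \<phi> [A]" if "finite A" for A using that by simp
  moreover have "wdef (\<lambda>E. holds Delta2 \<phi> (map E [i]))" using \<phi> by (rule wdef_holds) simp
  ultimately show ?thesis by (intro wdef_cong[of "\<lambda>E. E i \<in> codes"]) auto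
qed

lemma symbol_formula:
  "\<exists>\<phi>. set_formula (arity (weak_powerset Delta1) s) \<phi> \<and>
    (\<forall>us\<in>tuples (arity (weak_powerset Delta1) s) {X. finite X}.
      us \<in> interp (weak_powerset Delta1) s \<longleftrightarrow> holds Delta2 \<phi> (map f us))"
  using pres unfolding presentation_def univ_weak_powerset by blast

text \<open>The given formula is reliable on codes only. A left argument that is no code decodes to
  the empty set and makes the inclusion trivial; if just the right one is no code, the left set has
  to be empty, that is, below every coded set.\<close>

lemma wdef_nset_subset: "wdef (\<lambda>E. nset (E i) \<subseteq> nset (E j))"
proof -
  obtain \<phi> where \<phi>: "set_formula (arity (weak_powerset Delta1) Incl) \<phi>"
    and us: "\<forall>us\<in>tuples (arity (weak_powerset Delta1) Incl) {X. finite X}.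
      us \<in> interp (weak_powerset Delta1) Incl \<longleftrightarrow> holds Delta2 \<phi> (map f us)"
    using symbol_formula by blast
  have ar: "arity (weak_powerset Delta1) Incl = 2" by (simp add: weak_powerset_def)
  have incl: "X \<subseteq> Y \<longleftrightarrow> holds Delta2 \<phi> [f X, f Y]" if "finite X" "finite Y" for X Y
    using us[rule_format, of "[X, Y]"] that ar by (simp add: tuples_def weak_powerset_def Delta1_def)
  have code: "nset A \<subseteq> nset B \<longleftrightarrow> holds Delta2 \<phi> [A, B]" if "A \<in> codes" "B \<in> codes" for A B
    using that by (auto simp: codes_def incl)
  have h: "wdef (\<lambda>E. holds Delta2 \<phi> [E i, E j])" for i j
    using wdef_holds[OF \<phi>, of "[i, j]"] ar by simp
  have "wdef (\<lambda>E. E i \<in> codes \<longrightarrow> (E j \<in> codes \<and> holds Delta2 \<phi> [E i, E j]) \<or>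
      (E j \<notin> codes \<and> (\<forall>B. finite B \<longrightarrow> B \<in> codes \<longrightarrow> holds Delta2 \<phi> [E i, B])))"
    by (intro wdef_intros wdef_code h)
  moreover have "nset A \<subseteq> nset B \<longleftrightarrow> (A \<in> codes \<longrightarrow> (B \<in> codes \<and> holds Delta2 \<phi> [A, B]) \<or>
      (B \<notin> codes \<and> (\<forall>B. finite B \<longrightarrow> B \<in> codes \<longrightarrow> holds Delta2 \<phi> [A, B])))" for A B
  proof (cases "A \<in> codes \<and> B \<notin> codes")
    case True
    have "(\<forall>B. finite B \<longrightarrow> B \<in> codes \<longrightarrow> holds Delta2 \<phi> [A, B]) \<longleftrightarrow> nset A = {}"
    proof
      assume "\<forall>B. finite B \<longrightarrow> B \<in> codes \<longrightarrow> holds Delta2 \<phi> [A, B]"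
      then have "holds Delta2 \<phi> [A, f {}]" by simp
      then show "nset A = {}" using True code[of A "f {}"] by simp
    qed (use True code in auto)
    then show ?thesis using True nset_not_code by auto
  qed (use code nset_not_code in auto)
  ultimately show ?thesis by simp
qed

lemma wdef_nset_succ: "wdef (\<lambda>E. is_succ (nset (E i)) (nset (E j)))"
proof -
  obtain \<phi> where \<phi>: "set_formula (arity (weak_powerset Delta1) (Base Succ)) \<phi>"
    and us: "\<forall>us\<in>tuples (arity (weak_powerset Delta1) (Base Succ)) {X. finite X}.
      us \<in> interp (weak_powerset Delta1) (Base Succ) \<longleftrightarrow> holds Delta2 \<phi> (map f us)"
    using symbol_formula by blast
  have ar: "arity (weak_powerset Delta1) (Base Succ) = 2" by (simp add: weak_powerset_def Delta1_def)
  have succ: "is_succ X Y \<longleftrightarrow> holds Delta2 \<phi> [f X, f Y]" if "finite X" "finite Y" for X Y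
  proof -
    have "[X, Y] \<in> interp (weak_powerset Delta1) (Base Succ) \<longleftrightarrow>
        (\<exists>us. [X, Y] = map (\<lambda>u. {u}) us \<and> (\<exists>n. us = [n, Suc n]))"
      by (simp add: weak_powerset_def Delta1_def)
    also have "\<dots> \<longleftrightarrow> (\<exists>n. [X, Y] = map (\<lambda>u. {u}) [n, Suc n])" by metis
    finally show ?thesis
      using us[rule_format, of "[X, Y]"] that ar by (simp add: tuples_def is_succ_def)
  qed
  have h: "wdef (\<lambda>E. holds Delta2 \<phi> [E i, E j])"
    using wdef_holds[OF \<phi>, of "[i, j]"] ar by simp
  have "wdef (\<lambda>E. E i \<in> codes \<and> E j \<in> codes \<and> holds Delta2 \<phi> [E i, E j])"
    by (intro wdef_intros wdef_code h)
  moreover have "is_succ (nset A) (nset B) \<longleftrightarrow> A \<in> codes \<and> B \<in> codes \<and> holds Delta2 \<phi> [A, B]" for A B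
  proof (cases "A \<in> codes \<and> B \<in> codes")
    case True
    then show ?thesis by (auto simp: codes_def succ)
  qed (use nset_not_code in \<open>auto simp: is_succ_def\<close>)
  ultimately show ?thesis by simp
qed

lemma wdef_ex_nset:
  assumes "wdef (\<lambda>E. Q (nset (E 0)) (\<lambda>i. E (Suc i)))"
  shows "wdef (\<lambda>E. \<exists>X. finite X \<and> Q X E)"
proof (rule wdef_cong)
  show "wdef (\<lambda>E. \<exists>A. finite A \<and> Q (nset A) E)"
    using assms by (rule wdef_ex_set)
qed (metis nset_f finite_nset f_finite)

lemma wdef_all_nset:
  assumes "wdef (\<lambda>E. Q (nset (E 0)) (\<lambda>i. E (Suc i)))"
  shows "wdef (\<lambda>E. \<forall>X. finite X \<longrightarrow> Q X E)"
proof (rule wdef_cong)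
  show "wdef (\<lambda>E. \<not> (\<exists>A. finite A \<and> \<not> Q A E))"
    using assms by (intro wdef_not wdef_ex_nset)
qed blast

lemma wdef_ex_num:
  assumes "wdef (\<lambda>E. Q (num (E 0)) (\<lambda>i. E (Suc i)))"
  shows "wdef (\<lambda>E. \<exists>n. Q n E)"
proof (rule wdef_cong)
  show "wdef (\<lambda>E. \<exists>A. finite A \<and> Q (num A) E)"
    using assms by (rule wdef_ex_set)
qed (metis num_f f_finite finite.emptyI finite.insertI)

lemma wdef_all_num:
  assumes "wdef (\<lambda>E. Q (num (E 0)) (\<lambda>i. E (Suc i)))"
  shows "wdef (\<lambda>E. \<forall>n. Q n E)"
proof (rule wdef_cong)
  show "wdef (\<lambda>E. \<not> (\<exists>n. \<not> Q n E))"
    using assms by (intro wdef_not wdef_ex_num)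
qed blast

lemma wdef_nset_empty: "wdef (\<lambda>E. nset (E i) = {})"
proof (rule wdef_cong)
  show "wdef (\<lambda>E. \<forall>Y. finite Y \<longrightarrow> nset (E i) \<subseteq> Y)"
    by (intro wdef_all_nset wdef_nset_subset)
qed auto

lemma wdef_nset_single: "wdef (\<lambda>E. is_single (nset (E i)))"
proof (rule wdef_cong)
  show "wdef (\<lambda>E. \<not> nset (E i) = {} \<and>
      (\<forall>Y. finite Y \<longrightarrow> Y \<subseteq> nset (E i) \<longrightarrow> Y = {} \<or> nset (E i) \<subseteq> Y))"
    by (intro wdef_intros wdef_all_nset wdef_nset_subset wdef_nset_empty)
  fix E
  show "is_single (nset (E i)) \<longleftrightarrow> \<not> nset (E i) = {} \<and>
      (\<forall>Y. finite Y \<longrightarrow> Y \<subseteq> nset (E i) \<longrightarrow> Y = {} \<or> nset (E i) \<subseteq> Y)" (is "_ = ?rhs")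
  proof
    assume ?rhs
    then obtain n where n: "n \<in> nset (E i)" and "\<forall>Y. finite Y \<longrightarrow> Y \<subseteq> nset (E i) \<longrightarrow> Y = {} \<or> nset (E i) \<subseteq> Y"
      by auto
    then have "nset (E i) \<subseteq> {n}" by (metis empty_not_insert empty_subsetI finite.emptyI finite.insertI insert_subset)
    then show "is_single (nset (E i))" using n unfolding is_single_def by blast
  qed (auto simp: is_single_def)
qed

text \<open>Zero is the number without a predecessor. It needs a formula of its own because
  \<open>num\<close> returns 0 on sets that do not code a singleton.\<close>

lemma wdef_zero_mem: "wdef (\<lambda>E. 0 \<in> nset (E i))"
proof (rule wdef_cong)
  show "wdef (\<lambda>E. \<exists>Z. finite Z \<and> is_single Z \<and> \<not> (\<exists>Y. finite Y \<and> is_succ Y Z) \<and> Z \<subseteq> nset (E i))"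
    by (intro wdef_ex_nset wdef_conj wdef_not wdef_nset_subset wdef_nset_single wdef_nset_succ)
  fix E
  show "0 \<in> nset (E i) \<longleftrightarrow>
      (\<exists>Z. finite Z \<and> is_single Z \<and> \<not> (\<exists>Y. finite Y \<and> is_succ Y Z) \<and> Z \<subseteq> nset (E i))" (is "_ = ?rhs")
  proof
    assume "0 \<in> nset (E i)"
    then show ?rhs by (intro exI[of _ "{0}"]) (auto simp: is_single_def is_succ_def)
  next
    assume ?rhs
    then obtain n where "{n} \<subseteq> nset (E i)" "\<not> (\<exists>Y. finite Y \<and> is_succ Y {n})"
      unfolding is_single_def by blast
    moreover have "is_succ {n - 1} {n}" if "n \<noteq> 0" using that by (simp add: is_succ_def)
    ultimately show "0 \<in> nset (E i)" by (metis finite.emptyI finite.insertI insert_subset)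
  qed
qed

lemma wdef_num_mem: "wdef (\<lambda>E. num (E i) \<in> nset (E j))"
proof (rule wdef_cong)
  show "wdef (\<lambda>E. (is_single (nset (E i)) \<and> nset (E i) \<subseteq> nset (E j)) \<or>
      (\<not> is_single (nset (E i)) \<and> 0 \<in> nset (E j)))"
    by (intro wdef_intros wdef_nset_subset wdef_nset_single wdef_zero_mem)
qed (auto simp: num_def is_single_def)

lemma wdef_num_Suc: "wdef (\<lambda>E. num (E j) = Suc (num (E i)))"
proof (rule wdef_cong)
  show "wdef (\<lambda>E. \<exists>Y. finite Y \<and> (\<exists>Z. finite Z \<and> is_succ Y Z \<and> num (E i) \<in> Y \<and> num (E j) \<in> Z))"
    by (intro wdef_ex_nset wdef_conj wdef_nset_succ wdef_num_mem)
  fix E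
  show "num (E j) = Suc (num (E i)) \<longleftrightarrow>
      (\<exists>Y. finite Y \<and> (\<exists>Z. finite Z \<and> is_succ Y Z \<and> num (E i) \<in> Y \<and> num (E j) \<in> Z))" (is "_ = ?rhs")
  proof
    assume "num (E j) = Suc (num (E i))"
    then show ?rhs
      by (intro exI[of _ "{num (E i)}"] exI[of _ "{num (E j)}"] conjI) (simp_all add: is_succ_def)
  next
    assume ?rhs
    then show "num (E j) = Suc (num (E i))" unfolding is_succ_def by blast
  qed
qed

lemma wdef_num_eq: "wdef (\<lambda>E. num (E i) = num (E j))"
proof (rule wdef_cong)
  show "wdef (\<lambda>E. \<forall>Z. finite Z \<longrightarrow> num (E i) \<in> Z \<longrightarrow> num (E j) \<in> Z)"
    by (intro wdef_all_nset wdef_imp wdef_num_mem)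
qed (metis finite.emptyI finite.insertI insertI1 singletonD)

text \<open>The device used for \<open>prefix\<close>: \<open>{..m}\<close> is finite and closed
  under predecessors, so weak quantification captures the order.\<close>

lemma le_iff_closed:
  "n \<le> m \<longleftrightarrow> (\<forall>Z. finite Z \<longrightarrow> m \<in> Z \<longrightarrow> (\<forall>x y. y = Suc x \<longrightarrow> y \<in> Z \<longrightarrow> x \<in> Z) \<longrightarrow> n \<in> Z)"
proof
  assume "n \<le> m"
  show "\<forall>Z. finite Z \<longrightarrow> m \<in> Z \<longrightarrow> (\<forall>x y. y = Suc x \<longrightarrow> y \<in> Z \<longrightarrow> x \<in> Z) \<longrightarrow> n \<in> Z"
  proof (intro allI impI)
    fix Z assume "m \<in> Z" and *: "\<forall>x y. y = Suc x \<longrightarrow> y \<in> Z \<longrightarrow> x \<in> Z"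
    show "n \<in> Z"
      using \<open>n \<le> m\<close> by (rule inc_induct) (use \<open>m \<in> Z\<close> * in blast)+
  qed
next
  assume *: "\<forall>Z. finite Z \<longrightarrow> m \<in> Z \<longrightarrow> (\<forall>x y. y = Suc x \<longrightarrow> y \<in> Z \<longrightarrow> x \<in> Z) \<longrightarrow> n \<in> Z"
  have "n \<in> {..m}" by (rule *[rule_format]) auto
  then show "n \<le> m" by simp
qed

lemma wdef_num_le: "wdef (\<lambda>E. num (E i) \<le> num (E j))"
  unfolding le_iff_closed
  by (intro wdef_all_nset wdef_imp wdef_all_num wdef_num_mem wdef_num_Suc)

lemma wdef_num_less: "wdef (\<lambda>E. num (E i) < num (E j))"
  unfolding not_le[symmetric] by (intro wdef_not wdef_num_le)

lemma wdef_num_plus: "wdef (\<lambda>E. num (E j) = num (E i) + a)"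
proof (induction a arbitrary: i j)
  case 0
  then show ?case using wdef_num_eq[of j i] by simp
next
  case (Suc a)
  have "wdef (\<lambda>E. \<exists>m. m = num (E i) + a \<and> num (E j) = Suc m)"
    by (intro wdef_ex_num wdef_conj wdef_num_Suc Suc)
  then show ?case by simp
qed

text \<open>\<open>f (nset A)\<close> is \<open>A\<close> itself for a code and \<open>f {}\<close>
  otherwise; the latter is found as the only code that decodes to the empty set.\<close>

lemma wdef_nd_f_mem: "wdef (\<lambda>E. nd (E i) \<in> f (nset (E j)))"
proof (rule wdef_cong)
  show "wdef (\<lambda>E. (E j \<in> codes \<and> nd (E i) \<in> E j) \<or>
      (E j \<notin> codes \<and> (\<exists>B. finite B \<and> B \<in> codes \<and> nset B = {} \<and> nd (E i) \<in> B)))"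
    by (intro wdef_intros wdef_code wdef_nset_empty)
  fix E
  have empty: "B \<in> codes \<and> nset B = {} \<longleftrightarrow> B = f {}" for B
    using f_nset[of B] by (cases "B = f {}") auto
  have "(\<exists>B. finite B \<and> B \<in> codes \<and> nset B = {} \<and> nd (E i) \<in> B) \<longleftrightarrow> nd (E i) \<in> f {}"
    using empty f_finite[OF finite.emptyI] by metis
  then show "nd (E i) \<in> f (nset (E j)) \<longleftrightarrow> (E j \<in> codes \<and> nd (E i) \<in> E j) \<or>
      (E j \<notin> codes \<and> (\<exists>B. finite B \<and> B \<in> codes \<and> nset B = {} \<and> nd (E i) \<in> B))"
    using f_nset[of "E j"] nset_not_code[of "E j"] by (cases "E j \<in> codes") simp_all
qed

lemmas pdef_intros = wdef_intros wdef_code wdef_nset_subset wdef_ex_nset wdef_all_nset wdef_ex_num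
  wdef_all_num wdef_nset_empty wdef_num_mem wdef_num_Suc wdef_num_eq wdef_num_le wdef_num_less
  wdef_num_plus wdef_nd_f_mem

end

section \<open>Combinatorics of families of finite sets\<close>

definition first_diff :: "nat set \<Rightarrow> nat set \<Rightarrow> nat \<Rightarrow> bool" where
  "first_diff X Y d \<longleftrightarrow> (d \<in> X \<longleftrightarrow> d \<notin> Y) \<and> (\<forall>x. x < d \<longrightarrow> (x \<in> X \<longleftrightarrow> x \<in> Y))"

lemma first_diff_unique: "first_diff X Y d \<Longrightarrow> first_diff X Y d' \<Longrightarrow> d = d'"
  unfolding first_diff_def by (metis linorder_neqE_nat)

definition diffs :: "nat set set \<Rightarrow> nat set \<Rightarrow> nat set" where
  "diffs S Y = {d. \<exists>X\<in>S. first_diff X Y d}"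

lemma diffs_subset:
  assumes "S \<subseteq> Pow I" "Y \<in> S"
  shows "diffs S Y \<subseteq> I"
  using assms by (auto simp: diffs_def first_diff_def)

lemma finite_diffs:
  assumes "finite S"
  shows "finite (diffs S Y)"
proof -
  have "finite {d. first_diff X Y d}" for X
    by (cases "\<exists>d. first_diff X Y d") (auto intro: finite_subset[of _ "{_}"] dest: first_diff_unique)
  moreover have "diffs S Y = (\<Union>X\<in>S. {d. first_diff X Y d})" by (auto simp: diffs_def)
  ultimately show ?thesis using assms by simp
qed

text \<open>In the binary tree of initial segments of members of \<open>S\<close>, always descend into the more
  populous subtree.\<close>

lemma exists_branch_with_many_diffs:
  assumes "finite S" "S \<noteq> {}"
  shows "\<exists>Y\<in>S. card S \<le> 2 ^ card (diffs S Y)"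
  using assms
proof (induction "card S" arbitrary: S rule: less_induct)
  case less
  show ?case
  proof (cases "\<exists>x. \<exists>X\<in>S. \<exists>Y\<in>S. x \<in> X \<and> x \<notin> Y")
    case False
    then have "X = Y" if "X \<in> S" "Y \<in> S" for X Y using that by blast
    moreover obtain X where "X \<in> S" using less.prems by blast
    ultimately have "S = {X}" by blast
    then show ?thesis by simp
  next
    case True
    \<comment> \<open>The first position at which members of \<open>S\<close> split. All members
      agree below it, so it is the first difference of any two members on opposite sides. Keeping
      the larger side costs a factor of at most 2 in size and gains \<open>x\<close> as one more
      first difference.\<close>
    define x where "x = (LEAST x. \<exists>X\<in>S. \<exists>Y\<in>S. x \<in> X \<and> x \<notin> Y)"
    have x: "\<exists>X\<in>S. \<exists>Y\<in>S. x \<in> X \<and> x \<notin> Y"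
      unfolding x_def using True by (rule LeastI_ex)
    have agree: "y \<in> X \<longleftrightarrow> y \<in> Y" if "X \<in> S" "Y \<in> S" "y < x" for X Y y
      using not_less_Least[OF that(3)[unfolded x_def]] that(1,2) by blast
    have half: "\<exists>Y\<in>S. card S \<le> 2 ^ card (diffs S Y)"
      if b: "b = card {X\<in>S. (x \<in> X) = p}" "2 * b \<ge> card S" for b p
    proof -
      let ?S = "{X\<in>S. (x \<in> X) = p}"
      obtain X' where X': "X' \<in> S" "(x \<in> X') \<noteq> p" using x by (cases p) blast+
      have "card ?S < card S"
        by (rule psubset_card_mono) (use less.prems X' in auto)
      moreover have "?S \<noteq> {}" using x by (cases p) blast+
      ultimately obtain Y where Y: "Y \<in> ?S" "card ?S \<le> 2 ^ card (diffs ?S Y)"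
        using less.hyps[of ?S] less.prems by auto
      have "x \<notin> diffs ?S Y" using Y(1) by (auto simp: diffs_def first_diff_def)
      moreover have "insert x (diffs ?S Y) \<subseteq> diffs S Y"
      proof -
        have "x \<in> X' \<longleftrightarrow> x \<notin> Y" using X'(2) Y(1) by auto
        moreover have "\<forall>y. y < x \<longrightarrow> (y \<in> X' \<longleftrightarrow> y \<in> Y)" using agree[OF X'(1)] Y(1) by blast
        ultimately have "x \<in> diffs S Y" unfolding diffs_def first_diff_def using X'(1) by blast
        moreover have "diffs ?S Y \<subseteq> diffs S Y" by (auto simp: diffs_def)
        ultimately show ?thesis by blast
      qed
      ultimately have "Suc (card (diffs ?S Y)) \<le> card (diffs S Y)"
        using card_mono[OF finite_diffs[OF less.prems(1)], of "insert x (diffs ?S Y)" Y]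
          finite_diffs[of ?S Y] less.prems(1) by simp
      then have "2 ^ Suc (card (diffs ?S Y)) \<le> (2 :: nat) ^ card (diffs S Y)"
        by (rule power_increasing) simp
      then show ?thesis using Y b by (intro bexI[of _ Y]) auto
    qed
    have "S = {X\<in>S. (x \<in> X) = True} \<union> {X\<in>S. (x \<in> X) = False}" by blast
    then have "card S \<le> card {X\<in>S. (x \<in> X) = True} + card {X\<in>S. (x \<in> X) = False}"
      by (metis card_Un_le)
    then show ?thesis using half[OF refl, of True] half[OF refl, of False] by linarith
  qed
qed

lemma exists_large_fibre:
  assumes "finite A" "finite R" "g ` A \<subseteq> R" "A \<noteq> {}"
  shows "\<exists>y. card A \<le> card R * card {x\<in>A. g x = y}"
proof -
  let ?c = "\<lambda>y. card {x\<in>A. g x = y}"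
  have ne: "R \<noteq> {}" using assms by blast
  then have "Max (?c ` R) \<in> ?c ` R" using assms(2) by (intro Max_in) auto
  then obtain y where "y \<in> R" "?c y = Max (?c ` R)" by auto
  then have y: "\<forall>z\<in>R. ?c z \<le> ?c y" using assms(2) by simp
  have "card A = (\<Sum>x\<in>A. 1)" by simp
  also have "\<dots> = (\<Sum>y\<in>R. \<Sum>x\<in>{x\<in>A. g x = y}. 1)"
    using assms by (intro sum.group[symmetric]) auto
  also have "\<dots> = (\<Sum>y\<in>R. ?c y)" by simp
  also have "\<dots> \<le> of_nat (card R) * ?c y"
    by (rule sum_bounded_above) (use y in blast)
  finally show ?thesis by auto
qed

section \<open>Families closed under recombination across a region\<close>

definition mixable :: "('a \<Rightarrow> 'b set) \<Rightarrow> 'b set \<Rightarrow> 'a set \<Rightarrow> bool" where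
  "mixable F Z S \<longleftrightarrow> (\<forall>X\<in>S. \<forall>Y\<in>S. \<exists>W\<in>S. F W = (F X \<inter> Z) \<union> (F Y - Z))"

text \<open>A member \<open>X\<close> can be recovered from its two recombinations with the fixed
  \<open>X0\<close>: one keeps the part of \<open>X\<close> inside \<open>Z\<close> and lies in the
  first fibre, the other keeps the part outside and lies in the second.\<close>

lemma card_mixable:
  assumes "mixable F Z S" "inj_on F S" "finite S" "X0 \<in> S"
  shows "card S \<le> card {X\<in>S. F X - Z = F X0 - Z} * card {X\<in>S. F X \<inter> Z = F X0 \<inter> Z}"
proof -
  let ?A = "{X\<in>S. F X - Z = F X0 - Z}" and ?B = "{X\<in>S. F X \<inter> Z = F X0 \<inter> Z}"
  obtain m where m: "\<And>X Y. X \<in> S \<Longrightarrow> Y \<in> S \<Longrightarrow> m X Y \<in> S \<and> F (m X Y) = (F X \<inter> Z) \<union> (F Y - Z)"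
    using assms(1) unfolding mixable_def by metis
  have "inj_on (\<lambda>X. (m X X0, m X0 X)) S"
  proof (rule inj_onI)
    fix X Y assume XY: "X \<in> S" "Y \<in> S" "(m X X0, m X0 X) = (m Y X0, m X0 Y)"
    then have "F (m X X0) = F (m Y X0)" "F (m X0 X) = F (m X0 Y)" by simp_all
    then have "F X = F Y" using m XY(1,2) assms(4) by (auto simp: set_eq_iff)
    then show "X = Y" using assms(2) XY by (auto dest: inj_onD)
  qed
  moreover have "(\<lambda>X. (m X X0, m X0 X)) ` S \<subseteq> ?A \<times> ?B"
    using m assms(4) by auto
  ultimately have "card S \<le> card (?A \<times> ?B)"
    by (rule card_inj_on_le) (use assms(3) in simp)
  then show ?thesis by (simp add: card_cartesian_product)
qed

section \<open>Positions seen inside and outside a subtree\<close>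

context powerset_presentation
begin

definition eq_out :: "bool list \<Rightarrow> nat set \<Rightarrow> nat set \<Rightarrow> bool" where
  "eq_out w X Y \<longleftrightarrow> (\<forall>u. \<not> prefix w u \<longrightarrow> (u \<in> f X \<longleftrightarrow> u \<in> f Y))"

definition eq_in :: "bool list \<Rightarrow> nat set \<Rightarrow> nat set \<Rightarrow> bool" where
  "eq_in w X Y \<longleftrightarrow> (\<forall>u. prefix w u \<longrightarrow> (u \<in> f X \<longleftrightarrow> u \<in> f Y))"

text \<open>The reference set \<open>X0\<close> comes before the quantifier over positions. One
  reference for all of \<open>D\<close> is what allows the witnesses of different positions to be
  exchanged for one another.\<close>

definition seen_in :: "bool list \<Rightarrow> nat set \<Rightarrow> bool" where
  "seen_in w D \<longleftrightarrow> (\<exists>X0. finite X0 \<and>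
     (\<forall>d. d \<in> D \<longrightarrow> (\<exists>X. finite X \<and> eq_out w X X0 \<and> first_diff X X0 d)))"

definition seen_out :: "bool list \<Rightarrow> nat set \<Rightarrow> bool" where
  "seen_out w D \<longleftrightarrow> (\<exists>X0. finite X0 \<and>
     (\<forall>d. d \<in> D \<longrightarrow> (\<exists>X. finite X \<and> eq_in w X X0 \<and> first_diff X X0 d)))"

lemma wdef_first_diff: "wdef (\<lambda>E. first_diff (nset (E i)) (nset (E j)) (num (E k)))"
  unfolding first_diff_def by (intro pdef_intros)

lemma wdef_eq_out: "wdef (\<lambda>E. eq_out (nd (E i)) (nset (E j)) (nset (E k)))"
  unfolding eq_out_def by (intro pdef_intros)

lemma wdef_seen_in: "wdef (\<lambda>E. seen_in (nd (E i)) (nset (E j)))"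
  unfolding seen_in_def by (intro pdef_intros wdef_eq_out wdef_first_diff)

lemma seen_in_subset: "seen_in w D \<Longrightarrow> D' \<subseteq> D \<Longrightarrow> seen_in w D'"
  unfolding seen_in_def by (meson subsetD)

lemma seen_in_prefix:
  assumes "prefix u w" "seen_in w D"
  shows "seen_in u D"
proof -
  have "eq_out w X Y \<Longrightarrow> eq_out u X Y" for X Y
    using assms(1) unfolding eq_out_def by (meson prefix_order.trans)
  then show ?thesis using assms(2) unfolding seen_in_def by meson
qed

lemma seen_out_prefix:
  assumes "prefix u w" "seen_out u D"
  shows "seen_out w D"
proof -
  have "eq_in u X Y \<Longrightarrow> eq_in w X Y" for X Y
    using assms(1) unfolding eq_in_def by (meson prefix_order.trans)
  then show ?thesis using assms(2) unfolding seen_out_def by meson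
qed

lemma seen_in_seen_out_disjoint:
  assumes "\<not> prefix v w" "\<not> prefix w v" "seen_in w D"
  shows "seen_out v D"
proof -
  have "eq_out w X Y \<Longrightarrow> eq_in v X Y" for X Y
    using assms(1,2) unfolding eq_out_def eq_in_def by (meson prefix_same_cases)
  then show ?thesis using assms(3) unfolding seen_in_def seen_out_def by meson
qed

lemma seen_in_root: "seen_in [] D"
  unfolding seen_in_def
proof (rule exI[of _ "{}"], intro conjI allI impI)
  show "\<exists>X. finite X \<and> eq_out [] X {} \<and> first_diff X {} d" for d
    by (intro exI[of _ "{d}"]) (simp add: eq_out_def first_diff_def)
qed simp

lemma eq_in_sub: "eq_in w X Y \<Longrightarrow> sub w (f X) = sub w (f Y)"
  by (auto simp: eq_in_def sub_def)

text \<open>Comparing two first differences is a definable relation, but what happens inside \<open>w\<close> and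
  what happens outside interact through finitely many types only.\<close>

lemma bounded_alternation:
  "\<exists>N. \<forall>w D D' S. seen_in w D \<longrightarrow> seen_out w D' \<longrightarrow> S \<subseteq> D \<longrightarrow>
     (\<forall>x\<in>S. \<forall>y\<in>S. x < y \<longrightarrow> (\<exists>d\<in>D'. x < d \<and> d \<le> y)) \<longrightarrow> finite S \<and> card S \<le> N"
proof -
  define P where "P E \<longleftrightarrow> (\<exists>d d'. first_diff (nset (E 0)) (nset (E 1)) d \<and>
    first_diff (nset (E 2)) (nset (E 3)) d' \<and> d < d')" for E :: "nat \<Rightarrow> bool list set"
  have "wdef P" unfolding P_def by (intro pdef_intros wdef_first_diff)
  then obtain t :: "(nat \<Rightarrow> bool list set) \<Rightarrow> nat" where t: "decides t P"
    using wdef_recognizable recognizable_def by blast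
  define env where "env X X' Y Y' = (\<lambda>i::nat. if i = 0 then f X else if i = 1 then f X'
      else if i = 2 then f Y else f Y')" for X X' Y Y'
  have P_env: "P (env X X' Y Y') \<longleftrightarrow> d < d'"
    if "finite X" "finite X'" "finite Y" "finite Y'" "first_diff X X' d" "first_diff Y Y' d'"
    for X X' Y Y' d d'
    unfolding P_def env_def using that by (auto dest: first_diff_unique)
  show ?thesis
  proof (intro exI[of _ "card (range t)"] allI impI)
    fix w D D' S
    assume "seen_in w D" "seen_out w D'" and S: "S \<subseteq> D"
      and alt: "\<forall>x\<in>S. \<forall>y\<in>S. x < y \<longrightarrow> (\<exists>d\<in>D'. x < d \<and> d \<le> y)"
    then obtain X0 Y0 where fin: "finite X0" "finite Y0"
      and X: "\<forall>d. d \<in> D \<longrightarrow> (\<exists>X. finite X \<and> eq_out w X X0 \<and> first_diff X X0 d)"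
      and Y: "\<And>d. d \<in> D' \<Longrightarrow> \<exists>X. finite X \<and> eq_in w X Y0 \<and> first_diff X Y0 d"
      unfolding seen_in_def seen_out_def by blast
    obtain A where A: "\<And>d. d \<in> D \<Longrightarrow> finite (A d) \<and> eq_out w (A d) X0 \<and> first_diff (A d) X0 d"
      using X by metis
    \<comment> \<open>The type is computed with \<open>Y0\<close> in place of a witness
      \<open>B\<close> for a position of \<open>D'\<close>. Inside \<open>w\<close> every such
      \<open>B\<close> coincides with \<open>Y0\<close>, so \<open>g\<close> need not know which one
      will be used.\<close>
    define g where "g d = t (\<lambda>i. sub w (env (A d) X0 Y0 Y0 i))" for d
    have *: "g x \<noteq> g y" if xy: "x \<in> S" "y \<in> S" "x < y" for x y
    proof
      assume "g x = g y"
      obtain d where d: "d \<in> D'" "x < d" "d \<le> y"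
        using alt[rule_format, OF xy] by blast
      then obtain B where B: "finite B" "eq_in w B Y0" "first_diff B Y0 d" using Y by blast
      have [simp]: "finite (A x)" "finite (A y)" using A S xy by blast+
      have sub: "(\<lambda>i. sub w (env (A z) X0 B Y0 i)) = (\<lambda>i. sub w (env (A z) X0 Y0 Y0 i))" for z
        using eq_in_sub[OF B(2)] by (intro ext) (simp add: env_def)
      \<comment> \<open>Equal types would permit replacing \<open>A x\<close> by \<open>A y\<close>
        in the comparison with \<open>B\<close>, although \<open>d\<close> lies beyond
        \<open>x\<close> but not beyond \<open>y\<close>.\<close>
      have "P (env (A x) X0 B Y0) \<longleftrightarrow> P (env (A y) X0 B Y0)"
      proof (rule decidesD[OF t, of _ _ w])
        show "eqout w (env (A x) X0 B Y0 i) (env (A y) X0 B Y0 i)" for i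
          using A[of x] A[of y] xy S by (auto simp: env_def eqout_def eq_out_def subset_iff)
        show "t (\<lambda>i. sub w (env (A x) X0 B Y0 i)) = t (\<lambda>i. sub w (env (A y) X0 B Y0 i))"
          unfolding sub using \<open>g x = g y\<close> by (simp add: g_def)
      qed (use fin B in \<open>simp_all add: env_def\<close>)
      moreover have "P (env (A z) X0 B Y0) \<longleftrightarrow> z < d" if "z \<in> S" for z
        using A[of z] S that fin B by (intro P_env) auto
      ultimately show False using xy d by auto
    qed
    have inj: "inj_on g S"
      by (rule inj_onI) (metis * linorder_neqE_nat)
    have img: "g ` S \<subseteq> range t" by (auto simp: g_def)
    show "finite S \<and> card S \<le> card (range t)"
      using inj_on_finite[OF inj img decides_finite[OF t]] card_inj_on_le[OF inj img decides_finite[OF t]]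
      by blast
  qed
qed

text \<open>If no \<open>f {x}\<close> enters the subtree at \<open>w\<close>, then among sets with
  codes equal outside it the type of the inside decides whether \<open>x\<close> is a member.
  Witnesses with first differences \<open>x < y\<close> disagree about \<open>x\<close>, so all
  witnesses have distinct types. This will leave only finitely many nodes that see enough of a given
  block.\<close>

lemma seen_in_meets_subtree:
  "\<exists>N. \<forall>w D. seen_in w D \<longrightarrow> card D > N \<longrightarrow> (\<exists>x\<in>D. sub w (f {x}) \<noteq> {})"
proof -
  define P where "P E \<longleftrightarrow> nset (E 0) \<subseteq> nset (E 1)" for E :: "nat \<Rightarrow> bool list set"
  have "wdef P" unfolding P_def by (rule wdef_nset_subset)
  then obtain t :: "(nat \<Rightarrow> bool list set) \<Rightarrow> nat" where t: "decides t P"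
    using wdef_recognizable recognizable_def by blast
  define env where "env X Y = (\<lambda>i::nat. if i = 0 then f X else f Y)" for X Y
  show ?thesis
  proof (intro exI[of _ "card (range t)"] allI impI, rule ccontr)
    fix w D assume "seen_in w D" and card: "card (range t) < card D"
      and "\<not> (\<exists>x\<in>D. sub w (f {x}) \<noteq> {})"
    then obtain X0 where fin: "finite X0" and empty: "\<And>x. x \<in> D \<Longrightarrow> sub w (f {x}) = {}"
      and X: "\<forall>d. d \<in> D \<longrightarrow> (\<exists>X. finite X \<and> eq_out w X X0 \<and> first_diff X X0 d)"
      unfolding seen_in_def by blast
    obtain A where A: "\<And>d. d \<in> D \<Longrightarrow> finite (A d) \<and> eq_out w (A d) X0 \<and> first_diff (A d) X0 d"
      using X by metis
    define g where "g d = t (\<lambda>i::nat. if i = 0 then {} else sub w (f (A d)))" for d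
    have *: "g x \<noteq> g y" if "x \<in> D" "y \<in> D" "x < y" for x y
    proof
      assume "g x = g y"
      have sub: "(\<lambda>i. sub w (env {x} (A z) i)) = (\<lambda>i. if i = 0 then {} else sub w (f (A z)))" for z
        using empty[OF that(1)] by (intro ext) (simp add: env_def)
      have "P (env {x} (A x)) \<longleftrightarrow> P (env {x} (A y))"
      proof (rule decidesD[OF t, of _ _ w])
        show "eqout w (env {x} (A x) i) (env {x} (A y) i)" for i
          using A[of x] A[of y] that by (auto simp: env_def eqout_def eq_out_def)
        show "t (\<lambda>i. sub w (env {x} (A x) i)) = t (\<lambda>i. sub w (env {x} (A y) i))"
          unfolding sub using \<open>g x = g y\<close> by (simp add: g_def)
      qed (use A that in \<open>simp_all add: env_def\<close>)
      then have "x \<in> A x \<longleftrightarrow> x \<in> A y" using A[of x] A[of y] that by (simp add: P_def env_def)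
      then show False using A[of x] A[of y] that by (simp add: first_diff_def)
    qed
    have "inj_on g D"
      by (rule inj_onI) (metis * linorder_neqE_nat)
    moreover have "g ` D \<subseteq> range t" by (auto simp: g_def)
    ultimately have "card D \<le> card (range t)" using decides_finite[OF t] by (rule card_inj_on_le)
    then show False using card by simp
  qed
qed

section \<open>Counting codes region by region\<close>

lemma comb_in:
  assumes "finite S" "S \<noteq> {}" "S \<subseteq> Pow I" "finite I" "\<And>X Y. X \<in> S \<Longrightarrow> Y \<in> S \<Longrightarrow> eq_out w X Y"
  shows "\<exists>B\<subseteq>I. seen_in w B \<and> card S \<le> 2 ^ card B"
proof -
  obtain Y where Y: "Y \<in> S" "card S \<le> 2 ^ card (diffs S Y)"
    using exists_branch_with_many_diffs assms(1,2) by blast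
  have fin: "X \<in> S \<Longrightarrow> finite X" for X using assms(3,4) finite_subset by blast
  have "seen_in w (diffs S Y)"
    unfolding seen_in_def
  proof (rule exI[of _ Y], intro conjI allI impI)
    show "finite Y" using Y(1) by (rule fin)
    fix d assume "d \<in> diffs S Y"
    then obtain X where "X \<in> S" "first_diff X Y d" unfolding diffs_def by blast
    then show "\<exists>X. finite X \<and> eq_out w X Y \<and> first_diff X Y d"
      using fin assms(5) Y(1) by metis
  qed
  then show ?thesis using Y diffs_subset[OF assms(3) Y(1)] by blast
qed

lemma comb_out:
  assumes "finite S" "S \<noteq> {}" "S \<subseteq> Pow I" "finite I" "\<And>X Y. X \<in> S \<Longrightarrow> Y \<in> S \<Longrightarrow> eq_in w X Y"
  shows "\<exists>B\<subseteq>I. seen_out w B \<and> card S \<le> 2 ^ card B"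
proof -
  obtain Y where Y: "Y \<in> S" "card S \<le> 2 ^ card (diffs S Y)"
    using exists_branch_with_many_diffs assms(1,2) by blast
  have fin: "X \<in> S \<Longrightarrow> finite X" for X using assms(3,4) finite_subset by blast
  have "seen_out w (diffs S Y)"
    unfolding seen_out_def
  proof (rule exI[of _ Y], intro conjI allI impI)
    show "finite Y" using Y(1) by (rule fin)
    fix d assume "d \<in> diffs S Y"
    then obtain X where "X \<in> S" "first_diff X Y d" unfolding diffs_def by blast
    then show "\<exists>X. finite X \<and> eq_in w X Y \<and> first_diff X Y d"
      using fin assms(5) Y(1) by metis
  qed
  then show ?thesis using Y diffs_subset[OF assms(3) Y(1)] by blast
qed

lemma comb_in_fibre:
  assumes "finite S" "X0 \<in> S" "S \<subseteq> Pow I" "finite I"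
  shows "\<exists>B\<subseteq>I. seen_in w B \<and>
    card {X\<in>S. f X - {u. prefix w u} = f X0 - {u. prefix w u}} \<le> 2 ^ card B"
proof (rule comb_in)
  fix X Y
  assume "X \<in> {X\<in>S. f X - {u. prefix w u} = f X0 - {u. prefix w u}}"
    and "Y \<in> {X\<in>S. f X - {u. prefix w u} = f X0 - {u. prefix w u}}"
  then have eq: "f X - {u. prefix w u} = f Y - {u. prefix w u}" by simp
  have "u \<in> f X \<longleftrightarrow> u \<in> f Y" if "\<not> prefix w u" for u
    using eq[unfolded set_eq_iff, rule_format, of u] that by simp
  then show "eq_out w X Y" by (simp add: eq_out_def)
qed (use assms in auto)

lemma comb_out_fibre:
  assumes "finite S" "X0 \<in> S" "S \<subseteq> Pow I" "finite I"
  shows "\<exists>B\<subseteq>I. seen_out w B \<and>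
    card {X\<in>S. f X \<inter> {u. prefix w u} = f X0 \<inter> {u. prefix w u}} \<le> 2 ^ card B"
proof (rule comb_out)
  fix X Y
  assume "X \<in> {X\<in>S. f X \<inter> {u. prefix w u} = f X0 \<inter> {u. prefix w u}}"
    and "Y \<in> {X\<in>S. f X \<inter> {u. prefix w u} = f X0 \<inter> {u. prefix w u}}"
  then have eq: "f X \<inter> {u. prefix w u} = f Y \<inter> {u. prefix w u}" by simp
  have "u \<in> f X \<longleftrightarrow> u \<in> f Y" if "prefix w u" for u
    using eq[unfolded set_eq_iff, rule_format, of u] that by simp
  then show "eq_in w X Y" by (simp add: eq_in_def)
qed (use assms in auto)

text \<open>A type of the part of the code of \<open>X\<close> below \<open>w\<close>. The set
  \<open>I\<close> is a parameter because a recombination must again be the code of a subset of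
  \<open>I\<close>, not merely a code; otherwise the family being counted would not be
  closed.\<close>

definition mixing_type :: "(nat set \<Rightarrow> bool list \<Rightarrow> nat set \<Rightarrow> 'q) \<Rightarrow> 'q set \<Rightarrow> bool" where
  "mixing_type \<kappa> R \<longleftrightarrow> finite R \<and> (\<forall>I w X. \<kappa> I w X \<in> R) \<and>
     (\<forall>I w X Y. finite I \<longrightarrow> X \<subseteq> I \<longrightarrow> Y \<subseteq> I \<longrightarrow> \<kappa> I w X = \<kappa> I w Y \<longrightarrow>
        (\<exists>W\<subseteq>I. f W = (f X \<inter> {u. prefix w u}) \<union> (f Y - {u. prefix w u}))) \<and>
     (\<forall>I w X Y. sub w (f X) = sub w (f Y) \<longrightarrow> \<kappa> I w X = \<kappa> I w Y)"

lemma exists_mixing_type: "\<exists>(\<kappa> :: nat set \<Rightarrow> bool list \<Rightarrow> nat set \<Rightarrow> nat) R. mixing_type \<kappa> R"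
proof -
  define P where "P E \<longleftrightarrow> E 0 \<in> codes \<and> nset (E 0) \<subseteq> nset (E 1)" for E :: "nat \<Rightarrow> bool list set"
  have "wdef P" unfolding P_def by (intro wdef_conj wdef_code wdef_nset_subset)
  then obtain t :: "(nat \<Rightarrow> bool list set) \<Rightarrow> nat" where t: "decides t P"
    using wdef_recognizable recognizable_def by blast
  define env where "env A I = (\<lambda>i::nat. if i = 0 then A else f I)" for A I
  define \<kappa> where "\<kappa> I w X = t (\<lambda>i. sub w (env (f X) I i))" for I w X
  have "mixing_type \<kappa> (range t)"
    unfolding mixing_type_def
  proof (intro conjI allI impI)
    show "finite (range t)" using t by (rule decides_finite)
    show "\<kappa> I w X \<in> range t" for I w X by (simp add: \<kappa>_def)
    show "\<kappa> I w X = \<kappa> I w Y" if "sub w (f X) = sub w (f Y)" for I w X Y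
    proof -
      have "(\<lambda>i. sub w (env (f X) I i)) = (\<lambda>i. sub w (env (f Y) I i))"
        using that by (intro ext) (simp add: env_def)
      then show ?thesis by (simp add: \<kappa>_def)
    qed
  next
    fix I w X Y assume I: "finite I" "X \<subseteq> I" "Y \<subseteq> I" and \<kappa>: "\<kappa> I w X = \<kappa> I w Y"
    let ?A = "(f X \<inter> {u. prefix w u}) \<union> (f Y - {u. prefix w u})"
    have fin: "finite X" "finite Y" using I finite_subset by blast+
    have sub: "(\<lambda>i. sub w (env ?A I i)) = (\<lambda>i. sub w (env (f X) I i))"
      by (intro ext) (auto simp: env_def sub_def)
    have "P (env (f Y) I) \<longleftrightarrow> P (env ?A I)"
    proof (rule decidesD[OF t, of _ _ w])
      show "t (\<lambda>i. sub w (env (f Y) I i)) = t (\<lambda>i. sub w (env ?A I i))"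
        unfolding sub using \<kappa> by (simp add: \<kappa>_def)
    qed (use fin I in \<open>simp_all add: env_def eqout_def\<close>)
    moreover have "P (env (f Y) I)" using I fin by (simp add: P_def env_def)
    ultimately have "?A \<in> codes" "nset ?A \<subseteq> I" using I by (simp_all add: P_def env_def)
    then show "\<exists>W\<subseteq>I. f W = ?A" using f_nset by blast
  qed
  then show ?thesis by blast
qed

lemma inj_on_f: "S \<subseteq> Pow I \<Longrightarrow> finite I \<Longrightarrow> inj_on f S"
  by (rule inj_onI) (metis PowD f_inj finite_subset subsetD)

lemma sub_subtree:
  assumes "f X \<inter> {u. prefix w u} = f Y \<inter> {u. prefix w u}"
  shows "sub w (f X) = sub w (f Y)"
proof -
  have "w @ v \<in> f X \<longleftrightarrow> w @ v \<in> f Y" for v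
    using assms[unfolded set_eq_iff, rule_format, of "w @ v"] by simp
  then show ?thesis by (simp add: sub_def)
qed

text \<open>Among the \<open>2 ^ card I\<close> subsets, a most frequent type yields a mixable
  family with at least the fraction \<open>1 / card R\<close> of them. Its size is bounded by a
  product of two fibres, and each fibre provides a seen set at least as large as its binary
  logarithm. The constant \<open>card R\<close> is a crude bound for the logarithm of
  \<open>card R\<close>.\<close>

lemma two_region_combs:
  "\<exists>c. \<forall>w I. finite I \<longrightarrow> (\<exists>B1\<subseteq>I. \<exists>B2\<subseteq>I. seen_in w B1 \<and> seen_out w B2 \<and>
     card I \<le> card B1 + card B2 + c)"
proof -
  obtain \<kappa> :: "nat set \<Rightarrow> bool list \<Rightarrow> nat set \<Rightarrow> nat" and R where m: "mixing_type \<kappa> R"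
    using exists_mixing_type by blast
  have R: "finite R" "\<And>I w X. \<kappa> I w X \<in> R"
    and mix: "\<And>I w X Y. finite I \<Longrightarrow> X \<subseteq> I \<Longrightarrow> Y \<subseteq> I \<Longrightarrow> \<kappa> I w X = \<kappa> I w Y \<Longrightarrow>
      \<exists>W\<subseteq>I. f W = (f X \<inter> {u. prefix w u}) \<union> (f Y - {u. prefix w u})"
    and \<kappa>: "\<And>I w X Y. sub w (f X) = sub w (f Y) \<Longrightarrow> \<kappa> I w X = \<kappa> I w Y"
    using m unfolding mixing_type_def by (elim conjE; metis)+
  show ?thesis
  proof (intro exI[of _ "card R"] allI impI)
    fix w :: "bool list" and I :: "nat set" assume I: "finite I"
    define Z where "Z = {u. prefix w u}"
    have "\<kappa> I w ` Pow I \<subseteq> R" using R(2) by blast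
    then obtain y where "card (Pow I) \<le> card R * card {X\<in>Pow I. \<kappa> I w X = y}"
      using exists_large_fibre[OF finite_Pow_iff[THEN iffD2, OF I] R(1)] by blast
    moreover define S where "S = {X\<in>Pow I. \<kappa> I w X = y}"
    ultimately have S: "2 ^ card I \<le> card R * card S" using I by (simp add: card_Pow)
    have finS: "finite S" "S \<subseteq> Pow I" using I by (auto simp: S_def)
    have "S \<noteq> {}" using S by (metis card.empty mult_0_right not_less zero_less_numeral zero_less_power)
    then obtain X0 where X0: "X0 \<in> S" by blast
    have "mixable f Z S"
      unfolding mixable_def
    proof (intro ballI)
      fix X Y assume XY: "X \<in> S" "Y \<in> S"
      then obtain W where W: "W \<subseteq> I" "f W = (f X \<inter> Z) \<union> (f Y - Z)"
        using mix[OF I, of X Y w] by (auto simp: S_def Z_def)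
      have "\<kappa> I w W = \<kappa> I w X" by (rule \<kappa>, rule sub_subtree) (use W(2) in \<open>auto simp: Z_def\<close>)
      then have "W \<in> S" using W XY by (simp add: S_def)
      then show "\<exists>W\<in>S. f W = (f X \<inter> Z) \<union> (f Y - Z)" using W by blast
    qed
    then have card: "card S \<le> card {X\<in>S. f X - Z = f X0 - Z} * card {X\<in>S. f X \<inter> Z = f X0 \<inter> Z}"
      using inj_on_f[OF finS(2) I] finS(1) X0 by (rule card_mixable)
    obtain B1 where B1: "B1 \<subseteq> I" "seen_in w B1" "card {X\<in>S. f X - Z = f X0 - Z} \<le> 2 ^ card B1"
      using comb_in_fibre[OF finS(1) X0 finS(2) I, of w] unfolding Z_def by blast
    obtain B2 where B2: "B2 \<subseteq> I" "seen_out w B2" "card {X\<in>S. f X \<inter> Z = f X0 \<inter> Z} \<le> 2 ^ card B2"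
      using comb_out_fibre[OF finS(1) X0 finS(2) I, of w] unfolding Z_def by blast
    have "2 ^ card I \<le> card R * card S" by (rule S)
    also have "\<dots> \<le> 2 ^ card R * (2 ^ card B1 * 2 ^ card B2)"
      by (intro mult_le_mono order.trans[OF card mult_le_mono[OF B1(3) B2(3)]] less_imp_le[OF less_exp])
    also have "\<dots> = 2 ^ (card B1 + card B2 + card R)" by (simp add: power_add)
    finally have "card I \<le> card B1 + card B2 + card R" by (rule power_le_imp_le_exp[rotated]) simp
    then show "\<exists>B1\<subseteq>I. \<exists>B2\<subseteq>I. seen_in w B1 \<and> seen_out w B2 \<and> card I \<le> card B1 + card B2 + card R"
      using B1 B2 by blast
  qed
qed

text \<open>The same count with recombination at both children of \<open>w\<close>. Membership of
  \<open>w\<close> itself is fixed along with the two types, so that agreement below both children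
  amounts to agreement on the whole subtree at \<open>w\<close>, as \<open>seen_out w\<close>
  requires. Two types and one bit account for \<open>2 * card R + 1\<close>.\<close>

lemma three_region_combs:
  "\<exists>c. \<forall>w I. finite I \<longrightarrow> (\<exists>B0\<subseteq>I. \<exists>B1\<subseteq>I. \<exists>B2\<subseteq>I.
     seen_in (w @ [False]) B0 \<and> seen_in (w @ [True]) B1 \<and> seen_out w B2 \<and>
     card I \<le> card B0 + card B1 + card B2 + c)"
proof -
  obtain \<kappa> :: "nat set \<Rightarrow> bool list \<Rightarrow> nat set \<Rightarrow> nat" and R where m: "mixing_type \<kappa> R"
    using exists_mixing_type by blast
  have R: "finite R" "\<And>I w X. \<kappa> I w X \<in> R"
    and mix: "\<And>I w X Y. finite I \<Longrightarrow> X \<subseteq> I \<Longrightarrow> Y \<subseteq> I \<Longrightarrow> \<kappa> I w X = \<kappa> I w Y \<Longrightarrow>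
      \<exists>W\<subseteq>I. f W = (f X \<inter> {u. prefix w u}) \<union> (f Y - {u. prefix w u})"
    and \<kappa>: "\<And>I w X Y. sub w (f X) = sub w (f Y) \<Longrightarrow> \<kappa> I w X = \<kappa> I w Y"
    using m unfolding mixing_type_def by (elim conjE; metis)+
  show ?thesis
  proof (intro exI[of _ "2 * card R + 1"] allI impI)
    fix w :: "bool list" and I :: "nat set" assume I: "finite I"
    let ?w0 = "w @ [False]" and ?w1 = "w @ [True]"
    define Z0 where "Z0 = {u. prefix ?w0 u}"
    define Z1 where "Z1 = {u. prefix ?w1 u}"
    have disj: "Z0 \<inter> Z1 = {}" "w \<notin> Z0" "w \<notin> Z1"
      by (auto simp: Z0_def Z1_def prefix_def)
    define g where "g X = (\<kappa> I ?w0 X, \<kappa> I ?w1 X, w \<in> f X)" for X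
    have img: "g ` Pow I \<subseteq> R \<times> R \<times> UNIV" using R by (auto simp: g_def)
    have "finite (R \<times> R \<times> (UNIV :: bool set))" using R(1) by simp
    from exists_large_fibre[OF finite_Pow_iff[THEN iffD2, OF I] this img]
    obtain y where "card (Pow I) \<le> card (R \<times> R \<times> (UNIV :: bool set)) * card {X\<in>Pow I. g X = y}"
      by blast
    moreover define S where "S = {X\<in>Pow I. g X = y}"
    ultimately have S: "2 ^ card I \<le> (card R * (card R * 2)) * card S"
      using I by (simp add: card_Pow card_cartesian_product)
    have finS: "finite S" "S \<subseteq> Pow I" using I by (auto simp: S_def)
    have "S \<noteq> {}" using S by (metis card.empty mult_0_right not_less zero_less_numeral zero_less_power)
    then obtain X0 where X0: "X0 \<in> S" by blast
    \<comment> \<open>Recombining at one child takes that child's part from \<open>X\<close> and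
      leaves the sibling's part and the node \<open>w\<close> as in \<open>Y\<close>, so all three
      components of \<open>g\<close> survive and the result is again in \<open>S\<close>.\<close>
    have mixS: "\<exists>W\<in>S. f W = (f X \<inter> Z) \<union> (f Y - Z)"
      if XY: "X \<in> S" "Y \<in> S" and Z: "Z = Z0 \<and> v = ?w0 \<and> v' = ?w1 \<or> Z = Z1 \<and> v = ?w1 \<and> v' = ?w0"
      for X Y Z v v'
    proof -
      have Zv: "Z = {u. prefix v u}" using Z by (auto simp: Z0_def Z1_def)
      have eq: "\<kappa> I v X = \<kappa> I v Y" "X \<subseteq> I" "Y \<subseteq> I" using XY Z by (auto simp: S_def g_def)
      obtain W where W: "W \<subseteq> I" "f W = (f X \<inter> Z) \<union> (f Y - Z)"
        using mix[OF I eq(2,3,1)] unfolding Zv by blast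
      have "\<kappa> I v W = \<kappa> I v X"
        by (rule \<kappa>, rule sub_subtree) (use W(2) in \<open>auto simp: Zv\<close>)
      moreover have "\<kappa> I v' W = \<kappa> I v' Y"
      proof (rule \<kappa>, rule sub_subtree)
        have "{u. prefix v' u} \<inter> Z = {}" using Z disj(1) by (auto simp: Z0_def Z1_def)
        then show "f W \<inter> {u. prefix v' u} = f Y \<inter> {u. prefix v' u}" using W(2) by blast
      qed
      moreover have "w \<in> f W \<longleftrightarrow> w \<in> f Y" using W(2) Z disj by blast
      ultimately have "g W = g X" using XY Z by (auto simp: S_def g_def)
      then have "W \<in> S" using W XY by (simp add: S_def)
      then show ?thesis using W by blast
    qed
    \<comment> \<open>Freezing the contents below the left child leaves a family that can still be
      recombined at the right child, and the product bound is applied to it a second time.\<close>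
    define S' where "S' = {X\<in>S. f X \<inter> Z0 = f X0 \<inter> Z0}"
    have "mixable f Z0 S" unfolding mixable_def using mixS[of _ _ Z0 ?w0 ?w1] by blast
    then have card: "card S \<le> card {X\<in>S. f X - Z0 = f X0 - Z0} * card S'"
      unfolding S'_def using inj_on_f[OF finS(2) I] finS(1) X0 by (rule card_mixable)
    have finS': "finite S'" "S' \<subseteq> Pow I" "X0 \<in> S'" using finS X0 by (auto simp: S'_def)
    have "mixable f Z1 S'"
      unfolding mixable_def
    proof (intro ballI)
      fix X Y assume XY: "X \<in> S'" "Y \<in> S'"
      then obtain W where W: "W \<in> S" "f W = (f X \<inter> Z1) \<union> (f Y - Z1)"
        using mixS[of X Y Z1 ?w1 ?w0] by (auto simp: S'_def)
      then have "f W \<inter> Z0 = f Y \<inter> Z0" using disj(1) by blast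
      then show "\<exists>W\<in>S'. f W = (f X \<inter> Z1) \<union> (f Y - Z1)"
        using W XY by (intro bexI[of _ W]) (auto simp: S'_def)
    qed
    then have card': "card S' \<le> card {X\<in>S'. f X - Z1 = f X0 - Z1} * card {X\<in>S'. f X \<inter> Z1 = f X0 \<inter> Z1}"
      using inj_on_f[OF finS'(2) I] finS'(1,3) by (rule card_mixable)
    obtain B0 where B0: "B0 \<subseteq> I" "seen_in ?w0 B0" "card {X\<in>S. f X - Z0 = f X0 - Z0} \<le> 2 ^ card B0"
      using comb_in_fibre[OF finS(1) X0 finS(2) I, of ?w0] unfolding Z0_def by blast
    obtain B1 where B1: "B1 \<subseteq> I" "seen_in ?w1 B1" "card {X\<in>S'. f X - Z1 = f X0 - Z1} \<le> 2 ^ card B1"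
      using comb_in_fibre[OF finS'(1,3,2) I, of ?w1] unfolding Z1_def by blast
    have "\<exists>B\<subseteq>I. seen_out w B \<and> card {X\<in>S'. f X \<inter> Z1 = f X0 \<inter> Z1} \<le> 2 ^ card B"
    proof (rule comb_out)
      fix X Y assume XY: "X \<in> {X\<in>S'. f X \<inter> Z1 = f X0 \<inter> Z1}" "Y \<in> {X\<in>S'. f X \<inter> Z1 = f X0 \<inter> Z1}"
      then have eq0: "f X \<inter> Z0 = f Y \<inter> Z0" and eq1: "f X \<inter> Z1 = f Y \<inter> Z1"
        by (simp_all add: S'_def)
      have "g X = g Y" using XY by (simp add: S'_def S_def)
      then have eqw: "w \<in> f X \<longleftrightarrow> w \<in> f Y" by (simp add: g_def)
      have "u \<in> f X \<longleftrightarrow> u \<in> f Y" if pre: "prefix w u" for u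
      proof -
        obtain v where u: "u = w @ v" using pre by (auto simp: prefix_def)
        consider "u = w" | "u \<in> Z0" | "u \<in> Z1"
        proof (cases v)
          case (Cons b v')
          then have "u \<in> Z0 \<or> u \<in> Z1" using u by (cases b) (simp_all add: Z0_def Z1_def)
          then show ?thesis using that(2,3) by blast
        qed (use that(1) u in simp)
        then show ?thesis
          using eq0[unfolded set_eq_iff, rule_format, of u] eq1[unfolded set_eq_iff, rule_format, of u] eqw
          by cases simp_all
      qed
      then show "eq_in w X Y" by (simp add: eq_in_def)
    qed (use finS' I in auto)
    then obtain B2 where B2: "B2 \<subseteq> I" "seen_out w B2" "card {X\<in>S'. f X \<inter> Z1 = f X0 \<inter> Z1} \<le> 2 ^ card B2"
      by blast
    have "2 ^ card I \<le> (card R * (card R * 2)) * card S" by (rule S)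
    also have "\<dots> \<le> (2 ^ card R * (2 ^ card R * 2)) * (2 ^ card B0 * (2 ^ card B1 * 2 ^ card B2))"
      by (intro mult_le_mono less_imp_le[OF less_exp] order_refl
          order.trans[OF card mult_le_mono[OF B0(3) order.trans[OF card' mult_le_mono[OF B1(3) B2(3)]]]])
    also have "\<dots> = 2 ^ (card B0 + card B1 + card B2 + (2 * card R + 1))"
      by (simp add: power_add mult_2)
    finally have "card I \<le> card B0 + card B1 + card B2 + (2 * card R + 1)"
      by (rule power_le_imp_le_exp[rotated]) simp
    then show "\<exists>B0\<subseteq>I. \<exists>B1\<subseteq>I. \<exists>B2\<subseteq>I. seen_in ?w0 B0 \<and> seen_in ?w1 B1 \<and> seen_out w B2 \<and>
        card I \<le> card B0 + card B1 + card B2 + (2 * card R + 1)"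
      using B0 B1 B2 by blast
  qed
qed

end

section \<open>Leftmost leaves of binary trees, and ranks within fibres\<close>

lemma leftmost_leaf_exists:
  fixes S :: "bool list set"
  assumes "finite S" "[] \<in> S"
  shows "\<exists>w\<in>S. w @ [False] \<notin> S \<and> w @ [True] \<notin> S \<and>
    (\<forall>u. prefix (u @ [True]) w \<longrightarrow> u @ [False] \<notin> S)"
proof -
  \<comment> \<open>The nodes whose path never turns right where turning left would stay in
    \<open>S\<close>. A longest one has no child in \<open>S\<close>: a left child would extend it
    within \<open>G\<close>, and without a left child so would a right one.\<close>
  define G where "G = {v\<in>S. \<forall>u. prefix (u @ [True]) v \<longrightarrow> u @ [False] \<notin> S}"
  have "finite G" "[] \<in> G" using assms by (auto simp: G_def)
  then have "Max (length ` G) \<in> length ` G" by (intro Max_in) auto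
  then obtain v where v: "v \<in> G" "length v = Max (length ` G)" by auto
  have max: "length u \<le> length v" if "u \<in> G" for u
    using that \<open>finite G\<close> v(2) by simp
  have ext: "v @ [b] \<notin> S" if b: "b \<Longrightarrow> v @ [False] \<notin> S" for b
  proof
    assume "v @ [b] \<in> S"
    moreover have "u @ [False] \<notin> S" if "prefix (u @ [True]) (v @ [b])" for u
      using that v(1) b by (auto simp: G_def)
    ultimately have "v @ [b] \<in> G" by (simp add: G_def)
    then show False using max by force
  qed
  have "v @ [False] \<notin> S" using ext[of False] by simp
  moreover have "v @ [True] \<notin> S" using ext[of True] calculation by simp
  ultimately show ?thesis using v(1) by (intro bexI[of _ v]) (auto simp: G_def)
qed

text \<open>Two distinct leaves are incomparable. Where their paths part, the one turning right
  passes by a left child that belongs to \<open>S\<close>, being a prefix of the other leaf.\<close>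

lemma leftmost_leaf_unique:
  fixes S :: "bool list set"
  assumes closed: "\<And>u w. w \<in> S \<Longrightarrow> prefix u w \<Longrightarrow> u \<in> S"
    and w: "w \<in> S" "w @ [False] \<notin> S" "w @ [True] \<notin> S"
      "\<forall>u. prefix (u @ [True]) w \<longrightarrow> u @ [False] \<notin> S"
    and w': "w' \<in> S" "w' @ [False] \<notin> S" "w' @ [True] \<notin> S"
      "\<forall>u. prefix (u @ [True]) w' \<longrightarrow> u @ [False] \<notin> S"
  shows "w = w'"
proof (rule ccontr)
  assume "w \<noteq> w'"
  have leaf: "\<not> strict_prefix u v" if "v \<in> S" "u @ [False] \<notin> S" "u @ [True] \<notin> S" for u v
  proof
    assume "strict_prefix u v"
    then obtain b z where "v = u @ b # z" by (rule strict_prefixE')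
    then have "u @ [b] \<in> S" using closed[of v "u @ [b]"] that(1) by simp
    then show False using that(2,3) by (cases b) auto
  qed
  have "w \<parallel> w'"
    using leaf[OF w(1) w'(2,3)] leaf[OF w'(1) w(2,3)] \<open>w \<noteq> w'\<close>
    by (auto simp: strict_prefix_def)
  from parallel_decomp[OF this]
  obtain as b bs c cs where *: "b \<noteq> c" "w = as @ b # bs" "w' = as @ c # cs"
    by blast
  have in_S: "as @ [b] \<in> S" "as @ [c] \<in> S"
    using closed[OF w(1), of "as @ [b]"] closed[OF w'(1), of "as @ [c]"] * by simp_all
  show False
  proof (cases b)
    case True
    then have "as @ [False] \<notin> S" using w(4) * by simp
    then show False using in_S(2) * True by simp
  next
    case False
    then have "as @ [False] \<notin> S" using w'(4) * by simp
    then show False using in_S(1) False by simp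
  qed
qed

text \<open>The rank of \<open>n\<close> within its fibre. For bounded fibres it takes finitely many
  values, and the pair of \<open>h n\<close> and this rank identifies \<open>n\<close>.\<close>

definition occ :: "(nat \<Rightarrow> 'a) \<Rightarrow> nat \<Rightarrow> nat" where
  "occ h n = card {m. m < n \<and> h m = h n}"

lemma occ_less:
  assumes "m < n" "h m = h n"
  shows "occ h m < occ h n"
  unfolding occ_def by (rule psubset_card_mono) (use assms in auto)

lemma occ_inj: "h m = h n \<Longrightarrow> occ h m = occ h n \<Longrightarrow> m = n"
  by (metis linorder_neqE_nat nat_neq_iff occ_less)

lemma occ_bound:
  assumes "finite {m. h m = h n}" "card {m. h m = h n} \<le> M"
  shows "occ h n < M"
proof -
  have "occ h n < card {m. h m = h n}"
    unfolding occ_def by (rule psubset_card_mono) (use assms in auto)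
  then show ?thesis using assms(2) by simp
qed

text \<open>The greatest earlier element of the fibre has rank one less. The recursion uses a single
  quantifier over numbers, so each fixed bound on the rank becomes definable by induction.\<close>

lemma Suc_le_occ_iff: "Suc j \<le> occ h n \<longleftrightarrow> (\<exists>m. m < n \<and> h m = h n \<and> j \<le> occ h m)"
proof
  assume *: "Suc j \<le> occ h n"
  let ?A = "{m. m < n \<and> h m = h n}"
  have fin: "finite ?A" by simp
  have "?A \<noteq> {}" using * unfolding occ_def by (metis card.empty not_less_eq_eq zero_le)
  define m where "m = Max ?A"
  have m: "m < n" "h m = h n" using Max_in[OF fin \<open>?A \<noteq> {}\<close>] by (simp_all add: m_def)
  have "?A \<subseteq> insert m {k. k < m \<and> h k = h m}"
    using Max_ge[OF fin] m by (auto simp: m_def[symmetric] le_less)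
  then have "occ h n \<le> Suc (occ h m)"
    unfolding occ_def using card_mono[of "insert m {k. k < m \<and> h k = h m}" ?A] by simp
  then show "\<exists>m. m < n \<and> h m = h n \<and> j \<le> occ h m" using m * by (intro exI[of _ m]) simp
next
  assume "\<exists>m. m < n \<and> h m = h n \<and> j \<le> occ h m"
  then show "Suc j \<le> occ h n" using occ_less[of _ n h] by force
qed

section \<open>Covering blocks of positions and locating numbers at nodes\<close>

context powerset_presentation
begin

text \<open>On \<open>D \<inter> D'\<close> alternation is automatic: the larger of two positions
  itself serves as the separating element of \<open>D'\<close>.\<close>

lemma small_intersection:
  "\<exists>N. \<forall>w D D'. seen_in w D \<longrightarrow> seen_out w D' \<longrightarrow> card (D \<inter> D') \<le> N"
proof -
  obtain N where N: "\<forall>w D D' S. seen_in w D \<longrightarrow> seen_out w D' \<longrightarrow> S \<subseteq> D \<longrightarrow>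
     (\<forall>x\<in>S. \<forall>y\<in>S. x < y \<longrightarrow> (\<exists>d\<in>D'. x < d \<and> d \<le> y)) \<longrightarrow> finite S \<and> card S \<le> N"
    using bounded_alternation by blast
  have "card (D \<inter> D') \<le> N" if "seen_in w D" "seen_out w D'" for w D D'
    using N[rule_format, OF that, of "D \<inter> D'"] by auto
  then show ?thesis by blast
qed

lemma two_region_cover:
  "\<exists>c. \<forall>w I. finite I \<longrightarrow> (\<exists>B1\<subseteq>I. \<exists>B2\<subseteq>I. seen_in w B1 \<and> seen_out w B2 \<and>
     card (I - (B1 \<union> B2)) \<le> c)"
proof -
  obtain N where N: "\<And>w D D'. seen_in w D \<Longrightarrow> seen_out w D' \<Longrightarrow> card (D \<inter> D') \<le> N"
    using small_intersection by blast
  obtain c where c: "\<And>w I. finite I \<Longrightarrow> \<exists>B1\<subseteq>I. \<exists>B2\<subseteq>I. seen_in w B1 \<and> seen_out w B2 \<and>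
     card I \<le> card B1 + card B2 + c"
    using two_region_combs by blast
  have "\<exists>B1\<subseteq>I. \<exists>B2\<subseteq>I. seen_in w B1 \<and> seen_out w B2 \<and> card (I - (B1 \<union> B2)) \<le> c + N"
    if I: "finite I" for w I
  proof -
    obtain B1 B2 where B: "B1 \<subseteq> I" "B2 \<subseteq> I" "seen_in w B1" "seen_out w B2"
      "card I \<le> card B1 + card B2 + c"
      using c[OF I, of w] by blast
    have fin: "finite B1" "finite B2" using B I finite_subset by blast+
    have "card (I - (B1 \<union> B2)) = card I - card (B1 \<union> B2)"
      by (rule card_Diff_subset) (use B fin in auto)
    then have "card (I - (B1 \<union> B2)) \<le> c + N"
      using card_Un_Int[OF fin] N[OF B(3,4)] B(5) by linarith
    then show ?thesis using B by blast
  qed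
  then show ?thesis by blast
qed

text \<open>Any two of the three regions are separated as the inside and the outside of one child's
  subtree, so all pairwise intersections are small. Sets whose sizes add up to almost
  \<open>card I\<close> must then cover almost all of \<open>I\<close>.\<close>

lemma three_region_cover:
  "\<exists>c. \<forall>w I. finite I \<longrightarrow> (\<exists>B0\<subseteq>I. \<exists>B1\<subseteq>I. \<exists>B2\<subseteq>I.
     seen_in (w @ [False]) B0 \<and> seen_in (w @ [True]) B1 \<and> seen_out w B2 \<and>
     card (I - (B0 \<union> B1 \<union> B2)) \<le> c)"
proof -
  obtain N where N: "\<And>w D D'. seen_in w D \<Longrightarrow> seen_out w D' \<Longrightarrow> card (D \<inter> D') \<le> N"
    using small_intersection by blast
  obtain c where c: "\<And>w I. finite I \<Longrightarrow> \<exists>B0\<subseteq>I. \<exists>B1\<subseteq>I. \<exists>B2\<subseteq>I.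
     seen_in (w @ [False]) B0 \<and> seen_in (w @ [True]) B1 \<and> seen_out w B2 \<and>
     card I \<le> card B0 + card B1 + card B2 + c"
    using three_region_combs by blast
  have "\<exists>B0\<subseteq>I. \<exists>B1\<subseteq>I. \<exists>B2\<subseteq>I.
     seen_in (w @ [False]) B0 \<and> seen_in (w @ [True]) B1 \<and> seen_out w B2 \<and>
     card (I - (B0 \<union> B1 \<union> B2)) \<le> c + 3 * N"
    if I: "finite I" for w I
  proof -
    obtain B0 B1 B2 where B: "B0 \<subseteq> I" "B1 \<subseteq> I" "B2 \<subseteq> I" "seen_in (w @ [False]) B0"
      "seen_in (w @ [True]) B1" "seen_out w B2" "card I \<le> card B0 + card B1 + card B2 + c"
      using c[OF I, of w] by blast
    have fin: "finite B0" "finite B1" "finite B2" using B I finite_subset by blast+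
    have "card (B0 \<inter> B1) \<le> N"
      using B(4) by (rule N) (rule seen_in_seen_out_disjoint[OF _ _ B(5)], auto)
    moreover have "card (B0 \<inter> B2) \<le> N"
      using B(4) by (rule N) (rule seen_out_prefix[OF _ B(6)], simp)
    moreover have "card (B1 \<inter> B2) \<le> N"
      using B(5) by (rule N) (rule seen_out_prefix[OF _ B(6)], simp)
    moreover have "card ((B0 \<union> B1) \<inter> B2) \<le> card (B0 \<inter> B2) + card (B1 \<inter> B2)"
      by (metis Int_Un_distrib2 card_Un_le)
    moreover have "card (I - (B0 \<union> B1 \<union> B2)) = card I - card (B0 \<union> B1 \<union> B2)"
      by (rule card_Diff_subset) (use B fin in auto)
    ultimately have "card (I - (B0 \<union> B1 \<union> B2)) \<le> c + 3 * N"
      using card_Un_Int[OF fin(1,2)] card_Un_Int[of "B0 \<union> B1" B2] fin B(7) by simp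
    then show ?thesis using B by blast
  qed
  then show ?thesis by blast
qed

definition block_seen :: "nat \<Rightarrow> nat \<Rightarrow> nat \<Rightarrow> bool list \<Rightarrow> bool" where
  "block_seen T K n w \<longleftrightarrow> (\<exists>D\<subseteq>{n..<n + K}. T < card D \<and> seen_in w D)"

lemma block_seen_prefix: "block_seen T K n w \<Longrightarrow> prefix u w \<Longrightarrow> block_seen T K n u"
  unfolding block_seen_def using seen_in_prefix by blast

lemma wdef_block_seen: "wdef (\<lambda>E. block_seen T K (num (E i)) (nd (E j)))"
proof (rule wdef_cong)
  \<comment> \<open>A set \<open>D\<close> inside the block is a translate of one of finitely many
    patterns \<open>A\<close>, so the test of its cardinality takes place outside the logic.\<close>
  let ?S = "{A. A \<subseteq> {..<K} \<and> T < card A}"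
  have fin: "finite ?S" by (rule finite_subset[of _ "Pow {..<K}"]) auto
  have finA: "A \<in> ?S \<Longrightarrow> finite A" for A using finite_subset by blast
  show "wdef (\<lambda>E. \<exists>A\<in>?S. \<exists>D. finite D \<and> (\<forall>x. x \<in> D \<longleftrightarrow> (\<exists>a\<in>A. x = num (E i) + a)) \<and>
      seen_in (nd (E j)) D)"
    by (intro wdef_finite_bex[OF fin] wdef_finite_bex[OF finA] pdef_intros wdef_seen_in)
  fix E
  show "block_seen T K (num (E i)) (nd (E j)) \<longleftrightarrow>
    (\<exists>A\<in>?S. \<exists>D. finite D \<and> (\<forall>x. x \<in> D \<longleftrightarrow> (\<exists>a\<in>A. x = num (E i) + a)) \<and> seen_in (nd (E j)) D)"
    (is "_ = ?rhs")
  proof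
    assume "block_seen T K (num (E i)) (nd (E j))"
    then obtain D where D: "D \<subseteq> {num (E i)..<num (E i) + K}" "T < card D" "seen_in (nd (E j)) D"
      unfolding block_seen_def by blast
    have mem: "num (E i) \<le> x \<and> x < num (E i) + K" if "x \<in> D" for x
      using D(1) that by auto
    define A where "A = (\<lambda>x. x - num (E i)) ` D"
    have "inj_on (\<lambda>x. x - num (E i)) D"
      using mem by (intro inj_onI) (metis le_add_diff_inverse)
    then have "card A = card D" by (simp add: A_def card_image)
    moreover have "A \<subseteq> {..<K}" using mem by (force simp: A_def)
    moreover have "\<forall>x. x \<in> D \<longleftrightarrow> (\<exists>a\<in>A. x = num (E i) + a)"
      using mem by (force simp: A_def)
    moreover have "finite D" using D(1) finite_subset by blast
    ultimately show ?rhs using D(2,3) by auto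
  next
    assume ?rhs
    then obtain A D where A: "A \<subseteq> {..<K}" "T < card A"
      and D: "\<forall>x. x \<in> D \<longleftrightarrow> (\<exists>a\<in>A. x = num (E i) + a)" "seen_in (nd (E j)) D" by blast
    have "D = (\<lambda>a. num (E i) + a) ` A" using D(1) by blast
    then have "card D = card A" by (simp add: card_image inj_on_def)
    moreover have "D \<subseteq> {num (E i)..<num (E i) + K}" using D(1) A(1) by fastforce
    ultimately show "block_seen T K (num (E i)) (nd (E j))"
      using A(2) D(2) unfolding block_seen_def by auto
  qed
qed

definition leaf :: "nat \<Rightarrow> nat \<Rightarrow> nat \<Rightarrow> bool list \<Rightarrow> bool" where
  "leaf T K n w \<longleftrightarrow> block_seen T K n w \<and> \<not> block_seen T K n (w @ [False]) \<and>
     \<not> block_seen T K n (w @ [True])"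

text \<open>In each block at which \<open>w\<close> is a leaf, the outside of \<open>w\<close> must
  see a position because the children see too few, and the inside must see one because the outside
  cannot share all that \<open>w\<close> sees. The covers are taken of the union of all blocks, so
  one reference set per side serves every block and the bound on alternation applies.\<close>

lemma leaf_multiplicity:
  "\<exists>T K N. T < K \<and> (\<forall>n. finite {w. block_seen T K n w}) \<and>
    (\<forall>w J. finite J \<longrightarrow> (\<forall>n\<in>J. leaf T K n w) \<longrightarrow> (\<forall>m\<in>J. \<forall>n\<in>J. m < n \<longrightarrow> m + K \<le> n) \<longrightarrow>
      card J \<le> 2 * N)"
proof -
  obtain N where N: "\<And>w D D' S. seen_in w D \<Longrightarrow> seen_out w D' \<Longrightarrow> S \<subseteq> D \<Longrightarrow>
     (\<forall>x\<in>S. \<forall>y\<in>S. x < y \<longrightarrow> (\<exists>d\<in>D'. x < d \<and> d \<le> y)) \<Longrightarrow> finite S \<and> card S \<le> N"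
    using bounded_alternation by blast
  obtain N1 where N1: "\<And>w D D'. seen_in w D \<Longrightarrow> seen_out w D' \<Longrightarrow> card (D \<inter> D') \<le> N1"
    using small_intersection by blast
  obtain N2 where N2: "\<And>w D. seen_in w D \<Longrightarrow> card D > N2 \<Longrightarrow> \<exists>x\<in>D. sub w (f {x}) \<noteq> {}"
    using seen_in_meets_subtree by blast
  obtain c2 where c2: "\<And>w I. finite I \<Longrightarrow> \<exists>B1\<subseteq>I. \<exists>B2\<subseteq>I. seen_in w B1 \<and> seen_out w B2 \<and>
     card (I - (B1 \<union> B2)) \<le> c2"
    using two_region_cover by blast
  obtain c3 where c3: "\<And>w I. finite I \<Longrightarrow> \<exists>B0\<subseteq>I. \<exists>B1\<subseteq>I. \<exists>B2\<subseteq>I.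
     seen_in (w @ [False]) B0 \<and> seen_in (w @ [True]) B1 \<and> seen_out w B2 \<and>
     card (I - (B0 \<union> B1 \<union> B2)) \<le> c3"
    using three_region_cover by blast
  \<comment> \<open>More than \<open>N1 + c2\<close> positions can neither all be shared with the
    outside nor all be left uncovered. The summand \<open>N2\<close> guarantees that an eligible
    node is a prefix of a node in some \<open>f {x}\<close> with \<open>x\<close> in the
    block.\<close>
  define T where "T = N1 + N2 + c2"
  \<comment> \<open>Chosen so that a block is not exhausted by \<open>T\<close> positions for each
    child and \<open>c3\<close> uncovered ones.\<close>
  define K where "K = 2 * T + c3 + 1"
  have "finite {w. block_seen T K n w}" for n
  proof (rule finite_subset)
    show "{w. block_seen T K n w} \<subseteq> (\<Union>x\<in>{n..<n + K}. \<Union>u\<in>f {x}. set (prefixes u))"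
    proof
      fix w assume "w \<in> {w. block_seen T K n w}"
      then obtain D where D: "D \<subseteq> {n..<n + K}" "T < card D" "seen_in w D"
        unfolding block_seen_def by blast
      then obtain x where x: "x \<in> D" "sub w (f {x}) \<noteq> {}" using N2[of w D] by (auto simp: T_def)
      then obtain v where "w @ v \<in> f {x}" by auto
      then show "w \<in> (\<Union>x\<in>{n..<n + K}. \<Union>u\<in>f {x}. set (prefixes u))"
        using x(1) D(1) by (intro UN_I[of x] UN_I[of "w @ v"]) auto
    qed
  qed simp
  moreover have "card J \<le> 2 * N"
    if finJ: "finite J" and leaf: "\<forall>n\<in>J. leaf T K n w"
      and sep: "\<forall>m\<in>J. \<forall>n\<in>J. m < n \<longrightarrow> m + K \<le> n" for w J
  proof -
    define blk where "blk n = {n..<n + K}" for n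
    define I where "I = (\<Union>n\<in>J. blk n)"
    have I: "finite I" using finJ by (simp add: I_def blk_def)
    have blkI: "blk n \<subseteq> I" if "n \<in> J" for n using that by (auto simp: I_def)
    obtain B0 B1 B2 where B: "seen_in (w @ [False]) B0" "seen_in (w @ [True]) B1" "seen_out w B2"
      "card (I - (B0 \<union> B1 \<union> B2)) \<le> c3"
      using c3[OF I, of w] by blast
    obtain C1 C2 where C: "seen_in w C1" "seen_out w C2" "card (I - (C1 \<union> C2)) \<le> c2"
      using c2[OF I, of w] by blast
    have "\<exists>e. e \<in> B2 \<and> e \<in> blk n" if n: "n \<in> J" for n
    proof (rule ccontr)
      assume none: "\<not> (\<exists>e. e \<in> B2 \<and> e \<in> blk n)"
      have small: "card (blk n \<inter> D) \<le> T" if D: "seen_in (w @ [b]) D" for b D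
      proof -
        have "\<not> block_seen T K n (w @ [b])" using leaf n by (cases b) (auto simp: leaf_def)
        moreover have "seen_in (w @ [b]) (blk n \<inter> D)" using D by (rule seen_in_subset) blast
        ultimately show ?thesis unfolding block_seen_def blk_def by (meson Int_lower1 not_less)
      qed
      have "blk n \<subseteq> ((blk n \<inter> B0) \<union> (blk n \<inter> B1)) \<union> (I - (B0 \<union> B1 \<union> B2))"
        using none blkI[OF n] by blast
      then have "card (blk n) \<le> card (((blk n \<inter> B0) \<union> (blk n \<inter> B1)) \<union> (I - (B0 \<union> B1 \<union> B2)))"
        using I by (intro card_mono) (simp_all add: blk_def)
      also have "\<dots> \<le> card ((blk n \<inter> B0) \<union> (blk n \<inter> B1)) + card (I - (B0 \<union> B1 \<union> B2))"
        by (rule card_Un_le)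
      also have "\<dots> \<le> (card (blk n \<inter> B0) + card (blk n \<inter> B1)) + card (I - (B0 \<union> B1 \<union> B2))"
        by (intro add_right_mono card_Un_le)
      finally have "K \<le> (card (blk n \<inter> B0) + card (blk n \<inter> B1)) + card (I - (B0 \<union> B1 \<union> B2))"
        by (simp add: blk_def)
      then show False using small[OF B(1)] small[OF B(2)] B(4) unfolding K_def by linarith
    qed
    then obtain e where e: "\<And>n. n \<in> J \<Longrightarrow> e n \<in> B2 \<and> e n \<in> blk n" by metis
    have "\<exists>d. d \<in> C1 \<and> d \<in> blk n" if n: "n \<in> J" for n
    proof (rule ccontr)
      assume none: "\<not> (\<exists>d. d \<in> C1 \<and> d \<in> blk n)"
      have "block_seen T K n w" using leaf n by (simp add: leaf_def)
      then obtain D where D: "D \<subseteq> blk n" "T < card D" "seen_in w D"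
        unfolding block_seen_def blk_def by blast
      have "D \<subseteq> (D \<inter> C2) \<union> (I - (C1 \<union> C2))" using D(1) none blkI[OF n] by blast
      moreover have "finite D" using D(1) by (rule finite_subset) (simp add: blk_def)
      ultimately have "card D \<le> card ((D \<inter> C2) \<union> (I - (C1 \<union> C2)))"
        using I by (intro card_mono) simp_all
      also have "\<dots> \<le> card (D \<inter> C2) + card (I - (C1 \<union> C2))" by (rule card_Un_le)
      finally show False using N1[OF D(3) C(2)] C(3) D(2) by (simp add: T_def)
    qed
    then obtain d where d: "\<And>n. n \<in> J \<Longrightarrow> d n \<in> C1 \<and> d n \<in> blk n" by metis
    have order: "d m < n" "e m < n" if "m \<in> J" "n \<in> J" "m < n" for m n
      using sep[rule_format, OF that] d[OF that(1)] e[OF that(1)] by (simp_all add: blk_def)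
    have ge: "n \<le> d n" "n \<le> e n" if "n \<in> J" for n
      using d[OF that] e[OF that] by (simp_all add: blk_def)
    have mono: "m < n" if "m \<in> J" "n \<in> J" "d m < d n" for m n
    proof (rule ccontr)
      assume "\<not> m < n"
      then have "n = m \<or> d n < m" using order(1)[OF that(2,1)] by force
      then show False using that ge(1)[OF that(1)] by auto
    qed
    have inj: "inj_on d J"
    proof (rule inj_onI)
      fix m n assume "m \<in> J" "n \<in> J" "d m = d n"
      then show "m = n" using order(1)[of m n] order(1)[of n m] ge(1)[of m] ge(1)[of n]
        by (cases m n rule: linorder_cases) auto
    qed
    have bound: "card J' \<le> N"
      if J': "J' \<subseteq> J" "\<And>m n. m \<in> J' \<Longrightarrow> n \<in> J' \<Longrightarrow> m < n \<Longrightarrow> \<exists>b\<in>B2. d m < b \<and> b \<le> d n" for J'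
    proof -
      have alt: "\<forall>x\<in>d ` J'. \<forall>y\<in>d ` J'. x < y \<longrightarrow> (\<exists>b\<in>B2. x < b \<and> b \<le> y)"
        using J' mono by (auto simp: subset_iff)
      have "d ` J' \<subseteq> C1" using d J'(1) by blast
      from N[OF C(1) B(3) this alt] have "card (d ` J') \<le> N" by blast
      then show ?thesis using card_image[OF inj_on_subset[OF inj J'(1)]] by simp
    qed
    \<comment> \<open>The order of \<open>d n\<close> and \<open>e n\<close> within a block decides
      which outside position separates \<open>d m\<close> from \<open>d n\<close>: the earlier
      \<open>e m\<close> here, the later \<open>e n\<close> in the other half. Each half contributes
      at most \<open>N\<close>.\<close>
    have "card {n\<in>J. d n < e n} \<le> N"
    proof (rule bound)
      fix m n assume mn: "m \<in> {n\<in>J. d n < e n}" "n \<in> {n\<in>J. d n < e n}" "m < n"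
      then have "e m \<in> B2" "d m < e m" "e m \<le> d n"
        using e[of m] order(2)[of m n] ge(1)[of n] by auto
      then show "\<exists>b\<in>B2. d m < b \<and> b \<le> d n" by blast
    qed blast
    moreover have "card {n\<in>J. e n \<le> d n} \<le> N"
    proof (rule bound)
      fix m n assume mn: "m \<in> {n\<in>J. e n \<le> d n}" "n \<in> {n\<in>J. e n \<le> d n}" "m < n"
      then have "e n \<in> B2" "d m < e n" "e n \<le> d n"
        using e[of n] order(1)[of m n] ge(2)[of n] by auto
      then show "\<exists>b\<in>B2. d m < b \<and> b \<le> d n" by blast
    qed blast
    moreover have "J = {n\<in>J. d n < e n} \<union> {n\<in>J. e n \<le> d n}" by auto
    then have "card J \<le> card {n\<in>J. d n < e n} + card {n\<in>J. e n \<le> d n}"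
      using card_Un_le[of "{n\<in>J. d n < e n}" "{n\<in>J. e n \<le> d n}"] by simp
    ultimately show "card J \<le> 2 * N" by linarith
  qed
  moreover have "T < K" by (simp add: K_def)
  ultimately show ?thesis by blast
qed

definition location :: "(nat \<Rightarrow> bool list) \<Rightarrow> nat \<Rightarrow> bool" where
  "location h M \<longleftrightarrow> (\<forall>i j. wdef (\<lambda>E. h (num (E i)) = nd (E j))) \<and> (\<forall>n. occ h n < M)"

lemma exists_location: "\<exists>h M. location h M"
proof -
  obtain T K N where TK: "T < K" and fin: "\<And>n. finite {w. block_seen T K n w}"
    and card: "\<And>w J. finite J \<Longrightarrow> (\<forall>n\<in>J. leaf T K n w) \<Longrightarrow>
      (\<forall>m\<in>J. \<forall>n\<in>J. m < n \<longrightarrow> m + K \<le> n) \<Longrightarrow> card J \<le> 2 * N"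
    using leaf_multiplicity by blast
  \<comment> \<open>Children appear as quantified nodes because \<open>block_seen\<close> is known
    to be definable for decoded variables, not for terms such as \<open>w @ [False]\<close>.\<close>
  define loc where "loc n w \<longleftrightarrow> block_seen T K n w \<and>
    (\<forall>v. v = w @ [False] \<longrightarrow> \<not> block_seen T K n v) \<and>
    (\<forall>v. v = w @ [True] \<longrightarrow> \<not> block_seen T K n v) \<and>
    (\<forall>u v v'. v = u @ [True] \<longrightarrow> prefix v w \<longrightarrow> v' = u @ [False] \<longrightarrow> \<not> block_seen T K n v')" for n w
  have "block_seen T K n []" for n
    unfolding block_seen_def using TK by (intro exI[of _ "{n..<n + K}"]) (simp add: seen_in_root)
  then have "\<exists>w. loc n w" for n
    using leftmost_leaf_exists[OF fin, of n] unfolding loc_def by auto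
  then obtain h where h: "\<And>n. loc n (h n)" by metis
  have unique: "w = w'" if "loc n w" "loc n w'" for n w w'
  proof (rule leftmost_leaf_unique[of "{w. block_seen T K n w}"])
    show "\<And>u w. w \<in> {w. block_seen T K n w} \<Longrightarrow> prefix u w \<Longrightarrow> u \<in> {w. block_seen T K n w}"
      using block_seen_prefix by blast
  qed (use that in \<open>simp_all add: loc_def\<close>)
  have "wdef (\<lambda>E. loc (num (E i)) (nd (E j)))" for i j
    unfolding loc_def by (intro pdef_intros wdef_block_seen)
  moreover have "loc n w \<longleftrightarrow> h n = w" for n w using h unique by blast
  ultimately have "wdef (\<lambda>E. h (num (E i)) = nd (E j))" for i j by simp
  moreover have "occ h n < K * (2 * N) + 1" for n
  proof -
    have "finite {m. h m = h n} \<and> card {m. h m = h n} \<le> K * (2 * N)"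
    proof (rule finite_if_finite_subsets_card_bdd)
      fix G assume G: "G \<subseteq> {m. h m = h n}" "finite G"
      have leafG: "leaf T K m (h n)" if "m \<in> G" for m
        using G(1) that h[of m] by (auto simp: leaf_def loc_def)
      \<comment> \<open>Distinct numbers in one residue class modulo \<open>K\<close> are at least
        \<open>K\<close> apart, so their blocks are disjoint; summing over the \<open>K\<close>
        classes bounds the fibre.\<close>
      have "card {m\<in>G. m mod K = r} \<le> 2 * N" for r
      proof (rule card)
        show "\<forall>m\<in>{m\<in>G. m mod K = r}. \<forall>n\<in>{m\<in>G. m mod K = r}. m < n \<longrightarrow> m + K \<le> n"
        proof (intro ballI impI)
          fix m n assume "m \<in> {m\<in>G. m mod K = r}" "n \<in> {m\<in>G. m mod K = r}" "m < n"
          then have "m mod K = n mod K" "m < n" by simp_all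
          then have "K dvd n - m" using mod_eq_dvd_iff_nat[of m n K] by simp
          then have "K \<le> n - m" using \<open>m < n\<close> by (simp add: dvd_imp_le)
          then show "m + K \<le> n" using \<open>m < n\<close> by simp
        qed
      qed (use G leafG in auto)
      moreover have "G = (\<Union>r\<in>{..<K}. {m\<in>G. m mod K = r})" using TK by auto
      then have "card G \<le> (\<Sum>r<K. card {m\<in>G. m mod K = r})"
        using card_UN_le[of "{..<K}" "\<lambda>r. {m\<in>G. m mod K = r}"] by simp
      ultimately show "card G \<le> K * (2 * N)"
        using sum_bounded_above[of "{..<K}" "\<lambda>r. card {m\<in>G. m mod K = r}" "2 * N"] by simp
    qed
    then show ?thesis by (intro occ_bound) auto
  qed
  ultimately have "location h (K * (2 * N) + 1)" unfolding location_def by blast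
  then show ?thesis by blast
qed

lemma wdef_occ:
  assumes "location h M"
  shows "wdef (\<lambda>E. occ h (num (E i)) = j)"
proof -
  have h: "wdef (\<lambda>E. h (num (E i)) = nd (E j))" for i j using assms by (simp add: location_def)
  have same: "wdef (\<lambda>E. h (num (E i)) = h (num (E k)))" for i k
  proof (rule wdef_cong)
    show "wdef (\<lambda>E. \<exists>w. h (num (E i)) = w \<and> h (num (E k)) = w)" by (intro wdef_ex_node wdef_conj h)
  qed auto
  have le: "wdef (\<lambda>E. j \<le> occ h (num (E i)))" for i j
  proof (induction j arbitrary: i)
    case (Suc j)
    show ?case unfolding Suc_le_occ_iff by (intro pdef_intros same Suc)
  qed (simp add: wdef_const)
  have "wdef (\<lambda>E. j \<le> occ h (num (E i)) \<and> \<not> Suc j \<le> occ h (num (E i)))"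
    by (intro wdef_conj wdef_not le)
  then show ?thesis by (rule wdef_cong[rotated]) auto
qed

end

section \<open>Convergence and periodicity of the location\<close>

lemma sub_append_singleton [simp]: "sub v {v @ x} = {x}"
  by (auto simp: sub_def)

context powerset_presentation
begin

definition pair_env :: "bool list \<Rightarrow> bool list \<Rightarrow> nat \<Rightarrow> bool list set" where
  "pair_env x y = (\<lambda>i. if i = 0 then {x} else {y})"

lemma finite_fibre:
  assumes "location h M"
  shows "finite {n. h n = w}"
proof (rule inj_on_finite)
  show "inj_on (occ h) {n. h n = w}" by (rule inj_onI) (auto dest: occ_inj)
  show "occ h ` {n. h n = w} \<subseteq> {..<M}" using assms by (auto simp: location_def)
qed simp

lemma infinite_class:
  assumes "location h M" "infinite A"
  shows "\<exists>j<M. infinite {n\<in>A. occ h n = j}"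
proof (rule ccontr)
  assume "\<not> ?thesis"
  then have "finite (\<Union>j\<in>{..<M}. {n\<in>A. occ h n = j})" by auto
  moreover have "A = (\<Union>j\<in>{..<M}. {n\<in>A. occ h n = j})" using assms(1) by (auto simp: location_def)
  ultimately show False using assms(2) by simp
qed

text \<open>With the ranks fixed, the order of two numbers is a definable relation of their nodes.
  If both sides of \<open>v\<close> were infinite, some outside \<open>e\<close> would lie between
  inside numbers \<open>d0 < d\<close> of equal type, and exchanging these below \<open>v\<close>
  would preserve their comparison with \<open>e\<close>.\<close>

lemma eventually_inside_or_outside:
  assumes "location h M"
  shows "finite {n. prefix v (h n)} \<or> finite {n. \<not> prefix v (h n)}"
proof (rule ccontr)
  assume "\<not> ?thesis"
  then have inf: "infinite {n. prefix v (h n)}" "infinite {n. \<not> prefix v (h n)}" by simp_all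
  have h: "wdef (\<lambda>E. h (num (E i)) = nd (E j))" for i j using assms by (simp add: location_def)
  obtain j where j: "infinite {n\<in>{n. prefix v (h n)}. occ h n = j}"
    using infinite_class[OF assms inf(1)] by blast
  obtain j' where j': "infinite {n\<in>{n. \<not> prefix v (h n)}. occ h n = j'}"
    using infinite_class[OF assms inf(2)] by blast
  let ?A = "{n\<in>{n. prefix v (h n)}. occ h n = j}"
  define P where "P E \<longleftrightarrow> (\<exists>m n. m < n \<and> h m = nd (E 0) \<and> h n = nd (E 1) \<and> occ h m = j \<and> occ h n = j')"
    for E :: "nat \<Rightarrow> bool list set"
  have "wdef P" unfolding P_def by (intro pdef_intros h wdef_occ[OF assms])
  then obtain t :: "(nat \<Rightarrow> bool list set) \<Rightarrow> nat" where t: "decides t P"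
    using wdef_recognizable recognizable_def by blast
  define g where "g d = t (\<lambda>i. if i = 0 then sub v {h d} else {})" for d
  have "finite (g ` ?A)" by (rule finite_subset[OF _ decides_finite[OF t]]) (auto simp: g_def)
  from pigeonhole_infinite[OF j this]
  obtain d0 where d0: "d0 \<in> ?A" and inf': "infinite {d\<in>?A. g d = g d0}" by blast
  obtain e where e: "e > d0" "\<not> prefix v (h e)" "occ h e = j'"
    using j' unfolding infinite_nat_iff_unbounded by blast
  obtain d where d: "d > e" "d \<in> ?A" "g d = g d0"
    using inf' unfolding infinite_nat_iff_unbounded by blast
  have sub: "(\<lambda>i. sub v (pair_env (h m) (h e) i)) = (\<lambda>i. if i = 0 then sub v {h m} else {})" for m
    using sub_singleton_other[OF e(2)] by (intro ext) (simp add: pair_env_def)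
  have "P (pair_env (h d0) (h e)) \<longleftrightarrow> P (pair_env (h d) (h e))"
  proof (rule decidesD[OF t, of _ _ v])
    show "eqout v (pair_env (h d0) (h e) i) (pair_env (h d) (h e) i)" for i
      using d0 d(2) by (auto simp: pair_env_def eqout_def)
    show "t (\<lambda>i. sub v (pair_env (h d0) (h e) i)) = t (\<lambda>i. sub v (pair_env (h d) (h e) i))"
      unfolding sub using d(3) by (simp add: g_def)
  qed (simp_all add: pair_env_def)
  moreover have "P (pair_env (h d0) (h e))"
    unfolding P_def pair_env_def using e d0 by (intro exI[of _ d0] exI[of _ e]) simp
  ultimately obtain m n where mn: "m < n" "h m = h d" "h n = h e" "occ h m = j" "occ h n = j'"
    unfolding P_def pair_env_def by auto
  then have "m = d" "n = e" using occ_inj[of h m d] occ_inj[of h n e] e d by simp_all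
  then show False using mn(1) d(1) by simp
qed

text \<open>Fibres are finite, so almost all locations have length at least \<open>l\<close>. One of
  the finitely many subtrees at that depth receives infinitely many of them, hence almost
  all.\<close>

lemma exists_limit_node:
  assumes "location h M"
  shows "\<exists>v. length v = l \<and> finite {n. \<not> prefix v (h n)}"
proof -
  have fin: "finite {w :: bool list. length w < l}"
    by (rule finite_subset[OF _ finite_lists_length_le[of "UNIV :: bool set" l]]) auto
  have finl: "finite {w :: bool list. length w = l}"
    using finite_lists_length_eq[of "UNIV :: bool set" l] by simp
  have "{n. length (h n) < l} = (\<Union>w\<in>{w. length w < l}. {n. h n = w})" by auto
  then have short: "finite {n. length (h n) < l}" using fin finite_fibre[OF assms] by simp
  have "\<exists>v. length v = l \<and> infinite {n. prefix v (h n)}"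
  proof (rule ccontr)
    assume "\<not> ?thesis"
    then have "finite (\<Union>v\<in>{v. length v = l}. {n. prefix v (h n)})" using finl by simp
    moreover have "UNIV = {n. length (h n) < l} \<union> (\<Union>v\<in>{v. length v = l}. {n. prefix v (h n)})"
    proof -
      have "\<exists>v. length v = l \<and> prefix v (h n)" if "\<not> length (h n) < l" for n
        using that by (intro exI[of _ "take l (h n)"]) (simp add: take_is_prefix)
      then show ?thesis by blast
    qed
    ultimately show False using short infinite_UNIV_nat by (metis finite_UnI)
  qed
  then show ?thesis using eventually_inside_or_outside[OF assms] by blast
qed

text \<open>The class of \<open>v\<close> records, with ranks, the types of those pairs of relative
  nodes that successive numbers occupy below \<open>v\<close>. If \<open>v'\<close> has the same
  class, some pair of the type of \<open>(x, y)\<close> occurs below \<open>v'\<close>, and equality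
  of types lets \<open>(x, y)\<close> take its place there.\<close>

lemma context_class:
  assumes "location h M"
  shows "\<exists>c :: bool list \<Rightarrow> (nat \<times> nat \<times> nat) set. finite (range c) \<and>
    (\<forall>v v' x y n. c v = c v' \<longrightarrow> h n = v @ x \<longrightarrow> h (Suc n) = v @ y \<longrightarrow>
      (\<exists>n'. h n' = v' @ x \<and> h (Suc n') = v' @ y \<and> occ h n' = occ h n \<and> occ h (Suc n') = occ h (Suc n)))"
proof -
  have h: "wdef (\<lambda>E. h (num (E i)) = nd (E j))" for i j using assms by (simp add: location_def)
  define P where "P j j' E \<longleftrightarrow> (\<exists>n n'. n' = Suc n \<and> h n = nd (E 0) \<and> h n' = nd (E 1) \<and>
    occ h n = j \<and> occ h n' = j')" for j j' and E :: "nat \<Rightarrow> bool list set"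
  have "wdef (P j j')" for j j' unfolding P_def by (intro pdef_intros h wdef_occ[OF assms])
  then have "\<forall>j j'. \<exists>t :: (nat \<Rightarrow> bool list set) \<Rightarrow> nat. decides t (P j j')"
    using wdef_recognizable recognizable_def by blast
  then obtain t :: "nat \<Rightarrow> nat \<Rightarrow> (nat \<Rightarrow> bool list set) \<Rightarrow> nat" where t: "\<And>j j'. decides (t j j') (P j j')"
    by metis
  define c where "c v = {(j, j', q). j < M \<and> j' < M \<and>
    (\<exists>x y. P j j' (pair_env (v @ x) (v @ y)) \<and> q = t j j' (pair_env x y))}" for v
  show ?thesis
  proof (intro exI[of _ c] conjI allI impI)
    let ?U = "{..<M} \<times> {..<M} \<times> (\<Union>j\<in>{..<M}. \<Union>j'\<in>{..<M}. range (t j j'))"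
    have "finite ?U" using decides_finite[OF t] by simp
    moreover have "range c \<subseteq> Pow ?U" by (auto simp: c_def)
    ultimately show "finite (range c)" by (meson finite_Pow_iff finite_subset)
  next
    fix v v' x y n assume c: "c v = c v'" and hn: "h n = v @ x" "h (Suc n) = v @ y"
    let ?j = "occ h n" and ?j' = "occ h (Suc n)"
    have "?j < M" "?j' < M" using assms by (simp_all add: location_def)
    moreover have "P ?j ?j' (pair_env (v @ x) (v @ y))"
      unfolding P_def pair_env_def using hn by auto
    ultimately have "(?j, ?j', t ?j ?j' (pair_env x y)) \<in> c v'" unfolding c[symmetric] unfolding c_def by blast
    then obtain x' y' where P: "P ?j ?j' (pair_env (v' @ x') (v' @ y'))"
      and eq: "t ?j ?j' (pair_env x y) = t ?j ?j' (pair_env x' y')"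
      unfolding c_def by blast
    have sub: "(\<lambda>i. sub v' (pair_env (v' @ x) (v' @ y) i)) = pair_env x y" for x y
      by (intro ext) (simp add: pair_env_def)
    have "P ?j ?j' (pair_env (v' @ x') (v' @ y')) \<longleftrightarrow> P ?j ?j' (pair_env (v' @ x) (v' @ y))"
    proof (rule decidesD[OF t, of _ _ v'])
      show "eqout v' (pair_env (v' @ x') (v' @ y') i) (pair_env (v' @ x) (v' @ y) i)" for i
        by (auto simp: pair_env_def eqout_def)
    qed (simp_all only: sub eq, simp_all add: pair_env_def)
    then have "P ?j ?j' (pair_env (v' @ x) (v' @ y))" using P by blast
    then show "\<exists>n'. h n' = v' @ x \<and> h (Suc n') = v' @ y \<and> occ h n' = ?j \<and> occ h (Suc n') = ?j'"
      unfolding P_def pair_env_def by auto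
  qed
qed

text \<open>Two nodes on the limit branch have the same class. The locations below the upper one are
  transplanted pair by pair below the lower one, and since node and rank identify a number,
  consecutive pairs fit together to a single shifted run.\<close>

lemma location_periodic:
  assumes "location h M"
  shows "\<exists>n0 p v u w. 0 < p \<and> (\<forall>k. h (n0 + k) = v @ w k) \<and> (\<forall>k. w (p + k) = u @ w k) \<and>
    (\<forall>k. occ h (n0 + (p + k)) = occ h (n0 + k))"
proof -
  obtain c :: "bool list \<Rightarrow> (nat \<times> nat \<times> nat) set" where finc: "finite (range c)"
    and c: "\<And>v v' x y n. c v = c v' \<Longrightarrow> h n = v @ x \<Longrightarrow> h (Suc n) = v @ y \<Longrightarrow>
      \<exists>n'. h n' = v' @ x \<and> h (Suc n') = v' @ y \<and> occ h n' = occ h n \<and> occ h (Suc n') = occ h (Suc n)"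
    using context_class[OF assms] by metis
  obtain V where V: "\<And>l. length (V l) = l" "\<And>l. finite {n. \<not> prefix (V l) (h n)}"
    using exists_limit_node[OF assms] by metis
  have "finite (range (\<lambda>l. c (V l)))" by (rule finite_subset[OF _ finc]) auto
  then have "\<not> inj (\<lambda>l. c (V l))" using finite_imageD infinite_UNIV_nat by blast
  then obtain a b where ab: "a < b" "c (V a) = c (V b)"
    unfolding inj_def by (metis linorder_neqE_nat)
  have "finite ({n. \<not> prefix (V a) (h n)} \<union> {n. \<not> prefix (V b) (h n)})" using V(2) by simp
  then obtain n where "n \<notin> {n. \<not> prefix (V a) (h n)} \<union> {n. \<not> prefix (V b) (h n)}"
    using ex_new_if_finite[OF infinite_UNIV_nat] by blast
  then have "prefix (V a) (V b)"
    using ab(1) V(1) by (auto intro: prefix_length_prefix)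
  then obtain u where u: "V b = V a @ u" by (auto simp: prefix_def)
  then have "length u > 0" using ab(1) V(1) by (metis add.right_neutral length_0_conv length_append length_greater_0_conv less_irrefl)
  obtain n0 where n0: "\<forall>n\<in>{n. \<not> prefix (V a) (h n)}. n < n0"
    using V(2) finite_nat_set_iff_bounded by blast
  have "\<exists>w. h (n0 + k) = V a @ w" for k
    using n0 by (metis (mono_tags, lifting) mem_Collect_eq not_add_less1 prefix_def)
  then obtain w where w: "\<And>k. h (n0 + k) = V a @ w k" by metis
  have step: "\<exists>n'. h n' = V b @ w k \<and> h (Suc n') = V b @ w (Suc k) \<and> occ h n' = occ h (n0 + k) \<and>
      occ h (Suc n') = occ h (n0 + Suc k)" for k
    using c[OF ab(2) w[of k], of "w (Suc k)"] w[of "Suc k"] by simp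
  obtain n1 where n1: "h n1 = V b @ w 0" "occ h n1 = occ h n0" using step[of 0] by auto
  have run: "h (n1 + k) = V b @ w k \<and> occ h (n1 + k) = occ h (n0 + k)" for k
  proof (induction k)
    case (Suc k)
    obtain n' where n': "h n' = V b @ w k" "h (Suc n') = V b @ w (Suc k)"
      "occ h n' = occ h (n0 + k)" "occ h (Suc n') = occ h (n0 + Suc k)" using step[of k] by blast
    then have "n' = n1 + k" using Suc occ_inj[of h n' "n1 + k"] by simp
    then show ?case using n' by simp
  qed (use n1 in simp)
  have len: "length (h (n1 + k)) = length (h (n0 + k)) + length u" for k
    using run w u by simp
  \<comment> \<open>Otherwise each advance by \<open>q = n0 - n1\<close> would shorten the location
    by \<open>length u\<close>, without end; for \<open>q = 0\<close> the two lengths would already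
    differ.\<close>
  have "n0 < n1"
  proof (rule ccontr)
    assume "\<not> n0 < n1"
    then obtain q where q: "n0 = n1 + q" by (metis le_Suc_ex not_less)
    have "length (h (n1 + i * q)) + i * length u = length (h n1)" for i
    proof (induction i)
      case (Suc i)
      have "length (h (n1 + i * q)) = length (h (n1 + Suc i * q)) + length u"
        using len[of "i * q"] q by (simp add: algebra_simps)
      then show ?case using Suc by simp
    qed simp
    from this[of "Suc (length (h n1))"] have "Suc (length (h n1)) * length u \<le> length (h n1)" by linarith
    moreover have "Suc (length (h n1)) * 1 \<le> Suc (length (h n1)) * length u"
      using \<open>length u > 0\<close> by (intro mult_le_mono2) linarith
    ultimately show False by simp
  qed
  then obtain p where p: "n1 = n0 + p" "0 < p" by (metis less_imp_add_positive)
  show ?thesis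
  proof (intro exI conjI allI)
    show "0 < p" by (rule p(2))
    show "h (n0 + k) = V a @ w k" for k by (rule w)
    show "w (p + k) = u @ w k" for k
      using run[of k] w[of "p + k"] u p(1) by (simp add: add.assoc)
    show "occ h (n0 + (p + k)) = occ h (n0 + k)" for k
      using run[of k] p(1) by (simp add: add.assoc)
  qed
qed

end

section \<open>Finitely many residuals\<close>

text \<open>The nodes at depth \<open>D\<close> below \<open>x\<close> form a finite antichain, so
  their subtrees can be exchanged one at a time by equality of types; everywhere else the two
  environments already coincide.\<close>

lemma decides_frontier:
  fixes B B' :: "'i \<Rightarrow> bool list set"
  assumes t: "decides t P" and fin: "finenv B" "finenv B'"
    and out: "\<And>i u. \<not> prefix x u \<Longrightarrow> u \<in> B i \<longleftrightarrow> u \<in> B' i"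
    and short: "\<And>i z. length z < D \<Longrightarrow> x @ z \<in> B i \<longleftrightarrow> x @ z \<in> B' i"
    and deep: "\<And>z. length z = D \<Longrightarrow> t (\<lambda>i. sub (x @ z) (B i)) = t (\<lambda>i. sub (x @ z) (B' i))"
  shows "P B \<longleftrightarrow> P B'"
proof -
  define mix where "mix S i = {u. if \<exists>z\<in>S. prefix (x @ z) u then u \<in> B' i else u \<in> B i}" for S i
  have finmix: "finenv (mix S)" for S
  proof
    fix i show "finite (mix S i)"
      by (rule finite_subset[of _ "B i \<union> B' i"]) (use fin in \<open>auto simp: mix_def split: if_splits\<close>)
  qed
  have step: "P B \<longleftrightarrow> P (mix S)" if "finite S" "S \<subseteq> {z. length z = D}" for S
    using that
  proof (induction rule: finite_induct)
    case empty
    have "mix {} = B" by (rule ext) (simp add: mix_def)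
    then show ?case by simp
  next
    case (insert z S)
    have other: "\<not> prefix (x @ z') (x @ z @ y)" if "z' \<in> S" for z' y
    proof
      assume "prefix (x @ z') (x @ z @ y)"
      then have "prefix z' (z @ y)" by simp
      moreover have "length z' = length z" using that insert.prems by auto
      ultimately have "z' = z" by (auto simp: prefix_def)
      then show False using that insert.hyps by simp
    qed
    have "P (mix S) \<longleftrightarrow> P (mix (insert z S))"
    proof (rule decidesD[where v = "x @ z", OF t finmix finmix])
      show "eqout (x @ z) (mix S i) (mix (insert z S) i)" for i
        by (simp add: eqout_def mix_def)
      have "sub (x @ z) (mix S i) = sub (x @ z) (B i)" for i
        using other by (auto simp: mix_def sub_def)
      moreover have "sub (x @ z) (mix (insert z S) i) = sub (x @ z) (B' i)" for i
        by (auto simp: mix_def sub_def)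
      ultimately show "t (\<lambda>i. sub (x @ z) (mix S i)) = t (\<lambda>i. sub (x @ z) (mix (insert z S) i))"
        using deep[of z] insert.prems by simp
    qed
    then show ?case using insert by simp
  qed
  have "mix {z. length z = D} = B'"
  proof (rule ext, rule set_eqI)
    fix i u
    show "u \<in> mix {z. length z = D} i \<longleftrightarrow> u \<in> B' i"
    proof (cases "\<exists>z\<in>{z. length z = D}. prefix (x @ z) u")
      case False
      have "u \<in> B i \<longleftrightarrow> u \<in> B' i"
      proof (cases "prefix x u")
        case True
        then obtain y where y: "u = x @ y" by (auto simp: prefix_def)
        have "length y < D"
        proof (rule ccontr)
          assume "\<not> length y < D"
          then have "length (take D y) = D" "prefix (x @ take D y) u"
            by (simp_all add: y take_is_prefix)
          then show False using False by blast
        qed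
        then show ?thesis using short y by simp
      qed (rule out)
      then show ?thesis using False by (simp add: mix_def)
    qed (simp add: mix_def)
  qed
  moreover have "finite {z :: bool list. length z = D}"
    using finite_lists_length_eq[of "UNIV :: bool set" D] by simp
  ultimately show ?thesis using step[of "{z. length z = D}"] by simp
qed

text \<open>Tuples of sets are words over bit vectors, \<open>Z\<close> is a suffix, and the pairs
  \<open>(n, Y)\<close> are the prefixes of length \<open>n\<close> that complete it. Suffixes are
  classified because a finite tuple is eventually empty, which gives a run from the right a definite
  initial state.\<close>

definition residual :: "((nat \<Rightarrow> nat set) \<Rightarrow> bool) \<Rightarrow> (nat \<Rightarrow> nat set) \<Rightarrow> (nat \<times> (nat \<Rightarrow> nat set)) set" where
  "residual P Z = {(n, Y). (\<forall>i. Y i \<subseteq> {..<n}) \<and> P (\<lambda>i. Y i \<union> (\<lambda>x. n + x) ` Z i)}"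

lemma finite_image_factor:
  assumes "finite (\<kappa> ` A)" "\<And>x y. x \<in> A \<Longrightarrow> y \<in> A \<Longrightarrow> \<kappa> x = \<kappa> y \<Longrightarrow> \<rho> x = \<rho> y"
  shows "finite (\<rho> ` A)"
proof -
  have "\<rho> x = \<rho> (SOME y. y \<in> A \<and> \<kappa> y = \<kappa> x)" if "x \<in> A" for x
  proof -
    have "(SOME y. y \<in> A \<and> \<kappa> y = \<kappa> x) \<in> A \<and> \<kappa> (SOME y. y \<in> A \<and> \<kappa> y = \<kappa> x) = \<kappa> x"
      by (rule someI[of _ x]) (use that in simp)
    then show ?thesis using assms(2)[OF that] by metis
  qed
  then have "\<rho> ` A \<subseteq> (\<lambda>c. \<rho> (SOME y. y \<in> A \<and> \<kappa> y = c)) ` \<kappa> ` A" by auto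
  then show ?thesis using assms(1) finite_subset by blast
qed

context powerset_presentation
begin

text \<open>Sorting the members by rank makes \<open>h\<close> injective on each part, so nothing is
  lost in passing to nodes.\<close>

definition node_code :: "(nat \<Rightarrow> bool list) \<Rightarrow> nat \<Rightarrow> (nat \<Rightarrow> nat set) \<Rightarrow> nat \<times> nat \<Rightarrow> bool list set" where
  "node_code h k X = (\<lambda>(i, j). if i < k then h ` {n \<in> X i. occ h n = j} else {})"

text \<open>Codes \<open>F\<close> of the sets are guessed, and the definable condition
  \<open>C\<close> checks rank by rank that they decode to the sets that the node code
  describes.\<close>

lemma node_code_decided:
  assumes loc: "location h M" and P: "wdef (\<lambda>E. P (\<lambda>i. nset (E i)))"
    and dep: "\<And>X X'. (\<forall>i<k. X i = X' i) \<Longrightarrow> P X \<longleftrightarrow> P X'"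
  shows "\<exists>Q. recognizable Q \<and> (\<forall>X. finenv X \<longrightarrow> (P X \<longleftrightarrow> Q (node_code h k X)))"
proof -
  have h: "wdef (\<lambda>E. h (num (E i)) = nd (E j))" for i j using loc by (simp add: location_def)
  define C where "C j E \<longleftrightarrow> (\<forall>n. occ h n = j \<longrightarrow> (n \<in> nset (E 0) \<longleftrightarrow> (\<exists>w. h n = w \<and> w \<in> E 1)))"
    for j and E :: "nat \<Rightarrow> bool list set"
  have "wdef (C j)" for j unfolding C_def by (intro pdef_intros h wdef_occ[OF loc])
  then have recC: "recognizable (C j)" for j by (rule wdef_recognizable)
  define Q where "Q B \<longleftrightarrow> (\<exists>F :: nat \<Rightarrow> bool list set. finenv F \<and>
    ((\<forall>i\<in>{..<k}. \<forall>j\<in>{..<M}. C j (\<lambda>l. case_sum B F (if l = 0 then Inr i else Inl (i, j)))) \<and>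
      P (\<lambda>i. nset (case_sum B F (Inr i)))))" for B :: "nat \<times> nat \<Rightarrow> bool list set"
  have "recognizable Q"
    unfolding Q_def
    by (intro recognizable_ex[where P = "\<lambda>G. (\<forall>i\<in>{..<k}. \<forall>j\<in>{..<M}. C j (\<lambda>l. G (if l = 0 then Inr i else Inl (i, j)))) \<and>
          P (\<lambda>i. nset (G (Inr i)))"] recognizable_conj recognizable_ball finite_lessThan
        recognizable_subst[OF recC] recognizable_subst[OF wdef_recognizable[OF P], of Inr])
  moreover have "P X \<longleftrightarrow> Q (node_code h k X)" if X: "finenv X" for X
  proof -
    have C: "C j (\<lambda>l. case_sum (node_code h k X) F (if l = 0 then Inr i else Inl (i, j))) \<longleftrightarrow>
        (\<forall>n. occ h n = j \<longrightarrow> (n \<in> nset (F i) \<longleftrightarrow> n \<in> X i))" if "i < k" for i j F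
    proof -
      have "h n \<in> h ` {n \<in> X i. occ h n = occ h n'} \<longleftrightarrow> n \<in> X i" if "occ h n = occ h n'" for n n'
        using that by (auto dest: occ_inj)
      then show ?thesis using that by (auto simp: C_def node_code_def)
    qed
    show ?thesis
    proof
      assume "P X"
      then show "Q (node_code h k X)"
        unfolding Q_def using X by (intro exI[of _ "\<lambda>i. f (X i)"]) (simp add: C)
    next
      assume "Q (node_code h k X)"
      then obtain F where F: "\<forall>i\<in>{..<k}. \<forall>j\<in>{..<M}. \<forall>n. occ h n = j \<longrightarrow> (n \<in> nset (F i) \<longleftrightarrow> n \<in> X i)"
        "P (\<lambda>i. nset (F i))"
        unfolding Q_def by (simp add: C) blast
      have "nset (F i) = X i" if "i < k" for i
      proof (rule set_eqI)
        fix n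
        have "occ h n \<in> {..<M}" using loc by (simp add: location_def)
        then show "n \<in> nset (F i) \<longleftrightarrow> n \<in> X i" using F(1) that by blast
      qed
      then show "P X" using F(2) dep[of "\<lambda>i. nset (F i)" X] by simp
    qed
  qed
  ultimately show ?thesis by blast
qed

text \<open>Beyond the preperiod, cutting at \<open>n\<close> singles out a node \<open>x\<close>
  below which the whole suffix is located, in a shape that depends only on the phase
  \<open>r\<close> of \<open>n\<close>. Locations of the prefix reach less than \<open>D\<close>
  levels below \<open>x\<close>, so prefix and suffix overlap only in a bounded part of the
  tree.\<close>

lemma finite_residuals:
  assumes P: "wdef (\<lambda>E. P (\<lambda>i. nset (E i)))"
    and dep: "\<And>X X'. (\<forall>i<k. X i = X' i) \<Longrightarrow> P X \<longleftrightarrow> P X'"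
  shows "finite (residual P ` {Z. finenv Z})"
proof -
  obtain h M where loc: "location h M" using exists_location by blast
  obtain n0 p v u w where p: "0 < p" and h: "\<And>m. h (n0 + m) = v @ w m"
    and w: "\<And>m. w (p + m) = u @ w m" and o: "\<And>m. occ h (n0 + (p + m)) = occ h (n0 + m)"
    using location_periodic[OF loc] by metis
  define U where "U q = concat (replicate q u)" for q
  have wq: "w (q * p + m) = U q @ w m" for q m
  proof (induction q)
    case (Suc q)
    have "w (Suc q * p + m) = u @ w (q * p + m)" using w[of "q * p + m"] by (simp add: add.assoc)
    then show ?case using Suc by (simp add: U_def)
  qed (simp add: U_def)
  have oq: "occ h (n0 + (q * p + m)) = occ h (n0 + m)" for q m
  proof (induction q)
    case (Suc q)
    then show ?case using o[of "q * p + m"] by (simp add: add.assoc)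
  qed simp
  have lenU: "length (U a) \<le> length (U q)" if "a \<le> q" for a q
    using that by (simp add: U_def length_concat sum_list_replicate)
  have "finite ((\<lambda>m. length (h m)) ` {..<n0} \<union> (\<lambda>m. length (w m)) ` {..<p})" by simp
  then obtain D where "\<forall>l\<in>(\<lambda>m. length (h m)) ` {..<n0} \<union> (\<lambda>m. length (w m)) ` {..<p}. l < D"
    using finite_nat_set_iff_bounded by blast
  then have D: "\<And>m. m < n0 \<Longrightarrow> length (h m) < D" "\<And>m. m < p \<Longrightarrow> length (w m) < D" by auto
  obtain Q where Q: "recognizable Q" "\<And>X. finenv X \<Longrightarrow> P X \<longleftrightarrow> Q (node_code h k X)"
    using node_code_decided[OF loc P dep] by blast
  then obtain t :: "(nat \<times> nat \<Rightarrow> bool list set) \<Rightarrow> nat" where t: "decides t Q"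
    using recognizable_def by blast
  define a where "a r Z = (\<lambda>(i, j). if i < k then (\<lambda>n. w (r + n)) ` {n \<in> Z i. occ h (n0 + (r + n)) = j} else {})"
    for r and Z :: "nat \<Rightarrow> nat set"
  \<comment> \<open>Above level \<open>D\<close> nodes of the suffix may mix with nodes of the
    prefix and are recorded literally.\<close>
  define \<kappa>1 where "\<kappa>1 Z = {(r, i, j, z). r < p \<and> i < k \<and> j < M \<and> length z < D \<and> z \<in> a r Z (i, j)}" for Z
  \<comment> \<open>From level \<open>D\<close> on only the suffix is present, so the type of its
    subtree suffices.\<close>
  define \<kappa>2 where "\<kappa>2 Z = {(r, z, q). r < p \<and> length z = D \<and> q = t (\<lambda>i. sub z (a r Z i))}" for Z
  \<comment> \<open>Cuts inside the preperiod are recorded by testing all prefixes. Emptying the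
    coordinates from \<open>k\<close> on leaves finitely many of them and does not affect
    \<open>P\<close>.\<close>
  define \<kappa>3 where "\<kappa>3 Z = {(n, Y). n < n0 \<and> (n, Y) \<in> residual P Z \<and> (\<forall>i. k \<le> i \<longrightarrow> Y i = {})}" for Z
  define \<kappa> where "\<kappa> Z = (\<kappa>1 Z, \<kappa>2 Z, \<kappa>3 Z)" for Z
  show ?thesis
  proof (rule finite_image_factor)
    let ?U1 = "{..<p} \<times> {..<k} \<times> {..<M} \<times> {z :: bool list. length z < D}"
    let ?U2 = "{..<p} \<times> {z :: bool list. length z = D} \<times> range t"
    let ?U3 = "{..<n0} \<times> {Y. \<forall>i. (i \<in> {..<k} \<longrightarrow> Y i \<in> Pow {..<n0}) \<and> (i \<notin> {..<k} \<longrightarrow> Y i = {})}"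
    have "finite {z :: bool list. length z < D}"
      by (rule finite_subset[OF _ finite_lists_length_le[of "UNIV :: bool set" D]]) auto
    moreover have "finite {z :: bool list. length z = D}"
      using finite_lists_length_eq[of "UNIV :: bool set" D] by simp
    ultimately have fin: "finite (Pow ?U1 \<times> Pow ?U2 \<times> Pow ?U3)"
      using decides_finite[OF t] finite_set_of_finite_funs[of "{..<k}" "Pow {..<n0}" "{}"] by simp
    have "\<kappa>1 Z \<in> Pow ?U1" for Z by (auto simp: \<kappa>1_def)
    moreover have "\<kappa>2 Z \<in> Pow ?U2" for Z by (auto simp: \<kappa>2_def)
    moreover have "\<kappa>3 Z \<in> Pow ?U3" for Z
      by (fastforce simp: \<kappa>3_def residual_def)
    ultimately have "\<kappa> Z \<in> Pow ?U1 \<times> Pow ?U2 \<times> Pow ?U3" for Z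
      unfolding \<kappa>_def by (intro SigmaI)
    then show "finite (\<kappa> ` {Z. finenv Z})"
      by (intro finite_subset[OF _ fin] image_subsetI)
  next
    fix Z Z' :: "nat \<Rightarrow> nat set" assume fin: "Z \<in> {Z. finenv Z}" "Z' \<in> {Z. finenv Z}"
      and \<kappa>: "\<kappa> Z = \<kappa> Z'"
    have "P (\<lambda>i. Y i \<union> (\<lambda>x. n + x) ` Z i) \<longleftrightarrow> P (\<lambda>i. Y i \<union> (\<lambda>x. n + x) ` Z' i)"
      if Y: "\<forall>i. Y i \<subseteq> {..<n}" for n Y
    proof (cases "n < n0")
      case True
      define Y' where "Y' i = (if i < k then Y i else {})" for i
      have "P (\<lambda>i. Y i \<union> (\<lambda>x. n + x) ` Z i) \<longleftrightarrow> (n, Y') \<in> \<kappa>3 Z" for Z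
        using True Y dep[of "\<lambda>i. Y i \<union> (\<lambda>x. n + x) ` Z i" "\<lambda>i. Y' i \<union> (\<lambda>x. n + x) ` Z i"]
        by (auto simp: \<kappa>3_def residual_def Y'_def)
      then show ?thesis using \<kappa> by (simp add: \<kappa>_def)
    next
      case False
      define q r where "q = (n - n0) div p" and "r = (n - n0) mod p"
      have n: "n = n0 + (q * p + r)" and r: "r < p" using False p by (simp_all add: q_def r_def)
      define x where "x = v @ U q"
      have hn: "h (n + m) = x @ w (r + m)" for m
        using h[of "q * p + (r + m)"] wq[of q "r + m"] by (simp add: n x_def add.assoc)
      have on: "occ h (n + m) = occ h (n0 + (r + m))" for m
        using oq[of q "r + m"] by (simp add: n add.assoc)
      define X where "X Z = (\<lambda>i. Y i \<union> (\<lambda>x. n + x) ` Z i)" for Z :: "nat \<Rightarrow> nat set"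
      have finX: "finenv (X Z)" if "finenv Z" for Z
        using that Y by (auto simp: X_def intro: finite_subset)
      have code: "node_code h k (X Z) ij = node_code h k Y ij \<union> (@) x ` a r Z ij" for Z ij
      proof -
        obtain i j where ij: "ij = (i, j)" by force
        have "{m \<in> X Z i. occ h m = j} =
            {m \<in> Y i. occ h m = j} \<union> (\<lambda>m. n + m) ` {m \<in> Z i. occ h (n0 + (r + m)) = j}"
          unfolding X_def using on by auto
        then show ?thesis
          by (simp add: ij node_code_def a_def image_Un image_image hn)
      qed
      \<comment> \<open>An earlier number lies in a period \<open>b \<le> q\<close>. Since
        \<open>U b\<close> is not longer than \<open>U q\<close>, its location exceeds
        \<open>x\<close> in length by less than the bound \<open>D\<close> on one period's relative
        nodes.\<close>
      have low: "length y < D" if xy: "x @ y \<in> node_code h k Y ij" for y ij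
      proof -
        obtain i j where ij: "ij = (i, j)" by force
        obtain m where m: "m \<in> Y i" "h m = x @ y"
          using xy by (auto simp: ij node_code_def split: if_splits)
        have mn: "m < n" using m(1) Y by blast
        show ?thesis
        proof (cases "m < n0")
          case True
          then show ?thesis using D(1)[OF True] m(2) by simp
        next
          case False
          define b s where "b = (m - n0) div p" and "s = (m - n0) mod p"
          have ms: "m = n0 + (b * p + s)" "s < p" using False p by (simp_all add: b_def s_def)
          have "b \<le> q" unfolding b_def q_def using mn by (intro div_le_mono) simp
          moreover have "h m = v @ U b @ w s" using h[of "b * p + s"] wq[of b s] ms by simp
          ultimately show ?thesis using m(2) lenU[of b q] D(2)[OF ms(2)] by (auto simp: x_def dest!: arg_cong[of _ _ length])
        qed
      qed
      have eq1: "z \<in> a r Z ij \<longleftrightarrow> z \<in> a r Z' ij" if "length z < D" for z ij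
      proof -
        obtain i j where ij: "ij = (i, j)" by force
        have in_range: "i < k \<and> j < M" if "z \<in> a r Z (i, j)" for Z
          using that loc by (auto simp: a_def location_def split: if_splits)
        have "z \<in> a r Z (i, j) \<longleftrightarrow> (r, i, j, z) \<in> \<kappa>1 Z" for Z
          using in_range[of Z] r that by (auto simp: \<kappa>1_def)
        then show ?thesis using \<kappa> by (simp add: \<kappa>_def ij)
      qed
      have eq2: "t (\<lambda>i. sub z (a r Z i)) = t (\<lambda>i. sub z (a r Z' i))" if "length z = D" for z
      proof -
        have "(r, z, t (\<lambda>i. sub z (a r Z i))) \<in> \<kappa>2 Z" using r that by (simp add: \<kappa>2_def)
        then have "(r, z, t (\<lambda>i. sub z (a r Z i))) \<in> \<kappa>2 Z'" using \<kappa> by (simp add: \<kappa>_def)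
        then show ?thesis by (simp add: \<kappa>2_def)
      qed
      have sub: "sub (x @ z) (node_code h k (X Z) ij) = sub z (a r Z ij)" if "length z = D" for z ij Z
        unfolding code using low[of "z @ _" ij] that by (auto simp: sub_def)
      have "Q (node_code h k (X Z)) \<longleftrightarrow> Q (node_code h k (X Z'))"
      proof (rule decides_frontier[OF t, of _ _ x D])
        show "finenv (node_code h k (X Z))" "finenv (node_code h k (X Z'))"
          using finX fin by (auto simp: node_code_def)
        show "u \<in> node_code h k (X Z) i \<longleftrightarrow> u \<in> node_code h k (X Z') i" if "\<not> prefix x u" for u i
          using that by (auto simp: code)
        show "x @ z \<in> node_code h k (X Z) i \<longleftrightarrow> x @ z \<in> node_code h k (X Z') i" if "length z < D" for z i
          using eq1[OF that, of i] by (auto simp: code simp del: split_paired_All)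
        show "t (\<lambda>i. sub (x @ z) (node_code h k (X Z) i)) = t (\<lambda>i. sub (x @ z) (node_code h k (X Z') i))"
          if "length z = D" for z
          using eq2[OF that] by (simp add: sub[OF that])
      qed
      then show ?thesis using Q(2) finX fin by (simp add: X_def)
    qed
    then show "residual P Z = residual P Z'" unfolding residual_def by blast
  qed
qed

end

section \<open>From finitely many residuals to a formula\<close>

lemma wdef_ex_many:
  assumes "wdef Q"
  shows "wdef (\<lambda>E. \<exists>A. finenv A \<and> Q (\<lambda>i. if i < s then A i else E (i - s)))"
  using assms
proof (induction s arbitrary: Q)
  case 0
  have "(\<exists>A :: nat \<Rightarrow> bool list set. finenv A \<and> Q E) \<longleftrightarrow> Q E" for E
    by (auto intro: exI[of _ "\<lambda>_. {}"])
  then show ?case using 0 by simp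
next
  case (Suc s)
  have "wdef (\<lambda>E. Q (case_nat (E 0) (\<lambda>i. E (Suc i))))"
  proof -
    have "case_nat (E 0) (\<lambda>i. E (Suc i)) = E" for E :: "nat \<Rightarrow> bool list set"
      by (rule ext) (simp split: nat.split)
    then show ?thesis using Suc.prems by simp
  qed
  then have "wdef (\<lambda>E. \<exists>X. finite X \<and> Q (case_nat X E))" by (rule wdef_ex_set)
  then have IH: "wdef (\<lambda>E. \<exists>A. finenv A \<and> (\<exists>X. finite X \<and>
      Q (case_nat X (\<lambda>i. if i < s then A i else E (i - s)))))" by (rule Suc.IH)
  have shift: "case_nat X (\<lambda>i. if i < s then A i else E (i - s)) =
      (\<lambda>i. if i < Suc s then case_nat X A i else E (i - Suc s))" for X A and E :: "nat \<Rightarrow> bool list set"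
    by (rule ext) (simp split: nat.split)
  have "(\<exists>A. finenv A \<and> Q (\<lambda>i. if i < Suc s then A i else E (i - Suc s))) \<longleftrightarrow>
      (\<exists>A. finenv A \<and> (\<exists>X. finite X \<and> Q (case_nat X (\<lambda>i. if i < s then A i else E (i - s)))))" for E
    unfolding shift
  proof
    assume "\<exists>A. finenv A \<and> Q (\<lambda>i. if i < Suc s then A i else E (i - Suc s))"
    then obtain A where A: "finenv A" "Q (\<lambda>i. if i < Suc s then A i else E (i - Suc s))" by blast
    have "(\<lambda>i. if i < Suc s then case_nat (A 0) (\<lambda>i. A (Suc i)) i else E (i - Suc s)) =
        (\<lambda>i. if i < Suc s then A i else E (i - Suc s))"
      by (rule ext) (simp split: nat.split)
    then show "\<exists>A. finenv A \<and> (\<exists>X. finite X \<and> Q (\<lambda>i. if i < Suc s then case_nat X A i else E (i - Suc s)))"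
      using A by (intro exI[of _ "\<lambda>i. A (Suc i)"] conjI exI[of _ "A 0"]) simp_all
  next
    assume "\<exists>A. finenv A \<and> (\<exists>X. finite X \<and> Q (\<lambda>i. if i < Suc s then case_nat X A i else E (i - Suc s)))"
    then obtain A X where "finenv A" "finite X"
      "Q (\<lambda>i. if i < Suc s then case_nat X A i else E (i - Suc s))" by blast
    then show "\<exists>A. finenv A \<and> Q (\<lambda>i. if i < Suc s then A i else E (i - Suc s))"
      by (intro exI[of _ "case_nat X A"]) (simp split: nat.split)
  qed
  then show ?case using IH by simp
qed

text \<open>Surplus free variables are bound existentially. As \<open>P\<close> ignores them, the
  quantifier changes nothing.\<close>

lemma wdef_set_formula:
  assumes "wdef P" and dep: "\<And>E E'. (\<forall>i<k. E i = E' i) \<Longrightarrow> P E \<longleftrightarrow> P E'"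
  shows "\<exists>\<phi>. set_formula k \<phi> \<and> (\<forall>e E. finenv E \<longrightarrow> (P E \<longleftrightarrow> sat Delta2 e E \<phi>))"
proof -
  obtain \<phi> where \<phi>: "free_elem \<phi> = {}" "\<And>e E. finenv E \<Longrightarrow> P E \<longleftrightarrow> sat Delta2 e E \<phi>"
    using assms(1) unfolding wdef_def by blast
  have elim: "\<exists>\<psi>. free_elem \<psi> = {} \<and> free_set \<psi> = free_set \<phi> - S \<and>
      (\<forall>e E. finenv E \<longrightarrow> (P E \<longleftrightarrow> sat Delta2 e E \<psi>))"
    if "finite S" "S \<inter> {..<k} = {}" for S
    using that
  proof (induction rule: finite_induct)
    case empty
    then show ?case using \<phi> by auto
  next
    case (insert X S)
    then obtain \<psi> where \<psi>: "free_elem \<psi> = {}" "free_set \<psi> = free_set \<phi> - S"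
      "\<And>e E. finenv E \<Longrightarrow> P E \<longleftrightarrow> sat Delta2 e E \<psi>" by auto
    have "P E \<longleftrightarrow> sat Delta2 e E (ExSet X \<psi>)" if "finenv E" for e E
    proof -
      have "P E \<longleftrightarrow> P (E(X := A))" for A using insert.prems by (intro dep) auto
      then have "P E \<longleftrightarrow> sat Delta2 e (E(X := A)) \<psi>" if "finite A" for A
        using \<psi>(3)[of "E(X := A)" e] \<open>finenv E\<close> that by simp
      then show ?thesis by auto
    qed
    moreover have "free_elem (ExSet X \<psi>) = {}" "free_set (ExSet X \<psi>) = free_set \<phi> - insert X S"
      using \<psi>(1,2) by auto
    ultimately show ?case by blast
  qed
  have "finite (free_set \<phi> - {..<k})" "(free_set \<phi> - {..<k}) \<inter> {..<k} = {}"
    using finite_free_set[of \<phi>] by auto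
  from elim[OF this] obtain \<psi> where "free_elem \<psi> = {}" "free_set \<psi> = free_set \<phi> - (free_set \<phi> - {..<k})"
    "\<forall>e E. finenv E \<longrightarrow> (P E \<longleftrightarrow> sat Delta2 e E \<psi>)" by blast
  then show ?thesis unfolding set_formula_def by (intro exI[of _ \<psi>] conjI) (auto)
qed

definition tail :: "(nat \<Rightarrow> nat set) \<Rightarrow> nat \<Rightarrow> nat set" where
  "tail Z i = {x. Suc x \<in> Z i}"

text \<open>The first letter of \<open>Z\<close> can be appended to the prefix, as \<open>Y'\<close>
  does. The class of \<open>Z\<close> is therefore a function of this letter and of the class of the
  tail, which makes the automaton on classes deterministic.\<close>

lemma residual_tail:
  assumes dep: "\<And>X X'. (\<forall>i<k. X i = X' i) \<Longrightarrow> P X \<longleftrightarrow> P X'"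
    and bits: "\<forall>i<k. 0 \<in> Z i \<longleftrightarrow> 0 \<in> Z' i"
    and tail: "residual P (tail Z) = residual P (tail Z')"
  shows "residual P Z = residual P Z'"
proof -
  define Y' where "Y' n Y = (\<lambda>i. Y i \<union> (if i < k \<and> 0 \<in> Z i then {n} else {}))" for n and Y :: "nat \<Rightarrow> nat set"
  have "(n, Y) \<in> residual P W \<longleftrightarrow> (\<forall>i. Y i \<subseteq> {..<n}) \<and> (Suc n, Y' n Y) \<in> residual P (tail W)"
    if W: "\<forall>i<k. 0 \<in> Z i \<longleftrightarrow> 0 \<in> W i" for n Y W
  proof -
    have "Y i \<union> (\<lambda>x. n + x) ` W i = Y' n Y i \<union> (\<lambda>x. Suc n + x) ` tail W i" if "i < k" for i
    proof -
      have "(\<lambda>x. n + x) ` W i = (if 0 \<in> W i then {n} else {}) \<union> (\<lambda>x. Suc n + x) ` tail W i"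
      proof (rule set_eqI)
        fix y show "y \<in> (\<lambda>x. n + x) ` W i \<longleftrightarrow> y \<in> (if 0 \<in> W i then {n} else {}) \<union> (\<lambda>x. Suc n + x) ` tail W i"
          by (auto simp: tail_def image_iff) (metis add_Suc_right add.right_neutral not0_implies_Suc)+
      qed
      then show ?thesis using W that by (auto simp: Y'_def)
    qed
    then have "P (\<lambda>i. Y i \<union> (\<lambda>x. n + x) ` W i) \<longleftrightarrow> P (\<lambda>i. Y' n Y i \<union> (\<lambda>x. Suc n + x) ` tail W i)"
      by (intro dep) simp
    moreover have "\<forall>i. Y' n Y i \<subseteq> {..<Suc n}" if "\<forall>i. Y i \<subseteq> {..<n}"
    proof
      fix i
      have "Y i \<subseteq> {..<n}" using that by blast
      then show "Y' n Y i \<subseteq> {..<Suc n}" by (auto simp: Y'_def less_Suc_eq)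
    qed
    ultimately show ?thesis by (auto simp: residual_def)
  qed
  then show ?thesis using bits tail by auto
qed

lemma residual_determines:
  assumes "residual P Z = residual P Z'"
  shows "P Z \<longleftrightarrow> P Z'"
proof -
  have "P W \<longleftrightarrow> (0, \<lambda>_. {}) \<in> residual P W" for W by (simp add: residual_def)
  then show ?thesis using assms by simp
qed

context powerset_presentation
begin

lemma wdef_all_many_nset:
  assumes "wdef (\<lambda>E. Q (\<lambda>i. nset (E i)) (\<lambda>i. E (s + i)))"
    and dep: "\<And>X X' E. (\<forall>i<s. X i = X' i) \<Longrightarrow> Q X E \<longleftrightarrow> Q X' E"
  shows "wdef (\<lambda>E. \<forall>X. finenv X \<longrightarrow> Q X E)"
proof (rule wdef_cong)
  show "wdef (\<lambda>E. \<not> (\<exists>A. finenv A \<and> \<not> Q (\<lambda>i. nset (if i < s then A i else E (i - s))) E))"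
    using wdef_not[OF wdef_ex_many[OF wdef_not[OF assms(1)], of s]] by simp
  fix E
  have "(\<exists>A. finenv A \<and> \<not> Q (\<lambda>i. nset (if i < s then A i else E (i - s))) E) \<longleftrightarrow>
      (\<exists>X. finenv X \<and> \<not> Q X E)"
  proof
    assume "\<exists>X. finenv X \<and> \<not> Q X E"
    then obtain X where X: "finenv X" "\<not> Q X E" by blast
    have "Q (\<lambda>i. nset (if i < s then f (X i) else E (i - s))) E \<longleftrightarrow> Q X E"
      using X(1) by (intro dep) simp
    then show "\<exists>A. finenv A \<and> \<not> Q (\<lambda>i. nset (if i < s then A i else E (i - s))) E"
      using X by (intro exI[of _ "\<lambda>i. f (X i)"]) simp
  next
    assume "\<exists>A. finenv A \<and> \<not> Q (\<lambda>i. nset (if i < s then A i else E (i - s))) E"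
    then obtain A where "\<not> Q (\<lambda>i. nset (if i < s then A i else E (i - s))) E" by blast
    then show "\<exists>X. finenv X \<and> \<not> Q X E"
      by (intro exI[of _ "\<lambda>i. nset (if i < s then A i else E (i - s))"]) simp
  qed
  then show "(\<forall>X. finenv X \<longrightarrow> Q X E) \<longleftrightarrow>
      \<not> (\<exists>A. finenv A \<and> \<not> Q (\<lambda>i. nset (if i < s then A i else E (i - s))) E)" by blast
qed

text \<open>The formula says that every family of sets closed under the transitions of the automaton of
  residuals, read from right to left, reaches an accepting state at position \<open>0\<close>.\<close>

lemma wdef_if_finite_residuals:
  assumes fin: "finite (residual P ` {Z. finenv Z})"
    and dep: "\<And>X X'. (\<forall>i<k. X i = X' i) \<Longrightarrow> P X \<longleftrightarrow> P X'"
  shows "wdef (\<lambda>E. P (\<lambda>i. nset (E i)))"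
proof -
  obtain e s where e: "e ` residual P ` {Z. finenv Z} = {i::nat. i < s}" "inj_on e (residual P ` {Z. finenv Z})"
    using finite_imp_inj_to_nat_seg[OF fin] by blast
  define st where "st Z = e (residual P Z)" for Z
  have st_less: "st Z < s" if "finenv Z" for Z
    using e(1) that unfolding st_def by blast
  have st_eq: "residual P Z = residual P Z'" if "st Z = st Z'" "finenv Z" "finenv Z'" for Z Z'
    using e(2) that unfolding st_def by (auto dest: inj_onD)
  define bits where "bits Z = {i. i < k \<and> 0 \<in> Z i}" for Z :: "nat \<Rightarrow> nat set"
  \<comment> \<open>Transitions lead leftwards: \<open>q\<close> is the state just to the right of a
    position, \<open>b\<close> its letter, and \<open>q'\<close> the state that includes it.\<close>
  define Tr where "Tr = {(b, q, q'). \<exists>Z. finenv Z \<and> b = bits Z \<and> q = st (tail Z) \<and> q' = st Z}"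
  define Acc where "Acc = {q. \<exists>Z. finenv Z \<and> q = st Z \<and> P Z}"
  have fin_tail: "finenv (tail Z)" if "finenv Z" for Z
  proof
    fix i show "finite (tail Z i)"
      unfolding tail_def using finite_vimageI[of "Z i" Suc] that by (simp add: vimage_def)
  qed
  have finTr: "finite Tr"
    by (rule finite_subset[of _ "Pow {..<k} \<times> {..<s} \<times> {..<s}"])
      (auto simp: Tr_def bits_def intro!: st_less fin_tail)
  have Tr_less: "fst (snd \<tau>) < s \<and> snd (snd \<tau>) < s" if "\<tau> \<in> Tr" for \<tau>
    using that by (auto simp: Tr_def intro!: st_less fin_tail)
  have finAcc: "finite Acc" and Acc_less: "\<And>q. q \<in> Acc \<Longrightarrow> q < s"
  proof -
    show less: "q < s" if "q \<in> Acc" for q using that by (auto simp: Acc_def intro: st_less)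
    then show "finite Acc" using finite_subset[of Acc "{..<s}"] by blast
  qed
  define q0 where "q0 = st (\<lambda>_. {})"
  have "q0 < s" unfolding q0_def by (rule st_less) simp
  \<comment> \<open>The start \<open>n\<close> bounds all members of \<open>X\<close>, so the suffix
    there is empty and has state \<open>q0\<close>. The number \<open>z\<close> stands for 0 and
    \<open>m'\<close> for the successor of \<open>m\<close>.\<close>
  define \<Phi> where "\<Phi> X n W \<longleftrightarrow> n \<in> W q0 \<and>
      (\<forall>m m'. m' = Suc m \<longrightarrow> m < n \<longrightarrow> (\<forall>\<tau>\<in>Tr. m' \<in> W (fst (snd \<tau>)) \<and>
        (\<forall>i\<in>{..<k}. m \<in> X i \<longleftrightarrow> i \<in> fst \<tau>) \<longrightarrow> m \<in> W (snd (snd \<tau>)))) \<longrightarrow>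
      (\<exists>q\<in>Acc. \<exists>z. (\<forall>m. z \<le> m) \<and> z \<in> W q)" for X n and W :: "nat \<Rightarrow> nat set"
  have "wdef (\<lambda>E. \<forall>n. (\<forall>i\<in>{..<k}. \<forall>x. x \<in> nset (E i) \<longrightarrow> x < n) \<longrightarrow>
      (\<forall>W. finenv W \<longrightarrow> \<Phi> (\<lambda>i. nset (E i)) n W))"
  proof (intro wdef_all_num wdef_imp wdef_finite_ball finite_lessThan wdef_num_mem wdef_num_less
      wdef_all_many_nset[where s = s])
    show "wdef (\<lambda>E. \<Phi> (\<lambda>i. nset (E (s + Suc i))) (num (E (s + 0))) (\<lambda>i. nset (E i)))"
      unfolding \<Phi>_def
      by (intro pdef_intros wdef_finite_ball[OF finTr] wdef_finite_bex[OF finAcc]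
          wdef_finite_ball[OF finite_lessThan])
    show "\<Phi> (\<lambda>i. nset (E (Suc i))) (num (E 0)) X \<longleftrightarrow> \<Phi> (\<lambda>i. nset (E (Suc i))) (num (E 0)) X'"
      if "\<forall>i<s. X i = X' i" for X X' E
      unfolding \<Phi>_def using that \<open>q0 < s\<close> Tr_less Acc_less by (simp cong: ball_cong bex_cong)
  qed
  moreover have "P X \<longleftrightarrow> (\<forall>n. (\<forall>i\<in>{..<k}. \<forall>x. x \<in> X i \<longrightarrow> x < n) \<longrightarrow> (\<forall>W. finenv W \<longrightarrow> \<Phi> X n W))"
    if X: "finenv X" for X
  proof -
    define drp where "drp m = (\<lambda>i. if i < k then {x. x + m \<in> X i} else {})" for m
    have fin_drp: "finenv (drp m)" for m
    proof
      fix i have "finite ((\<lambda>x. x + m) -` X i)" using X by (intro finite_vimageI) (auto simp: inj_def)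
      then show "finite (drp m i)" by (simp add: drp_def vimage_def)
    qed
    have tail_drp: "tail (drp m) = drp (Suc m)" for m
      by (rule ext) (simp add: tail_def drp_def)
    have drp_empty: "drp n = (\<lambda>_. {})" if n: "\<forall>i\<in>{..<k}. \<forall>x. x \<in> X i \<longrightarrow> x < n" for n
    proof -
      have "x + n \<notin> X i" if "i < k" for i x
        using n that by (metis lessThan_iff not_add_less2)
      then show ?thesis by (intro ext) (simp add: drp_def)
    qed
    have P_drp: "P (drp 0) \<longleftrightarrow> P X" by (rule dep) (simp add: drp_def)
    show ?thesis
    proof
      assume "P X"
      show "\<forall>n. (\<forall>i\<in>{..<k}. \<forall>x. x \<in> X i \<longrightarrow> x < n) \<longrightarrow> (\<forall>W. finenv W \<longrightarrow> \<Phi> X n W)"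
      proof (intro allI impI)
        fix n and W :: "nat \<Rightarrow> nat set"
        assume n: "\<forall>i\<in>{..<k}. \<forall>x. x \<in> X i \<longrightarrow> x < n"
        show "\<Phi> X n W"
          unfolding \<Phi>_def
        proof (intro impI, elim conjE)
          assume W0: "n \<in> W q0" and step: "\<forall>m m'. m' = Suc m \<longrightarrow> m < n \<longrightarrow> (\<forall>\<tau>\<in>Tr. m' \<in> W (fst (snd \<tau>)) \<and>
            (\<forall>i\<in>{..<k}. m \<in> X i \<longleftrightarrow> i \<in> fst \<tau>) \<longrightarrow> m \<in> W (snd (snd \<tau>)))"
          have base: "n \<in> W (st (drp n))" using W0 drp_empty[OF n] by (simp add: q0_def)
          have "0 \<in> W (st (drp 0))"
          proof (rule inc_induct[OF le0, where P = "\<lambda>m. m \<in> W (st (drp m))"])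
            show "n \<in> W (st (drp n))" by (rule base)
            fix m assume m: "m < n" "Suc m \<in> W (st (drp (Suc m)))"
            have "(bits (drp m), st (tail (drp m)), st (drp m)) \<in> Tr"
              unfolding Tr_def using fin_drp by blast
            then have "Suc m \<in> W (st (tail (drp m))) \<and> (\<forall>i\<in>{..<k}. m \<in> X i \<longleftrightarrow> i \<in> bits (drp m)) \<longrightarrow>
                m \<in> W (st (drp m))"
              using step m(1) by (metis fst_conv snd_conv)
            moreover have "\<forall>i\<in>{..<k}. m \<in> X i \<longleftrightarrow> i \<in> bits (drp m)" by (simp add: bits_def drp_def)
            ultimately show "m \<in> W (st (drp m))" using m(2) by (simp add: tail_drp)
          qed
          moreover have "st (drp 0) \<in> Acc" unfolding Acc_def using fin_drp P_drp \<open>P X\<close> by blast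
          ultimately show "\<exists>q\<in>Acc. \<exists>z. (\<forall>m. z \<le> m) \<and> z \<in> W q" by blast
        qed
      qed
    next
      assume *: "\<forall>n. (\<forall>i\<in>{..<k}. \<forall>x. x \<in> X i \<longrightarrow> x < n) \<longrightarrow> (\<forall>W. finenv W \<longrightarrow> \<Phi> X n W)"
      have "finite (\<Union>i\<in>{..<k}. X i)" using X by simp
      then obtain n where "\<forall>x\<in>(\<Union>i\<in>{..<k}. X i). x < n" using finite_nat_set_iff_bounded by blast
      then have n: "\<forall>i\<in>{..<k}. \<forall>x. x \<in> X i \<longrightarrow> x < n" by blast
      \<comment> \<open>The true run, with each position listed under its actual state; it is closed
        under the transitions by \<open>residual_tail\<close>.\<close>
      define W where "W q = {m. m \<le> n \<and> st (drp m) = q}" for q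
      have "finenv W" by (simp add: W_def)
      then have "\<Phi> X n W" using * n by blast
      moreover have "n \<in> W q0"
        using drp_empty[OF n] by (simp add: W_def q0_def)
      moreover have "m \<in> W (snd (snd \<tau>))"
        if m: "m < n" and \<tau>: "\<tau> \<in> Tr" and Suc: "Suc m \<in> W (fst (snd \<tau>))"
          and b: "\<forall>i\<in>{..<k}. m \<in> X i \<longleftrightarrow> i \<in> fst \<tau>" for m \<tau>
      proof -
        obtain Z where Z: "finenv Z" "\<tau> = (bits Z, st (tail Z), st Z)" using \<tau> unfolding Tr_def by auto
        have eq: "residual P (tail Z) = residual P (tail (drp m))"
          using Suc Z fin_tail fin_drp by (intro st_eq) (simp_all add: W_def tail_drp)
        have "\<forall>i<k. 0 \<in> Z i \<longleftrightarrow> 0 \<in> drp m i" using b Z(2) by (simp add: bits_def drp_def)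
        from residual_tail[where P = P and k = k, OF dep this eq]
        have "residual P Z = residual P (drp m)" .
        then show ?thesis using Z m by (simp add: W_def st_def)
      qed
      ultimately obtain q z where q: "q \<in> Acc" "\<forall>m. z \<le> m" "z \<in> W q" unfolding \<Phi>_def by blast
      then have "z = 0" by (metis le_zero_eq)
      obtain Z where Z: "finenv Z" "q = st Z" "P Z" using q(1) unfolding Acc_def by blast
      have "residual P Z = residual P (drp 0)"
        using q(3) Z fin_drp \<open>z = 0\<close> by (intro st_eq) (simp_all add: W_def)
      then show "P X" using residual_determines Z(3) P_drp by blast
    qed
  qed
  ultimately show ?thesis by simp
qed

section \<open>Passing between presentations of the expansion and definable predicates\<close>

lemma wdef_relation:
  assumes "presentation Delta2 (expand (weak_powerset Delta1) k R) f"
  shows "wdef (\<lambda>E. map (\<lambda>i. nset (E i)) [0..<k] \<in> R)"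
proof -
  have "univ (expand (weak_powerset Delta1) k R) = {X. finite X}"
    "arity (expand (weak_powerset Delta1) k R) New = k" "interp (expand (weak_powerset Delta1) k R) New = R"
    using univ_weak_powerset by (simp_all add: expand_def)
  then obtain \<phi> where \<phi>: "set_formula k \<phi>"
    and us: "\<forall>us\<in>tuples k {X. finite X}. us \<in> R \<longleftrightarrow> holds Delta2 \<phi> (map f us)"
    using assms unfolding presentation_def by metis
  \<comment> \<open>The formula for \<open>R\<close> speaks about codes, but \<open>E\<close> may
    contain sets that are none. The first \<open>k\<close> variables are quantified codes decoding
    to the same sets as the original variables, which are shifted to \<open>k + i\<close>.\<close>
  let ?Q = "\<lambda>E. (\<forall>i\<in>{..<k}. E i \<in> codes \<and> nset (E i) \<subseteq> nset (E (k + i)) \<and> nset (E (k + i)) \<subseteq> nset (E i)) \<and>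
    holds Delta2 \<phi> (map E [0..<k])"
  have "wdef ?Q"
    by (intro wdef_conj wdef_finite_ball finite_lessThan wdef_code wdef_nset_subset wdef_holds[OF \<phi>]) simp
  have map_eq: "map (\<lambda>i. if i < k then A i else E (i - k)) [0..<k] = map A [0..<k]"
    for A E :: "nat \<Rightarrow> bool list set" by simp
  from wdef_ex_many[OF \<open>wdef ?Q\<close>, of k]
  have "wdef (\<lambda>E. \<exists>A. finenv A \<and> (\<forall>i\<in>{..<k}. A i \<in> codes \<and> nset (A i) = nset (E i)) \<and>
      holds Delta2 \<phi> (map A [0..<k]))"
    by (simp add: map_eq set_eq_subset)
  moreover have "map (\<lambda>i. nset (E i)) [0..<k] \<in> R \<longleftrightarrow>
      (\<exists>A. finenv A \<and> (\<forall>i\<in>{..<k}. A i \<in> codes \<and> nset (A i) = nset (E i)) \<and> holds Delta2 \<phi> (map A [0..<k]))"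
    for E
  proof -
    have "map (\<lambda>i. nset (E i)) [0..<k] \<in> tuples k {X. finite X}" by (auto simp: tuples_def)
    then have R: "map (\<lambda>i. nset (E i)) [0..<k] \<in> R \<longleftrightarrow> holds Delta2 \<phi> (map (\<lambda>i. f (nset (E i))) [0..<k])"
      using us by (simp add: comp_def)
    have A: "map A [0..<k] = map (\<lambda>i. f (nset (E i))) [0..<k]"
      if "\<forall>i\<in>{..<k}. A i \<in> codes \<and> nset (A i) = nset (E i)" for A
    proof (rule map_cong)
      fix i assume "i \<in> set [0..<k]"
      then have "A i \<in> codes" "nset (A i) = nset (E i)" using that by simp_all
      then show "A i = f (nset (E i))" using f_nset[of "A i"] by simp
    qed simp
    show ?thesis
    proof
      assume "map (\<lambda>i. nset (E i)) [0..<k] \<in> R"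
      then show "\<exists>A. finenv A \<and> (\<forall>i\<in>{..<k}. A i \<in> codes \<and> nset (A i) = nset (E i)) \<and>
          holds Delta2 \<phi> (map A [0..<k])"
        using R by (intro exI[of _ "\<lambda>i. f (nset (E i))"]) simp
    next
      assume "\<exists>A. finenv A \<and> (\<forall>i\<in>{..<k}. A i \<in> codes \<and> nset (A i) = nset (E i)) \<and>
          holds Delta2 \<phi> (map A [0..<k])"
      then obtain A where "\<forall>i\<in>{..<k}. A i \<in> codes \<and> nset (A i) = nset (E i)"
        "holds Delta2 \<phi> (map A [0..<k])" by blast
      then show "map (\<lambda>i. nset (E i)) [0..<k] \<in> R" using R A[of A] by simp
    qed
  qed
  ultimately show ?thesis by simp
qed

lemma presentation_expand_if_wdef:
  assumes "wdef (\<lambda>E. map (\<lambda>i. nset (E i)) [0..<k] \<in> R)"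
  shows "presentation Delta2 (expand (weak_powerset Delta1) k R) f"
proof -
  let ?S = "expand (weak_powerset Delta1) k R"
  have "\<exists>\<phi>. set_formula k \<phi> \<and> (\<forall>e E. finenv E \<longrightarrow>
      (map (\<lambda>i. nset (E i)) [0..<k] \<in> R \<longleftrightarrow> sat Delta2 e E \<phi>))"
  proof (rule wdef_set_formula[OF assms])
    fix E E' :: "nat \<Rightarrow> bool list set" assume "\<forall>i<k. E i = E' i"
    then have "map (\<lambda>i. nset (E i)) [0..<k] = map (\<lambda>i. nset (E' i)) [0..<k]" by simp
    then show "map (\<lambda>i. nset (E i)) [0..<k] \<in> R \<longleftrightarrow> map (\<lambda>i. nset (E' i)) [0..<k] \<in> R" by (rule arg_cong)
  qed
  then obtain \<phi> where \<phi>: "set_formula k \<phi>" "\<And>e E. finenv E \<Longrightarrow>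
      map (\<lambda>i. nset (E i)) [0..<k] \<in> R \<longleftrightarrow> sat Delta2 e E \<phi>" by blast
  have new: "us \<in> R \<longleftrightarrow> holds Delta2 \<phi> (map f us)" if "us \<in> tuples k {X. finite X}" for us
  proof -
    define E where "E i = (if i < length (map f us) then map f us ! i else {})" for i
    have us: "length us = k" "\<And>i. i < k \<Longrightarrow> finite (us ! i)" using that nth_mem by (fastforce simp: tuples_def)+
    then have "finenv E" by (simp add: E_def)
    moreover have "map (\<lambda>i. nset (E i)) [0..<k] = us"
      using us by (intro nth_equalityI) (simp_all add: E_def)
    ultimately show ?thesis using \<phi>(2)[of E] by (simp add: holds_def E_def[abs_def])
  qed
  have "\<exists>\<phi>. set_formula (arity ?S s) \<phi> \<and>
      (\<forall>us\<in>tuples (arity ?S s) (univ ?S). us \<in> interp ?S s \<longleftrightarrow> holds Delta2 \<phi> (map f us))" for s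
  proof (cases s)
    case (Old r)
    then show ?thesis using pres unfolding presentation_def by (simp add: expand_def)
  next
    case New
    then show ?thesis using \<phi>(1) new univ_weak_powerset by (simp add: expand_def) blast
  qed
  then show ?thesis using pres unfolding presentation_def by (simp add: expand_def)
qed

end

theorem theorem5p7:
  fixes k :: nat and R :: "nat set list set"
  assumes "R \<subseteq> tuples k (univ (weak_powerset Delta1))"
    and "\<exists>f. presentation Delta2 (weak_powerset Delta1) f \<and>
             definable_in Delta2 (weak_powerset Delta1) f k R"
  shows "\<forall>g. presentation Delta2 (weak_powerset Delta1) g \<longrightarrow>
             definable_in Delta2 (weak_powerset Delta1) g k R"
proof (intro allI impI)
  fix g assume g: "presentation Delta2 (weak_powerset Delta1) g"
  obtain f where f: "presentation Delta2 (weak_powerset Delta1) f"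
    "presentation Delta2 (expand (weak_powerset Delta1) k R) f"
    using assms(2) unfolding definable_in_def by blast
  interpret f: powerset_presentation f by unfold_locales (rule f(1))
  interpret g: powerset_presentation g by unfold_locales (rule g)
  define P where "P X \<longleftrightarrow> map X [0..<k] \<in> R" for X
  have dep: "P X \<longleftrightarrow> P X'" if "\<forall>i<k. X i = X' i" for X X'
  proof -
    have "map X [0..<k] = map X' [0..<k]" using that by simp
    then show ?thesis unfolding P_def by (rule arg_cong)
  qed
  \<comment> \<open>This statement concerns numbers alone, and it is the only information that
    passes from \<open>f\<close> to \<open>g\<close>.\<close>
  have "finite (residual P ` {Z. finenv Z})"
    using f.wdef_relation[OF f(2)] dep by (intro f.finite_residuals[where k = k]) (simp_all add: P_def)
  then have "wdef (\<lambda>E. P (\<lambda>i. g.nset (E i)))"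
    using dep by (rule g.wdef_if_finite_residuals)
  then show "definable_in Delta2 (weak_powerset Delta1) g k R"
    unfolding definable_in_def P_def by (rule g.presentation_expand_if_wdef)
qed

end
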